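(* Let $H$ be a graph that is isomorphic to an induced subgraph of the hypercube $Q_k$ for some $k$. Then there is a constant $c = c(H)$ such that for every $n$ there exists a packing of $Q_n$ by induced copies of $H$ in which at most $O(n^c)$ vertices of $Q_n$ remain uncovered (the implied constant depending only on $H$).
   Context: $Q_n$ denotes the $n$-dimensional hypercube: vertex set $\{0,1\}^n$, two vertices adjacent iff they differ in exactly one coordinate. An induced copy of $H$ in a graph $G$ is an induced subgraph of $G$ isomorphic to $H$. A packing of $G$ by induced copies of $H$ is a collection of pairwise vertex-disjoint induced copies of $H$ in $G$; a vertex is uncovered if it lies in none of them. *)

theory Defs
  imports
    Complex_Main
    "HOL-Library.Landau_Symbols"
    "Graph_Theory.Graph_Theory"
begin

text \<open>
  Simple graphs are symmetric loop-free digraphs whose arcs are pairs of vertices (locale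
  \<open>pair_graph\<close>); an edge is represented by its two orientations. The vertex set \<open>{0,1}\<^sup>n\<close> of
  the hypercube is the set of Boolean lists of length \<open>n\<close>.
\<close>

definition hypercube :: "nat \<Rightarrow> bool list pair_pre_digraph" where
  "hypercube n =
     \<lparr> pverts = {x. length x = n},
       parcs = {(x, y). length x = n \<and> length y = n \<and> card {i. i < n \<and> x ! i \<noteq> y ! i} = 1} \<rparr>"

lemma finite_pverts_hypercube: "finite (pverts (hypercube n))"
  using finite_lists_length_eq[of "UNIV :: bool set" n] by (simp add: hypercube_def)

lemma card_pverts_hypercube: "card (pverts (hypercube n)) = 2 ^ n"
  using card_lists_length_eq[of "UNIV :: bool set" n] by (simp add: hypercube_def)

lemma pair_graph_hypercube: "pair_graph (hypercube n)"
proof -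
  let ?d = "\<lambda>x y :: bool list. {i. i < n \<and> x ! i \<noteq> y ! i}"
  have V: "pverts (hypercube n) = {x. length x = n}"
    by (simp add: hypercube_def)
  have E: "(x, y) \<in> parcs (hypercube n) \<longleftrightarrow> length x = n \<and> length y = n \<and> card (?d x y) = 1"
    for x y by (simp only: hypercube_def pair_pre_digraph.simps mem_Collect_eq prod.case)
  have sub: "parcs (hypercube n) \<subseteq> pverts (hypercube n) \<times> pverts (hypercube n)"
    by (rule subrelI) (simp only: E V mem_Sigma_iff mem_Collect_eq)
  then have fin: "finite (parcs (hypercube n))"
    using finite_pverts_hypercube finite_SigmaI finite_subset by meson
  have d_sym: "?d y x = ?d x y" for x y
    by blast
  have "sym (parcs (hypercube n))"
    by (rule symI) (simp only: E d_sym)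
  then have symm: "symmetric (with_proj (hypercube n))"
    by (simp only: symmetric_def with_proj_simps)
  have "?d x x = {}" for x
    by blast
  then have "card (?d x x) = 0" for x
    by (simp only: card.empty)
  then have irrefl: "(x, x) \<notin> parcs (hypercube n)" for x
    by (simp only: E) linarith
  show ?thesis
  proof
    fix e
    assume e: "e \<in> parcs (hypercube n)"
    then show "fst e \<in> pverts (hypercube n)" "snd e \<in> pverts (hypercube n)"
      using sub by (metis mem_Times_iff subsetD)+
    show "fst e \<noteq> snd e"
      using e irrefl by (metis prod.collapse)
  qed (fact fin finite_pverts_hypercube symm)+
qed

text \<open>A copy is the subgraph itself, not an embedding of \<open>H\<close>.\<close>

definition induced_copy ::
  "('a, 'b) pre_digraph \<Rightarrow> ('v, 'e) pre_digraph \<Rightarrow> ('v, 'e) pre_digraph \<Rightarrow> bool" where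
  "induced_copy H G C \<longleftrightarrow> induced_subgraph C G \<and> digraph_iso H C"

definition induced_packing ::
  "('a, 'b) pre_digraph \<Rightarrow> ('v, 'e) pre_digraph \<Rightarrow> ('v, 'e) pre_digraph set \<Rightarrow> bool" where
  "induced_packing H G P \<longleftrightarrow>
     (\<forall>C\<in>P. induced_copy H G C) \<and> pairwise (\<lambda>C D. disjnt (verts C) (verts D)) P"

definition uncovered :: "('v, 'e) pre_digraph \<Rightarrow> ('v, 'e) pre_digraph set \<Rightarrow> 'v set" where
  "uncovered G P = verts G - (\<Union>C\<in>P. verts C)"

end

theory Submission
  imports Defs "HOL-Library.Disjoint_Sets" "HOL-Library.FuncSet"
begin

text \<open>
  Identify \<open>{0,1}\<^sup>n\<close> with \<open>Pow {..<n}\<close> and let \<open>S \<subseteq> Pow {..<k}\<close> be the vertex set of a copy of \<open>H\<close>,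
  translated so that \<open>{} \<in> S\<close>; the tiles are the images of \<open>S\<close> under injections of the coordinates
  followed by translations.

  Gadgets. Families \<open>A\<close>, \<open>B\<close> are exchangeable if some \<open>X\<close>, which can be chosen to avoid any prescribed
  finite family, makes both \<open>X \<union> A\<close> and \<open>X \<union> B\<close> tileable. Comparing tiles that differ in one
  coordinate, \<open>k\<close> times over, shows in the group ring of the cube that
  \<open>\<Prod>i<k. (1 - t\<^sub>i x\<^sub>i)\<close> vanishes modulo tiles, in the sense that its positive and negative terms are
  exchangeable. Hence every point is exchangeable with a family in fresh coordinates. Since the
  translates of \<open>S\<close> cover \<open>Pow {..<k}\<close> uniformly, \<open>card S\<close> disjoint equivalents of \<open>Pow {..<k}\<close> are
  exchangeable with \<open>{}\<close>; this gives an absorber in a cube of constant dimension.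

  Modular cover. Toggling the middle of a pattern \<open>001\<close> or \<open>110\<close> moves a change of the bit string to
  the left, so all strings with at least \<open>k\<close> such patterns are tops of tiles that are otherwise lower.
  Solving a triangular system yields boundedly many colour classes of disjoint tiles covering each such
  string \<open>-1\<close> modulo \<open>card S\<close> times. Only polynomially many strings have fewer than \<open>k\<close> patterns.

  Split the cube as \<open>Q\<^sub>q \<times> Q\<^sub>p \<times> Q\<^sub>n\<close> with \<open>q\<close>, \<open>p\<close> constant. The first two factors are tiled up to sparse
  leftovers; the product of the leftovers is covered by extra tiles in the first direction, and the
  holes so created are completed, using the modular cover in the third direction, to a
  multiple of \<open>card S\<close>, which the absorber in the second direction repairs.
\<close>


section \<open>Tiles and exchangeable families\<close>

definition xr :: "'a set \<Rightarrow> 'a set \<Rightarrow> 'a set" (infixl "\<triangle>" 65) where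
  "x \<triangle> y = {i. (i \<in> x) \<noteq> (i \<in> y)}"

lemma mem_xr [simp]: "i \<in> x \<triangle> y \<longleftrightarrow> (i \<in> x) \<noteq> (i \<in> y)"
  by (simp add: xr_def)

lemma xr_assoc: "x \<triangle> y \<triangle> z = x \<triangle> (y \<triangle> z)"
  and xr_commute: "x \<triangle> y = y \<triangle> x"
  and xr_left_commute: "x \<triangle> (y \<triangle> z) = y \<triangle> (x \<triangle> z)"
  by (auto simp: set_eq_iff)

lemmas xr_ac = xr_assoc xr_commute xr_left_commute

lemma xr_empty [simp]: "x \<triangle> {} = x" "{} \<triangle> x = x"
  and xr_self [simp]: "x \<triangle> x = {}"
  and xr_cancel [simp]: "x \<triangle> (x \<triangle> y) = y"
  and xr_left_inj [simp]: "x \<triangle> y = x \<triangle> z \<longleftrightarrow> y = z"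
  and xr_right_inj [simp]: "y \<triangle> x = z \<triangle> x \<longleftrightarrow> y = z"
  by (auto simp: set_eq_iff)

lemma xr_subset: "x \<subseteq> A \<Longrightarrow> y \<subseteq> A \<Longrightarrow> x \<triangle> y \<subseteq> A"
  by auto

lemma xr_disjoint: "x \<inter> y = {} \<Longrightarrow> x \<triangle> y = x \<union> y"
  by (auto simp: set_eq_iff)

lemma finite_xr [simp]: "finite x \<Longrightarrow> finite y \<Longrightarrow> finite (x \<triangle> y)"
  by (rule finite_subset[of _ "x \<union> y"]) auto

lemma image_xr: "inj f \<Longrightarrow> f ` (x \<triangle> y) = f ` x \<triangle> f ` y"
  by (auto simp: set_eq_iff inj_image_mem_iff inj_eq)

text \<open>This is the sumset in the group of subsets under symmetric difference. When
  \<open>A\<close> and \<open>B\<close> live on disjoint coordinates each element arises from only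
  one pair, so the set then represents a product in the group ring.\<close>

definition mul :: "'a set set \<Rightarrow> 'a set set \<Rightarrow> 'a set set" (infixl "\<odot>" 75) where
  "A \<odot> B = {a \<triangle> b | a b. a \<in> A \<and> b \<in> B}"

lemma mulI: "a \<in> A \<Longrightarrow> b \<in> B \<Longrightarrow> a \<triangle> b \<in> A \<odot> B"
  by (auto simp: mul_def)

lemma mulE: "x \<in> A \<odot> B \<Longrightarrow> (\<And>a b. x = a \<triangle> b \<Longrightarrow> a \<in> A \<Longrightarrow> b \<in> B \<Longrightarrow> thesis) \<Longrightarrow> thesis"
  by (auto simp: mul_def)

lemma mul_commute: "A \<odot> B = B \<odot> A"
  unfolding mul_def by (metis (no_types, opaque_lifting) xr_commute)

lemma mul_Un_left: "(A \<union> B) \<odot> C = A \<odot> C \<union> B \<odot> C"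
  and mul_Un_right: "C \<odot> (A \<union> B) = C \<odot> A \<union> C \<odot> B"
  by (auto simp: mul_def)

lemma mul_empty [simp]: "{} \<odot> A = {}" "A \<odot> {} = {}" "{{}} \<odot> A = A" "A \<odot> {{}} = A"
  by (auto simp: mul_def)

lemma mul_singleton: "{g} \<odot> A = (\<lambda>x. g \<triangle> x) ` A"
  by (auto simp: mul_def)

lemma mul_assoc: "A \<odot> B \<odot> C = A \<odot> (B \<odot> C)"
  unfolding mul_def by (auto simp: xr_assoc) (metis xr_assoc)+

lemma mul_UN: "A \<odot> B = (\<Union>a\<in>A. {a} \<odot> B)"
  by (auto simp: mul_def)

lemma Union_mul: "\<Union>(A \<odot> B) \<subseteq> \<Union>A \<union> \<Union>B"
  by (auto simp: mul_def)

lemma finite_Union_mul [simp]: "finite (\<Union>A) \<Longrightarrow> finite (\<Union>B) \<Longrightarrow> finite (\<Union>(A \<odot> B))"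
  by (rule finite_subset[OF Union_mul]) auto

lemma finite_of_Union: "finite (\<Union>A) \<Longrightarrow> finite A"
  by (rule finite_UnionD)

text \<open>Intersecting with \<open>C\<close> recovers \<open>a\<close> and removes
  \<open>p\<close>, so both parts of a sum on separated coordinates can be read off.\<close>

lemma xr_separated:
  assumes "a \<triangle> p = a' \<triangle> p'" "a \<subseteq> C" "a' \<subseteq> C" "p \<inter> C = {}" "p' \<inter> C = {}"
  shows "a = a'" "p = p'"
proof -
  have "(a \<triangle> p) \<inter> C = a" "(a' \<triangle> p') \<inter> C = a'"
    using assms(2-) by auto
  then show "a = a'" using assms(1) by simp
  then show "p = p'" using assms(1) by simp
qed

text \<open>A common element would have the same part inside \<open>C\<close> and the same part
  outside it. Most disjointness claims in the gluing arguments reduce to this.\<close>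

lemma mul_disjoint:
  assumes "\<Union>A \<subseteq> C" "\<Union>A' \<subseteq> C" "\<Union>P \<inter> C = {}" "\<Union>P' \<inter> C = {}" "A \<inter> A' = {} \<or> P \<inter> P' = {}"
  shows "(A \<odot> P) \<inter> (A' \<odot> P') = {}"
proof (rule ccontr)
  assume "(A \<odot> P) \<inter> (A' \<odot> P') \<noteq> {}"
  then obtain a p a' p' where *: "a \<in> A" "p \<in> P" "a' \<in> A'" "p' \<in> P'" "a \<triangle> p = a' \<triangle> p'"
    by (auto simp: mul_def)
  moreover have "a = a'" "p = p'"
    using xr_separated[OF *(5), of C] assms(1-4) * by blast+
  ultimately show False using assms(5) by auto
qed

section \<open>Tiles and tileable families\<close>

locale shape =
  fixes k :: nat and S :: "nat set set"
  assumes S_sub: "S \<subseteq> Pow {..<k}" and empty_S: "{} \<in> S"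
begin

lemma finite_S: "finite S"
  using S_sub finite_subset by blast

text \<open>The ambient space consists of all sets of naturals, so fresh coordinates are always
  available; a bound \<open>Pow {..<n}\<close> is imposed separately where it matters. Since
  \<open>{} \<in> S\<close>, the translation \<open>g\<close> is itself a point of the tile.\<close>

definition tile :: "nat set set \<Rightarrow> bool" where
  "tile N \<longleftrightarrow> (\<exists>g f. inj_on f {..<k} \<and> N = (\<lambda>s. g \<triangle> f ` s) ` S)"

definition tileable :: "nat set set \<Rightarrow> bool" where
  "tileable A \<longleftrightarrow> (\<exists>\<P>. (\<forall>N\<in>\<P>. tile N) \<and> pairwise disjnt \<P> \<and> \<Union>\<P> = A)"

lemma tileI: "inj_on f {..<k} \<Longrightarrow> tile ((\<lambda>s. g \<triangle> f ` s) ` S)"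
  by (auto simp: tile_def)

lemma tileable_tile: "tile N \<Longrightarrow> tileable N"
  unfolding tileable_def by (rule exI[of _ "{N}"]) simp

lemma tileable_empty [simp]: "tileable {}"
  unfolding tileable_def by (rule exI[of _ "{}"]) simp

lemma tileable_UN:
  assumes "\<And>i. i \<in> I \<Longrightarrow> tileable (A i)" "disjoint_family_on A I"
  shows "tileable (\<Union>i\<in>I. A i)"
proof -
  obtain \<P> where \<P>: "\<And>i N. i \<in> I \<Longrightarrow> N \<in> \<P> i \<Longrightarrow> tile N"
    "\<And>i. i \<in> I \<Longrightarrow> pairwise disjnt (\<P> i)" "\<And>i. i \<in> I \<Longrightarrow> \<Union>(\<P> i) = A i"
    using assms(1) unfolding tileable_def by metis
  have "disjnt N M" if "i \<in> I" "N \<in> \<P> i" "j \<in> I" "M \<in> \<P> j" "N \<noteq> M" for i j N M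
  proof (cases "i = j")
    case True then show ?thesis using that \<P>(2) by (auto simp: pairwise_def)
  next
    case False
    then have "A i \<inter> A j = {}" using assms(2) that by (auto simp: disjoint_family_on_def)
    then show ?thesis using \<P>(3) that unfolding disjnt_def by blast
  qed
  moreover have "\<Union>(\<Union>i\<in>I. \<P> i) = (\<Union>i\<in>I. A i)"
    using \<P>(3) by blast
  ultimately show ?thesis
    unfolding tileable_def using \<P>(1)
    by (intro exI[of _ "\<Union>i\<in>I. \<P> i"]) (auto simp: pairwise_def)
qed

lemma tileable_Un:
  assumes "tileable A" "tileable B" "A \<inter> B = {}"
  shows "tileable (A \<union> B)"
proof -
  have "tileable (\<Union>i\<in>{True, False}. if i then A else B)"
    by (rule tileable_UN) (use assms in \<open>auto simp: disjoint_family_on_def\<close>)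
  then show ?thesis by (simp add: Un_commute)
qed

lemma tile_map:
  assumes "inj \<phi>" "tile N"
  shows "tile ((\<lambda>x. g \<triangle> \<phi> ` x) ` N)"
proof -
  obtain g0 f where *: "inj_on f {..<k}" "N = (\<lambda>s. g0 \<triangle> f ` s) ` S"
    using assms(2) by (auto simp: tile_def)
  have "(\<lambda>x. g \<triangle> \<phi> ` x) ` N = (\<lambda>s. (g \<triangle> \<phi> ` g0) \<triangle> (\<phi> \<circ> f) ` s) ` S"
    unfolding *(2) image_image by (simp add: image_xr[OF assms(1)] xr_assoc image_comp)
  moreover have "inj_on (\<phi> \<circ> f) {..<k}"
    using * assms(1) by (simp add: comp_inj_on inj_on_subset)
  ultimately show ?thesis by (metis tileI)
qed

text \<open>Renaming coordinates injectively and then translating sends tiles to tiles, and the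
  induced map on sets is injective, so disjointness survives.\<close>

lemma tileable_map:
  assumes "inj \<phi>" "tileable A"
  shows "tileable ((\<lambda>x. g \<triangle> \<phi> ` x) ` A)"
proof -
  obtain \<P> where \<P>: "\<And>N. N \<in> \<P> \<Longrightarrow> tile N" "pairwise disjnt \<P>" "\<Union>\<P> = A"
    using assms(2) by (auto simp: tileable_def)
  let ?m = "\<lambda>x. g \<triangle> \<phi> ` x"
  have "inj ?m" using assms(1) by (auto simp: inj_def inj_image_eq_iff)
  then have "disjoint_family_on (\<lambda>N. ?m ` N) \<P>"
    using \<P>(2) unfolding disjoint_family_on_def pairwise_def disjnt_def
    by (metis image_Int image_empty)
  then have "tileable (\<Union>N\<in>\<P>. ?m ` N)"
    by (intro tileable_UN tileable_tile tile_map assms \<P>(1))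
  moreover have "(\<Union>N\<in>\<P>. ?m ` N) = ?m ` A" using \<P>(3) by auto
  ultimately show ?thesis by simp
qed

lemma tileable_translate: "tileable A \<Longrightarrow> tileable ({g} \<odot> A)"
  using tileable_map[of "\<lambda>x. x" A g] by (simp add: mul_singleton)

text \<open>The part of a point inside \<open>C\<close> is its base point \<open>y\<close>, so
  fibres over different base points cannot meet. In this way tilings in one group of coordinates are
  repeated along another.\<close>

lemma tileable_fibres:
  assumes "\<And>y. y \<in> G \<Longrightarrow> tileable (A y)" "\<And>y. y \<in> G \<Longrightarrow> \<Union>(A y) \<inter> C = {}" "\<Union>G \<subseteq> C"
  shows "tileable (\<Union>y\<in>G. {y} \<odot> A y)"
proof (intro tileable_UN tileable_translate assms)
  show "disjoint_family_on (\<lambda>y. {y} \<odot> A y) G"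
    unfolding disjoint_family_on_def
  proof (intro ballI impI)
    fix m n assume "m \<in> G" "n \<in> G" "m \<noteq> n"
    then show "({m} \<odot> A m) \<inter> ({n} \<odot> A n) = {}"
      using assms(2,3) by (intro mul_disjoint[of _ C]) auto
  qed
qed auto

definition exch :: "nat set set \<Rightarrow> nat set set \<Rightarrow> bool" where
  "exch A B \<longleftrightarrow> finite (\<Union>A) \<and> finite (\<Union>B) \<and> (\<forall>F. finite (\<Union>F) \<longrightarrow>
     (\<exists>X. finite (\<Union>X) \<and> X \<inter> (F \<union> A \<union> B) = {} \<and> tileable (X \<union> A) \<and> tileable (X \<union> B)))"

lemma abE:
  assumes "exch A B" "finite (\<Union>F)"
  obtains X where "finite (\<Union>X)" "X \<inter> F = {}" "X \<inter> A = {}" "X \<inter> B = {}" "tileable (X \<union> A)" "tileable (X \<union> B)"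
proof -
  obtain X where "finite (\<Union>X)" "X \<inter> (F \<union> A \<union> B) = {}" "tileable (X \<union> A)" "tileable (X \<union> B)"
    using assms unfolding exch_def by metis
  then show thesis by (intro that[of X]) auto
qed

lemma exch_finite: "exch A B \<Longrightarrow> finite (\<Union>A)" "exch A B \<Longrightarrow> finite (\<Union>B)"
  by (auto simp: exch_def)

lemma exch_sym: "exch A B \<Longrightarrow> exch B A"
  unfolding exch_def by (simp add: Un_ac) (metis Un_commute)

lemma exch_tileable: "tileable A \<Longrightarrow> finite (\<Union>A) \<Longrightarrow> exch A {}"
  unfolding exch_def by (auto intro!: exI[of _ "{}"])

text \<open>The second remainder is chosen after the first and avoids it together with all four
  families, so both exchanges take place side by side.\<close>

lemma exch_Un:
  assumes "exch A B" "exch C D" "A \<inter> C = {}" "B \<inter> D = {}"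
  shows "exch (A \<union> C) (B \<union> D)"
  unfolding exch_def
proof (intro conjI allI impI)
  show "finite (\<Union>(A \<union> C))" "finite (\<Union>(B \<union> D))"
    using assms(1,2) by (auto simp: exch_def)
  fix F :: "nat set set" assume F: "finite (\<Union>F)"
  have fin: "finite (\<Union>(F \<union> A \<union> B \<union> C \<union> D))"
    using F assms(1,2) by (auto simp: exch_def)
  obtain X where X: "finite (\<Union>X)" "X \<inter> (F \<union> A \<union> B \<union> C \<union> D) = {}" "tileable (X \<union> A)" "tileable (X \<union> B)"
    by (rule abE[OF assms(1) fin]) blast
  have fin': "finite (\<Union>(F \<union> A \<union> B \<union> C \<union> D \<union> X))" using fin X(1) by auto
  obtain Y where Y: "finite (\<Union>Y)" "Y \<inter> (F \<union> A \<union> B \<union> C \<union> D \<union> X) = {}" "tileable (Y \<union> C)" "tileable (Y \<union> D)"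
    by (rule abE[OF assms(2) fin']) blast
  have "tileable ((X \<union> A) \<union> (Y \<union> C))" "tileable ((X \<union> B) \<union> (Y \<union> D))"
    by (rule tileable_Un; use X Y assms in blast)+
  then have "tileable (X \<union> Y \<union> (A \<union> C))" "tileable (X \<union> Y \<union> (B \<union> D))"
    by (simp_all add: Un_ac)
  then show "\<exists>X. finite (\<Union>X) \<and> X \<inter> (F \<union> (A \<union> C) \<union> (B \<union> D)) = {} \<and> tileable (X \<union> (A \<union> C)) \<and> tileable (X \<union> (B \<union> D))"
    using X(1,2) Y(1,2) by (intro exI[of _ "X \<union> Y"]) auto
qed

lemma exch_empty [simp]: "exch {} {}"
  by (rule exch_tileable) auto

lemma exch_UN:
  assumes "finite I" "\<And>i. i \<in> I \<Longrightarrow> exch (A i) (B i)" "disjoint_family_on A I" "disjoint_family_on B I"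
  shows "exch (\<Union>i\<in>I. A i) (\<Union>i\<in>I. B i)"
  using assms
proof (induction I rule: finite_induct)
  case empty then show ?case by simp
next
  case (insert i I)
  then have "exch (A i \<union> (\<Union>i\<in>I. A i)) (B i \<union> (\<Union>i\<in>I. B i))"
    by (intro exch_Un insert.IH) (auto simp: disjoint_family_on_def)
  then show ?case by simp
qed

text \<open>A common part \<open>R\<close> that can be moved off any prescribed family may be merged
  with the remainder \<open>X\<close>.\<close>

lemma exch_cancel_fresh:
  assumes "finite (\<Union>A)" "finite (\<Union>B)"
    and "\<And>F. finite (\<Union>F) \<Longrightarrow> \<exists>R. R \<inter> F = {} \<and> exch (A \<union> R) (B \<union> R)"
  shows "exch A B"
  unfolding exch_def
proof (intro conjI allI impI assms)
  fix F :: "nat set set" assume F: "finite (\<Union>F)"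
  then have "finite (\<Union>(F \<union> A \<union> B))" using assms by auto
  then obtain R where R: "R \<inter> (F \<union> A \<union> B) = {}" "exch (A \<union> R) (B \<union> R)"
    using assms(3) by blast
  obtain X where X: "finite (\<Union>X)" "X \<inter> F = {}" "X \<inter> (A \<union> R) = {}" "X \<inter> (B \<union> R) = {}"
      "tileable (X \<union> (A \<union> R))" "tileable (X \<union> (B \<union> R))"
    using abE[OF R(2) F] by metis
  have "finite (\<Union>R)" using R(2) by (auto simp: exch_def)
  moreover have "tileable (X \<union> R \<union> A)" "tileable (X \<union> R \<union> B)" using X by (simp_all add: Un_ac)
  ultimately show "\<exists>X. finite (\<Union>X) \<and> X \<inter> (F \<union> A \<union> B) = {} \<and> tileable (X \<union> A) \<and> tileable (X \<union> B)"
    using X R by (intro exI[of _ "X \<union> R"]) auto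
qed

lemma exch_translate:
  assumes "exch A B" "finite g"
  shows "exch ({g} \<odot> A) ({g} \<odot> B)"
  unfolding exch_def
proof (intro conjI allI impI)
  show "finite (\<Union>({g} \<odot> A))" "finite (\<Union>({g} \<odot> B))"
    using assms by (auto simp: exch_def intro!: finite_Union_mul)
  fix F :: "nat set set" assume F: "finite (\<Union>F)"
  \<comment> \<open>Translation by \<open>g\<close> is an involution, so
    \<open>{g} \<odot> X\<close> avoids \<open>F\<close> exactly when \<open>X\<close> avoids
    \<open>{g} \<odot> F\<close>.\<close>
  then have "finite (\<Union>({g} \<odot> F))" using assms by (intro finite_Union_mul) auto
  then obtain X where X: "finite (\<Union>X)" "X \<inter> ({g} \<odot> F) = {}" "X \<inter> A = {}" "X \<inter> B = {}"
      "tileable (X \<union> A)" "tileable (X \<union> B)"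
    using abE[OF assms(1)] by metis
  have "tileable ({g} \<odot> X \<union> {g} \<odot> A)" "tileable ({g} \<odot> X \<union> {g} \<odot> B)"
    using tileable_translate[OF X(5), of g] tileable_translate[OF X(6), of g] by (simp_all add: mul_Un_right)
  moreover have "({g} \<odot> X) \<inter> (F \<union> {g} \<odot> A \<union> {g} \<odot> B) = {}"
  proof -
    have "g \<triangle> x \<notin> F" if "x \<in> X" for x
      using X(2) that mulI[of g "{g}" "g \<triangle> x" F] by auto
    then show ?thesis using X(3,4) by (auto simp: mul_singleton)
  qed
  ultimately show "\<exists>Y. finite (\<Union>Y) \<and> Y \<inter> (F \<union> {g} \<odot> A \<union> {g} \<odot> B) = {} \<and>
      tileable (Y \<union> {g} \<odot> A) \<and> tileable (Y \<union> {g} \<odot> B)"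
    using X(1) assms(2) by (intro exI[of _ "{g} \<odot> X"]) (auto intro!: finite_Union_mul)
qed

text \<open>Multiplying by a family in separate coordinates gives a disjoint sum of translates of
  the given exchange, one for each point of \<open>A\<close>.\<close>

lemma exch_mul:
  assumes "exch P Q" "finite (\<Union>A)" "\<Union>A \<subseteq> C" "\<Union>P \<inter> C = {}" "\<Union>Q \<inter> C = {}"
  shows "exch (A \<odot> P) (A \<odot> Q)"
proof -
  have "disjoint_family_on (\<lambda>a. {a} \<odot> P) A" if "\<Union>P \<inter> C = {}" for P
    unfolding disjoint_family_on_def
  proof (intro ballI impI)
    fix m n assume "m \<in> A" "n \<in> A" "m \<noteq> n"
    then show "({m} \<odot> P) \<inter> ({n} \<odot> P) = {}"
      using assms(3) that by (intro mul_disjoint[of _ C]) auto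
  qed
  then have "exch (\<Union>a\<in>A. {a} \<odot> P) (\<Union>a\<in>A. {a} \<odot> Q)"
    using assms by (intro exch_UN exch_translate)
      (auto intro: finite_of_Union finite_subset[OF Sup_upper])
  then show ?thesis by (simp flip: mul_UN)
qed

end

lemma translate_Int: "{g} \<odot> P \<inter> {g} \<odot> Q = {g} \<odot> (P \<inter> Q)"
  by (simp add: mul_singleton image_Int inj_def)

lemma mul_insert_empty [simp]: "A \<odot> insert {} P = A \<union> A \<odot> P" "insert {} P \<odot> A = A \<union> P \<odot> A"
  by (simp_all add: insert_is_Un[of "{}" P] mul_Un_left mul_Un_right del: insert_is_Un[symmetric] Un_insert_left)

section \<open>The cube relation modulo tiles\<close>

context shape begin

text \<open>Comparing tiles one coordinate at a time removes coordinates of \<open>S\<close> from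
  below. The section is what remains of \<open>S\<close> after \<open>j\<close> removals, until only
  \<open>{{}}\<close> is left at \<open>j = k\<close>.\<close>

definition slot_section :: "nat \<Rightarrow> (nat \<Rightarrow> nat) \<Rightarrow> nat set set" where
  "slot_section j f = {f ` s |s. s \<in> S \<and> s \<inter> {..<j} = {}}"

text \<open>The section at \<open>j\<close> splits into the next section and the coordinate placed
  in slot \<open>j\<close> times this family, which is the analogue of the link of a vertex in a
  complex.\<close>

definition slot_link :: "nat \<Rightarrow> (nat \<Rightarrow> nat) \<Rightarrow> nat set set" where
  "slot_link j f = {f ` (s - {j}) |s. s \<in> S \<and> s \<inter> {..<j} = {} \<and> j \<in> s}"

text \<open>In the construction \<open>P\<close> and \<open>Q\<close> hold the positive and negative
  terms of \<open>\<Prod>i<j. (1 - t\<^sub>i x\<^sub>i)\<close>, and the condition says that this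
  product times the section vanishes modulo tiles. It is demanded for all placements
  \<open>f\<close>, because the inductive step compares placements that differ only in slot
  \<open>j\<close>.\<close>

definition balanced :: "nat \<Rightarrow> nat set set \<Rightarrow> nat set set \<Rightarrow> bool" where
  "balanced j P Q \<longleftrightarrow> (\<forall>f. inj_on f {j..<k} \<longrightarrow> f ` {j..<k} \<inter> \<Union>(P \<union> Q) = {} \<longrightarrow>
     exch (P \<odot> slot_section j f) (Q \<odot> slot_section j f))"

lemma Union_slot_section: "\<Union>(slot_section j f) \<subseteq> f ` {j..<k}"
proof
  fix i assume "i \<in> \<Union>(slot_section j f)"
  then obtain s a where s: "s \<in> S" "s \<inter> {..<j} = {}" "a \<in> s" "i = f a" by (auto simp: slot_section_def)
  then have "a \<in> {j..<k}" using S_sub by (auto simp: disjoint_iff)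
  then show "i \<in> f ` {j..<k}" using s by auto
qed

lemma Union_slot_link: "\<Union>(slot_link j f) \<subseteq> f ` {Suc j..<k}"
proof
  fix i assume "i \<in> \<Union>(slot_link j f)"
  then obtain s a where s: "s \<in> S" "s \<inter> {..<j} = {}" "a \<in> s" "a \<noteq> j" "i = f a" by (auto simp: slot_link_def)
  then have "a \<in> {Suc j..<k}" using S_sub
    by (auto simp: disjoint_iff)
  then show "i \<in> f ` {Suc j..<k}" using s by auto
qed

text \<open>A point of the section either avoids slot \<open>j\<close> and does not see
  \<open>y\<close>, or it receives \<open>y\<close> as a separate summand, because \<open>y\<close>
  is not a value of \<open>f\<close> on the later slots.\<close>

lemma slot_section_upd:
  assumes "y \<notin> f ` {Suc j..<k}"
  shows "slot_section j (f(j := y)) = slot_section (Suc j) f \<union> {{y}} \<odot> slot_link j f"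
proof -
  have im: "f(j := y) ` s = f ` s" if "j \<notin> s" for s
    using that by (intro image_cong) auto
  have im2: "f(j := y) ` s = {y} \<triangle> f ` (s - {j})" if "s \<in> S" "s \<inter> {..<j} = {}" "j \<in> s" for s
  proof -
    have "f(j := y) ` s = insert y (f ` (s - {j}))"
      using that(3) by (subst insert_Diff[OF that(3), symmetric]) (simp only: image_insert, simp add: im)
    moreover have "y \<notin> f ` (s - {j})"
    proof -
      have "f ` (s - {j}) \<subseteq> \<Union>(slot_link j f)" using that by (auto simp: slot_link_def)
      then show ?thesis using assms Union_slot_link[of j f] by auto
    qed
    ultimately show ?thesis by (subst xr_disjoint) auto
  qed
  have 1: "s \<inter> {..<Suc j} = {} \<longleftrightarrow> s \<inter> {..<j} = {} \<and> j \<notin> s" for s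
    by (auto simp: lessThan_Suc)
  show ?thesis
  proof (intro equalityI subsetI)
    fix x assume "x \<in> slot_section j (f(j := y))"
    then obtain s where s: "s \<in> S" "s \<inter> {..<j} = {}" "x = f(j := y) ` s" by (auto simp: slot_section_def)
    show "x \<in> slot_section (Suc j) f \<union> {{y}} \<odot> slot_link j f"
    proof (cases "j \<in> s")
      case True
      then have "f ` (s - {j}) \<in> slot_link j f" using s by (auto simp: slot_link_def)
      then show ?thesis using im2[OF s(1,2) True] s(3) by (auto intro: mulI)
    next
      case False
      then show ?thesis using s im[OF False] unfolding slot_section_def by (auto simp: 1)
    qed
  next
    fix x assume "x \<in> slot_section (Suc j) f \<union> {{y}} \<odot> slot_link j f"
    then show "x \<in> slot_section j (f(j := y))"
    proof
      assume "x \<in> slot_section (Suc j) f"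
      then obtain s where s: "s \<in> S" "s \<inter> {..<j} = {}" "j \<notin> s" "x = f ` s" by (auto simp: slot_section_def 1)
      then show ?thesis using im[OF s(3)] unfolding slot_section_def by auto
    next
      assume "x \<in> {{y}} \<odot> slot_link j f"
      then obtain s where s: "s \<in> S" "s \<inter> {..<j} = {}" "j \<in> s" "x = {y} \<triangle> f ` (s - {j})"
        by (auto simp: slot_link_def mul_singleton)
      then show ?thesis using im2[OF s(1-3)] unfolding slot_section_def mem_Collect_eq by metis
    qed
  qed
qed

text \<open>The full section is a tile, hence exchangeable with the empty family; this is the case
  of the empty product \<open>1\<close>.\<close>

lemma balanced_0: "balanced 0 {{}} {}"
  unfolding balanced_def
proof (intro allI impI)
  fix f :: "nat \<Rightarrow> nat" assume f: "inj_on f {0..<k}"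
  have "slot_section 0 f = (\<lambda>s. {} \<triangle> f ` s) ` S" by (auto simp: slot_section_def)
  moreover have "inj_on f {..<k}" using f by (simp add: lessThan_atLeast0)
  ultimately have "tileable (slot_section 0 f)" by (metis tileable_tile tileI)
  moreover have "finite (\<Union>(slot_section 0 f))" using Union_slot_section finite_subset by blast
  ultimately show "exch ({{}} \<odot> slot_section 0 f) ({} \<odot> slot_section 0 f)" by (simp add: exch_tileable)
qed

text \<open>Marks, first factors and second factors use three separate groups of coordinates, so a
  common point determines its mark and its first factor.\<close>

lemma marked_disjoint:
  assumes "m \<subseteq> M" "m' \<subseteq> M" "\<Union>P \<subseteq> W" "\<Union>P' \<subseteq> W" "\<Union>D \<subseteq> E" "\<Union>D' \<subseteq> E"
    and "M \<inter> W = {}" "M \<inter> E = {}" "W \<inter> E = {}" "m \<noteq> m' \<or> P \<inter> P' = {}"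
  shows "({m} \<odot> (P \<odot> D)) \<inter> ({m'} \<odot> (P' \<odot> D')) = {}"
proof -
  have U: "\<Union>(P \<odot> D) \<inter> M = {}" if "\<Union>P \<subseteq> W" "\<Union>D \<subseteq> E" for P D
    using that Union_mul[of P D] assms(7,8) by blast
  show ?thesis
  proof (cases "m = m'")
    case True
    then have "(P \<odot> D) \<inter> (P' \<odot> D') = {}"
      using assms by (intro mul_disjoint[of _ W]) auto
    then show ?thesis using assms U[of P D] U[of P' D'] by (intro mul_disjoint[of _ M]) auto
  next
    case False
    then show ?thesis using assms U[of P D] U[of P' D'] by (intro mul_disjoint[of _ M]) auto
  qed
qed

text \<open>
  The common terms of the four exchanges used here all contain the fresh coordinate \<open>y\<close>, so they
  can be absorbed into the gadget.
\<close>

lemma balanced_step: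
  assumes "balanced j P Q" "j < k" "finite (\<Union>(P \<union> Q))" "P \<inter> Q = {}" "P \<noteq> {}"
    and "t \<noteq> x" "t \<notin> \<Union>(P \<union> Q)" "x \<notin> \<Union>(P \<union> Q)"
  shows "balanced (Suc j) (P \<union> {{t, x}} \<odot> Q) (Q \<union> {{t, x}} \<odot> P)"
  unfolding balanced_def
proof (intro allI impI)
  let ?P = "P \<union> {{t, x}} \<odot> Q" and ?Q = "Q \<union> {{t, x}} \<odot> P"
  let ?W = "\<Union>(P \<union> Q)"
  fix f :: "nat \<Rightarrow> nat" assume f: "inj_on f {Suc j..<k}" and av: "f ` {Suc j..<k} \<inter> \<Union>(?P \<union> ?Q) = {}"
  let ?E = "f ` {Suc j..<k}"
  let ?D = "slot_section (Suc j) f" and ?C = "slot_link j f"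
  have W: "?E \<inter> ?W = {}" using av by auto
  \<comment> \<open>Nonemptiness of \<open>P\<close> puts \<open>t\<close> and \<open>x\<close> into
    the support of \<open>?Q\<close>, so the placement \<open>f\<close> avoids them.\<close>
  obtain p where p: "p \<in> P" using assms(5) by auto
  then have "{t, x} \<triangle> p \<in> ?Q" by (auto intro: mulI)
  moreover have "t \<in> {t, x} \<triangle> p" "x \<in> {t, x} \<triangle> p" using p assms(7,8) by auto
  ultimately have tx: "t \<notin> ?E" "x \<notin> ?E" using av by blast+
  have UD: "\<Union>?D \<subseteq> ?E" and UC: "\<Union>?C \<subseteq> ?E" using Union_slot_section Union_slot_link by auto
  have finD: "finite (\<Union>?D)" "finite (\<Union>?C)" using UD UC finite_subset by blast+
  have finPQ: "finite (\<Union>P)" "finite (\<Union>Q)" using assms(3) by auto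
  have slot: "exch (P \<odot> ?D \<union> {{z}} \<odot> (P \<odot> ?C)) (Q \<odot> ?D \<union> {{z}} \<odot> (Q \<odot> ?C))"
    if z: "z \<notin> ?E" "z \<notin> ?W" for z
  proof -
    have "f(j := z) ` {j..<k} = insert z ?E"
    proof -
      have "{j..<k} = insert j {Suc j..<k}" using assms(2) by auto
      moreover have "f(j := z) ` {Suc j..<k} = ?E" by (intro image_cong) auto
      ultimately show ?thesis by (simp del: fun_upd_apply) simp
    qed
    moreover have "inj_on (f(j := z)) {j..<k}"
    proof -
      have "{j..<k} = insert j {Suc j..<k}" using assms(2) by auto
      then show ?thesis using f z(1) by (auto simp: inj_on_def)
    qed
    ultimately have "exch (P \<odot> slot_section j (f(j := z))) (Q \<odot> slot_section j (f(j := z)))"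
      using assms(1) z W unfolding balanced_def by (metis Int_insert_left)
    moreover have "A \<odot> slot_section j (f(j := z)) = A \<odot> ?D \<union> {{z}} \<odot> (A \<odot> ?C)" for A
      unfolding slot_section_upd[OF z(1)] mul_Un_right by (metis mul_assoc mul_commute)
    ultimately show ?thesis by simp
  qed
  have tr: "{g} \<odot> ({m} \<odot> A) = {g \<triangle> m} \<odot> A" for g m :: "nat set" and A
    by (simp add: mul_def xr_assoc) metis
  show "exch (?P \<odot> ?D) (?Q \<odot> ?D)"
  proof (rule exch_cancel_fresh)
    show "finite (\<Union>(?P \<odot> ?D))" "finite (\<Union>(?Q \<odot> ?D))"
      using finPQ finD by (auto intro!: finite_Union_mul)
    fix F :: "nat set set" assume F: "finite (\<Union>F)"
    have "finite (\<Union>F \<union> ?W \<union> ?E \<union> {t, x})" using F assms(3) by auto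
    from ex_new_if_finite[OF infinite_UNIV_nat this]
    obtain y where "y \<notin> \<Union>F \<union> ?W \<union> ?E \<union> {t, x}" ..
    then have y: "y \<notin> \<Union>F" "y \<notin> ?W" "y \<notin> ?E" "y \<noteq> t" "y \<noteq> x" by auto
    let ?p = "\<lambda>m A D. {m} \<odot> (A \<odot> D)"
    have e: "{t, y} \<triangle> {t} = {y}" "{t, x} \<triangle> {y} = {t, x, y}" "{t, y} \<triangle> {x} = {t, x, y}"
      using assms(6) y(4,5) by auto
    \<comment> \<open>In the group ring the four exchanges add up to \<open>P - Q\<close> times
      \<open>(D + y C) - t y (D + t C) - t x (D + y C) + t y (D + x C)\<close>. Since squares of
      coordinates are \<open>1\<close>, all multiples of \<open>C\<close> cancel and
      \<open>(1 - t x) D\<close> remains.\<close>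
    have r1: "exch (?p {} P ?D \<union> ?p {y} P ?C) (?p {} Q ?D \<union> ?p {y} Q ?C)"
      using slot[of y] y by simp
    have r2: "exch (?p {t, y} Q ?D \<union> ?p {y} Q ?C) (?p {t, y} P ?D \<union> ?p {y} P ?C)"
      using exch_translate[OF exch_sym[OF slot[of t]], of "{t, y}"] tx assms(7)
      by (simp add: mul_Un_right tr e)
    have r3: "exch (?p {t, x} Q ?D \<union> ?p {t, x, y} Q ?C) (?p {t, x} P ?D \<union> ?p {t, x, y} P ?C)"
      using exch_translate[OF exch_sym[OF slot[of y]], of "{t, x}"] y
      by (simp add: mul_Un_right tr e)
    have r4: "exch (?p {t, y} P ?D \<union> ?p {t, x, y} P ?C) (?p {t, y} Q ?D \<union> ?p {t, x, y} Q ?C)"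
      using exch_translate[OF slot[of x], of "{t, y}"] tx assms(8)
      by (simp add: mul_Un_right tr e)
    have dj: "?p m A U \<inter> ?p m' A' U' = {}"
      if "m \<subseteq> {t, x, y}" "m' \<subseteq> {t, x, y}" "A \<in> {P, Q}" "A' \<in> {P, Q}" "U \<in> {?D, ?C}" "U' \<in> {?D, ?C}"
        "m \<noteq> m' \<or> A \<inter> A' = {}" for m m' A A' U U'
    proof (rule marked_disjoint[of _ "{t, x, y}" _ _ ?W _ _ ?E])
      show "{t, x, y} \<inter> ?W = {}" "{t, x, y} \<inter> ?E = {}" using assms(7,8) y tx by auto
      show "\<Union>A \<subseteq> ?W" "\<Union>A' \<subseteq> ?W" using that(3,4) by blast+
      show "\<Union>U \<subseteq> ?E" "\<Union>U' \<subseteq> ?E" using that(5,6) UD UC by blast+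
      show "?W \<inter> ?E = {}" using W by auto
    qed (rule that)+
    have QP: "Q \<inter> P = {}" using assms(4) by auto
    have ne: "{} \<noteq> {y}" "{t} \<noteq> {}" "{t, y} \<noteq> {}" "{t, y} \<noteq> {y}" "{t, x} \<noteq> {}" "{t, x} \<noteq> {y}"
      "{t, x} \<noteq> {t, y}" "{t, x, y} \<noteq> {}" "{t, x, y} \<noteq> {y}" "{t, x, y} \<noteq> {t, y}" "{t, x, y} \<noteq> {t, x}"
      using y assms(6) by auto
    define R where "R = ?p {y} P ?C \<union> ?p {y} Q ?C \<union> ?p {t, y} P ?D \<union> ?p {t, y} Q ?D
      \<union> ?p {t, x, y} P ?C \<union> ?p {t, x, y} Q ?C"
    have 12: "exch ((?p {} P ?D \<union> ?p {y} P ?C) \<union> (?p {t, y} Q ?D \<union> ?p {y} Q ?C))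
        ((?p {} Q ?D \<union> ?p {y} Q ?C) \<union> (?p {t, y} P ?D \<union> ?p {y} P ?C))"
      by (rule exch_Un[OF r1 r2]; simp only: Int_Un_distrib Int_Un_distrib2 Un_empty;
          intro conjI; rule dj; simp add: ne ne[symmetric] y(4,5) y(4,5)[symmetric] assms(4) QP)
    have 34: "exch ((?p {t, x} Q ?D \<union> ?p {t, x, y} Q ?C) \<union> (?p {t, y} P ?D \<union> ?p {t, x, y} P ?C))
        ((?p {t, x} P ?D \<union> ?p {t, x, y} P ?C) \<union> (?p {t, y} Q ?D \<union> ?p {t, x, y} Q ?C))"
      by (rule exch_Un[OF r3 r4]; simp only: Int_Un_distrib Int_Un_distrib2 Un_empty;
          intro conjI; rule dj; simp add: ne ne[symmetric] y(4,5) y(4,5)[symmetric] assms(4) QP)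
    have all: "exch (((?p {} P ?D \<union> ?p {y} P ?C) \<union> (?p {t, y} Q ?D \<union> ?p {y} Q ?C)) \<union>
        ((?p {t, x} Q ?D \<union> ?p {t, x, y} Q ?C) \<union> (?p {t, y} P ?D \<union> ?p {t, x, y} P ?C)))
       (((?p {} Q ?D \<union> ?p {y} Q ?C) \<union> (?p {t, y} P ?D \<union> ?p {y} P ?C)) \<union>
        ((?p {t, x} P ?D \<union> ?p {t, x, y} P ?C) \<union> (?p {t, y} Q ?D \<union> ?p {t, x, y} Q ?C)))"
      by (rule exch_Un[OF 12 34]; simp only: Int_Un_distrib Int_Un_distrib2 Un_empty;
          intro conjI; rule dj; simp add: ne ne[symmetric] y(4,5) y(4,5)[symmetric] assms(4) QP)
    have PD: "?P \<odot> ?D = ?p {} P ?D \<union> ?p {t, x} Q ?D" "?Q \<odot> ?D = ?p {} Q ?D \<union> ?p {t, x} P ?D"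
      by (simp_all add: mul_Un_left mul_assoc)
    have "exch (?P \<odot> ?D \<union> R) (?Q \<odot> ?D \<union> R)"
      using all unfolding PD R_def by (simp only: Un_ac)
    moreover have "R \<inter> F = {}"
    proof -
      have "y \<in> r" if "r \<in> R" for r
      proof -
        have pc: "y \<in> r" if "r \<in> ?p m A U" "y \<in> m" "A \<subseteq> P \<union> Q" "U \<subseteq> ?D \<union> ?C" for m A U
        proof -
          obtain a u where au: "a \<in> A" "u \<in> U" "r = m \<triangle> (a \<triangle> u)"
            using \<open>r \<in> ?p m A U\<close> by (auto elim!: mulE)
          have "a \<in> P \<union> Q" "u \<in> ?D \<union> ?C" using au that(3,4) by blast+
          then have "a \<subseteq> ?W" "u \<subseteq> ?E" using UD UC by auto
          then have "y \<notin> a" "y \<notin> u" using y(2,3) by blast+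
          then show ?thesis using au(3) that(2) by simp
        qed
        show ?thesis using \<open>r \<in> R\<close> unfolding R_def Un_iff
          by - (elim disjE; erule pc; blast)
      qed
      then show ?thesis using y(1) by (metis UnionI disjoint_iff)
    qed
    ultimately show "\<exists>R. R \<inter> F = {} \<and> exch (?P \<odot> ?D \<union> R) (?Q \<odot> ?D \<union> R)"
      by (intro exI[of _ R] conjI)
  qed
qed

lemma slot_section_k: "slot_section k f = {{}}"
proof -
  have "s = {}" if "s \<in> S" "s \<inter> {..<k} = {}" for s using that S_sub by auto
  then show ?thesis using empty_S by (auto simp: slot_section_def)
qed

text \<open>Each step takes two new coordinates from \<open>b\<close> on. The shifted terms are
  marked by \<open>t\<close>, which keeps \<open>P\<close> and \<open>Q\<close> disjoint, and the
  constant term \<open>{}\<close> stays in \<open>P\<close>.\<close>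

lemma balanced_exists:
  assumes "j \<le> k"
  shows "\<exists>P Q. balanced j P Q \<and> {} \<in> P \<and> P \<inter> Q = {} \<and> finite (\<Union>(P \<union> Q)) \<and> \<Union>(P \<union> Q) \<subseteq> {b..}"
  using assms
proof (induction j)
  case 0
  show ?case using balanced_0 by (intro exI[of _ "{{}}"] exI[of _ "{}"]) auto
next
  case (Suc j)
  then obtain P Q where PQ: "balanced j P Q" "{} \<in> P" "P \<inter> Q = {}" "finite (\<Union>(P \<union> Q))" "\<Union>(P \<union> Q) \<subseteq> {b..}"
    by auto
  have "finite (\<Union>(P \<union> Q) \<union> {..<b})" using PQ(4) by auto
  then obtain t where t: "t \<notin> \<Union>(P \<union> Q)" "t \<ge> b"
    by (metis UnI1 UnI2 ex_new_if_finite infinite_UNIV_nat lessThan_iff not_less)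
  have "finite (\<Union>(P \<union> Q) \<union> {..<b} \<union> {t})" using PQ(4) by auto
  then obtain x where x: "x \<notin> \<Union>(P \<union> Q)" "x \<ge> b" "x \<noteq> t"
    by (metis UnI1 UnI2 ex_new_if_finite infinite_UNIV_nat lessThan_iff not_less insertI1)
  let ?P = "P \<union> {{t, x}} \<odot> Q" and ?Q = "Q \<union> {{t, x}} \<odot> P"
  have "balanced (Suc j) ?P ?Q"
    using Suc.prems PQ t x by (intro balanced_step) auto
  moreover have "?P \<inter> ?Q = {}"
  proof -
    have "t \<in> r" if "r \<in> {{t, x}} \<odot> P \<union> {{t, x}} \<odot> Q" for r
      using that t(1) by (auto simp: mul_def)
    moreover have "t \<notin> r" if "r \<in> P \<union> Q" for r using that t(1) by auto
    moreover have "{{t, x}} \<odot> Q \<inter> {{t, x}} \<odot> P = {}"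
      using PQ(3) by (simp add: translate_Int Int_commute)
    ultimately show ?thesis using PQ(3) by blast
  qed
  moreover have "\<Union>(?P \<union> ?Q) \<subseteq> {t, x} \<union> \<Union>(P \<union> Q)"
    using Union_mul[of "{{t, x}}" P] Union_mul[of "{{t, x}}" Q] by auto
  moreover from this have "finite (\<Union>(?P \<union> ?Q))" using PQ(4) by (rule_tac finite_subset) auto
  moreover have "{t, x} \<union> \<Union>(P \<union> Q) \<subseteq> {b..}" using PQ(5) t x by auto
  moreover have "{} \<in> ?P" using PQ(2) by simp
  ultimately show ?case by (meson order_trans)
qed

text \<open>At stage \<open>k\<close> the section is only \<open>{{}}\<close>, so the full product
  itself vanishes modulo tiles. The bound \<open>b\<close> lets it be placed beyond all coordinates
  already in use.\<close>

lemma cube_relation: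
  obtains P Q where "exch P Q" "{} \<in> P" "P \<inter> Q = {}" "finite (\<Union>P)" "finite (\<Union>Q)"
    "\<Union>P \<subseteq> {b..}" "\<Union>Q \<subseteq> {b..}"
proof -
  obtain P Q where PQ: "balanced k P Q" "{} \<in> P" "P \<inter> Q = {}" "finite (\<Union>(P \<union> Q))" "\<Union>(P \<union> Q) \<subseteq> {b..}"
    using balanced_exists[of k b] by auto
  have "exch P Q" using PQ(1) by (auto simp: balanced_def slot_section_k)
  then show ?thesis using PQ by (intro that) auto
qed

section \<open>Cancellation, transitivity and fresh equivalents\<close>

lemma coordinate_bound:
  assumes "finite (\<Union>F)"
  obtains b :: nat where "\<Union>F \<subseteq> {..<b}"
  using finite_nat_bounded[OF assms] by auto

text \<open>With \<open>P = 1 + P'\<close> congruent to \<open>Q\<close>, multiplication by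
  \<open>1\<close> may be replaced by multiplication by \<open>Q - P'\<close>, all of whose terms
  use fresh coordinates. Applied to the difference of \<open>A\<close> and \<open>B\<close>, this
  replaces the given common part \<open>R\<close> by one that avoids any prescribed family.\<close>

lemma exch_cancel_disjoint:
  assumes "exch (A \<union> R) (B \<union> R)" "A \<inter> B = {}" "A \<inter> R = {}" "B \<inter> R = {}"
  shows "exch A B"
proof (rule exch_cancel_fresh)
  show fin: "finite (\<Union>A)" "finite (\<Union>B)" using assms(1) by (auto simp: exch_def)
  have finR: "finite (\<Union>R)" using assms(1) by (auto simp: exch_def)
  fix F :: "nat set set" assume "finite (\<Union>F)"
  then obtain b where b: "\<Union>(F \<union> A \<union> B \<union> R) \<subseteq> {..<b}"
    using fin finR by (metis Union_Un_distrib coordinate_bound finite_UnI)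
  obtain P Q where PQ: "exch P Q" "{} \<in> P" "P \<inter> Q = {}" "finite (\<Union>P)" "finite (\<Union>Q)"
      "\<Union>P \<subseteq> {b..}" "\<Union>Q \<subseteq> {b..}"
    by (rule cube_relation)
  define P' where "P' = P - {{}}"
  have P: "P = {{}} \<union> P'" using PQ(2) by (auto simp: P'_def)
  have P': "finite (\<Union>P')" "\<Union>P' \<subseteq> {b..}" "{} \<notin> P'" "P' \<inter> Q = {}" "{} \<notin> Q"
    using PQ finite_subset[of "\<Union>P'" "\<Union>P"] by (auto simp: P'_def)
  have sep: "{b..} \<inter> {..<b} = {}" by auto
  have sepP: "\<Union>P \<inter> {..<b} = {}" "\<Union>Q \<inter> {..<b} = {}" "\<Union>P' \<inter> {..<b} = {}"
    using PQ(6,7) P'(2) sep by blast+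
  have sepA: "\<Union>A \<subseteq> {..<b}" "\<Union>B \<subseteq> {..<b}" "\<Union>R \<subseteq> {..<b}" using b by auto
  have lt: "X \<inter> {b..} = {}" if "X \<subseteq> {..<b}" for X using that sep by blast
  have sw: "exch (U \<odot> V) (U' \<odot> V)" if "exch U U'" "\<Union>U \<subseteq> {..<b}" "\<Union>U' \<subseteq> {..<b}"
      "\<Union>V \<subseteq> {b..}" "finite (\<Union>V)" for U U' V
    using exch_mul[OF that(1,5,4) lt[OF that(2)] lt[OF that(3)]] by (simp add: mul_commute)
  have r1: "exch (A \<union> A \<odot> P') (A \<odot> Q)"
    using exch_mul[OF PQ(1) fin(1) sepA(1) sepP(1,2)] by (simp add: P mul_Un_right)
  have r2: "exch (B \<odot> Q) (B \<union> B \<odot> P')"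
    using exch_sym[OF exch_mul[OF PQ(1) fin(2) sepA(2) sepP(1,2)]] by (simp add: P mul_Un_right)
  have r3: "exch (B \<odot> P' \<union> R \<odot> P') (A \<odot> P' \<union> R \<odot> P')"
    using sw[OF exch_sym[OF assms(1)], of P'] sepA P' by (simp add: mul_Un_left)
  have r4: "exch (A \<odot> Q \<union> R \<odot> Q) (B \<odot> Q \<union> R \<odot> Q)"
    using sw[OF assms(1), of Q] sepA PQ by (simp add: mul_Un_left)
  have dj: "U \<odot> V \<inter> U' \<odot> V' = {}"
    if "U \<in> {A, B, R}" "U' \<in> {A, B, R}" "V \<in> {{{}}, P', Q}" "V' \<in> {{{}}, P', Q}"
      "U \<inter> U' = {} \<or> V \<inter> V' = {}" for U V U' V'
  proof (rule mul_disjoint[of _ "{..<b}"])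
    show "\<Union>U \<subseteq> {..<b}" "\<Union>U' \<subseteq> {..<b}" using that(1,2) sepA by blast+
    show "\<Union>V \<inter> {..<b} = {}" "\<Union>V' \<inter> {..<b} = {}" using that(3,4) sepP by auto
  qed (rule that)
  have djE: "U \<inter> U' \<odot> V' = {}" "U' \<odot> V' \<inter> U = {}" if "U \<in> {A, B, R}" "U' \<in> {A, B, R}" "V' \<in> {P', Q}"
     for U U' V'
  proof -
    have "{{}} \<inter> V' = {}" using that(3) P'(3,5) by blast
    then have "U \<odot> {{}} \<inter> U' \<odot> V' = {}" using that by (intro dj) simp_all
    then show "U \<inter> U' \<odot> V' = {}" "U' \<odot> V' \<inter> U = {}" by (simp_all add: Int_commute)
  qed
  note D = assms(2-4) P'(4)
  note D' = D[THEN Int_commute[THEN trans]]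
  have 12: "exch ((A \<union> A \<odot> P') \<union> (B \<odot> Q)) ((A \<odot> Q) \<union> (B \<union> B \<odot> P'))"
    by (rule exch_Un[OF r1 r2]; simp add: Int_Un_distrib Int_Un_distrib2 dj djE D D')
  have 34: "exch ((B \<odot> P' \<union> R \<odot> P') \<union> (A \<odot> Q \<union> R \<odot> Q)) ((A \<odot> P' \<union> R \<odot> P') \<union> (B \<odot> Q \<union> R \<odot> Q))"
    by (rule exch_Un[OF r3 r4]; simp add: Int_Un_distrib Int_Un_distrib2 dj djE D D')
  have all: "exch (((A \<union> A \<odot> P') \<union> (B \<odot> Q)) \<union> ((B \<odot> P' \<union> R \<odot> P') \<union> (A \<odot> Q \<union> R \<odot> Q)))
     (((A \<odot> Q) \<union> (B \<union> B \<odot> P')) \<union> ((A \<odot> P' \<union> R \<odot> P') \<union> (B \<odot> Q \<union> R \<odot> Q)))"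
    by (rule exch_Un[OF 12 34]; simp add: Int_Un_distrib Int_Un_distrib2 dj djE D D')
  \<comment> \<open>In the sum of the four exchanges each product of \<open>A\<close>,
    \<open>B\<close> or \<open>R\<close> with \<open>P'\<close> or \<open>Q\<close> occurs once on
    either side, and only \<open>A\<close> and \<open>B\<close> are left over.\<close>
  define R' where "R' = (A \<union> B \<union> R) \<odot> (P' \<union> Q)"
  have "exch (A \<union> R') (B \<union> R')"
    using all unfolding R'_def mul_Un_left mul_Un_right by (simp only: Un_ac)
  moreover have "R' \<inter> F = {}"
  proof -
    have "\<not> r \<subseteq> {..<b}" if "r \<in> R'" for r
    proof -
      obtain a p where r: "r = a \<triangle> p" "a \<in> A \<union> B \<union> R" "p \<in> P' \<union> Q"
        using \<open>r \<in> R'\<close> unfolding R'_def by (auto elim!: mulE)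
      then obtain i where i: "i \<in> p" using P'(3,5) by (metis Un_iff ex_in_conv)
      then have "i \<in> {b..}" using r(3) P'(2) PQ(7) by blast
      moreover have "i \<notin> a" using \<open>i \<in> {b..}\<close> r(2) b by (auto simp: subset_iff)
      ultimately show ?thesis using i r(1) by auto
    qed
    then show ?thesis using b by blast
  qed
  ultimately show "\<exists>R. R \<inter> F = {} \<and> exch (A \<union> R) (B \<union> R)" by blast
qed

text \<open>The union of the two exchanges has \<open>B\<close> on both sides, where it can be
  cancelled.\<close>

lemma exch_trans_disjoint:
  assumes "exch A B" "exch B C" "A \<inter> B = {}" "B \<inter> C = {}" "A \<inter> C = {}"
  shows "exch A C"
proof (rule exch_cancel_disjoint)
  show "exch (A \<union> B) (C \<union> B)" using exch_Un[OF assms(1,2)] assms by (auto simp: Un_commute)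
qed (use assms in auto)

text \<open>The cube relation reads \<open>1 = Q - P'\<close> modulo tiles. A tile
  \<open>1 + T\<close> on still fresher coordinates gives \<open>- P' = P' T\<close>, so
  \<open>1\<close> is congruent to \<open>Q + P' T\<close>, which has no negative terms.\<close>

lemma fresh_equivalent:
  "\<exists>\<Theta> b'. exch {{}} \<Theta> \<and> {} \<notin> \<Theta> \<and> \<Union>\<Theta> \<subseteq> {b..<b'}"
proof -
  obtain P Q where PQ: "exch P Q" "{} \<in> P" "P \<inter> Q = {}" "finite (\<Union>P)" "finite (\<Union>Q)"
      "\<Union>P \<subseteq> {b..}" "\<Union>Q \<subseteq> {b..}"
    by (rule cube_relation)
  define P' where "P' = P - {{}}"
  have P: "P = {{}} \<union> P'" using PQ(2) by (auto simp: P'_def)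
  obtain c where c: "\<Union>(P \<union> Q) \<subseteq> {..<c}" using PQ(4,5) by (metis Union_Un_distrib coordinate_bound finite_UnI)
  define c' where "c' = max b c"
  define T0 where "T0 = (\<lambda>s. {} \<triangle> (\<lambda>i. c' + i) ` s) ` S"
  have T0: "tile T0" unfolding T0_def by (intro tileI) auto
  have UT0: "\<Union>T0 \<subseteq> {c'..<c' + k}"
    using S_sub by (auto simp: T0_def subset_iff)
  define T where "T = T0 - {{}}"
  have "{} \<in> T0" using empty_S by (auto simp: T0_def)
  then have T0': "T0 = {{}} \<union> T" by (auto simp: T_def)
  have UP: "\<Union>P \<subseteq> {..<c'}" "\<Union>Q \<subseteq> {..<c'}" "\<Union>P' \<subseteq> {..<c'}"
    using c by (auto simp: c'_def P'_def)
  have UT: "\<Union>T0 \<inter> {..<c'} = {}" using UT0 by force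
  then have UT': "\<Union>T \<inter> {..<c'} = {}" by (auto simp: T_def)
  define \<Theta> where "\<Theta> = Q \<union> P' \<odot> T"
  have tlT: "tileable (P' \<odot> T0)"
    unfolding mul_UN[of P'] using UP UT by (intro tileable_fibres[of _ _ "{..<c'}"] tileable_tile T0) auto
  have ne: "\<not> r \<subseteq> {..<c'}" if r: "r \<in> P' \<odot> T" for r
  proof -
    from r obtain p t where pt: "r = p \<triangle> t" "p \<in> P'" "t \<in> T" by (auto elim: mulE)
    then obtain i where i: "i \<in> t" by (auto simp: T_def)
    then have "i \<notin> {..<c'}" "i \<notin> p" using pt UT' UP by blast+
    then show ?thesis using i pt(1) by auto
  qed
  have fin: "finite (\<Union>(P' \<odot> T0))" using PQ(4) UT0
    by (intro finite_Union_mul) (auto simp: P'_def intro: finite_subset)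
  have "\<not> x \<subseteq> {..<c'} \<or> x \<in> P'" if "x \<in> P' \<odot> T0" for x
    using that ne unfolding T0' mul_Un_right by auto
  then have "Q \<inter> P' \<odot> T0 = {}"
    using PQ(3) UP(2) unfolding P'_def by blast
  then have "exch ({{}} \<union> P') (Q \<union> P' \<odot> T0)"
    using exch_Un[OF PQ(1) exch_sym[OF exch_tileable[OF tlT fin]]] by (simp add: P)
  moreover have "Q \<union> P' \<odot> T0 = \<Theta> \<union> P'"
    by (auto simp: \<Theta>_def T0' mul_Un_right)
  ultimately have "exch ({{}} \<union> P') (\<Theta> \<union> P')" by simp
  moreover have e: "{} \<notin> \<Theta>" using ne[of "{}"] PQ(2,3) by (auto simp: \<Theta>_def)
  moreover have "\<Theta> \<inter> P' = {}" using ne UP(3) PQ(3) by (auto simp: \<Theta>_def P'_def)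
  moreover have "{{}} \<inter> P' = {}" by (simp add: P'_def)
  ultimately have "exch {{}} \<Theta>"
    by (intro exch_cancel_disjoint[of "{{}}" P' \<Theta>]) simp_all
  moreover have "\<Union>\<Theta> \<subseteq> {b..<c' + k}"
  proof -
    have "\<Union>P' \<subseteq> {b..<c' + k}" "\<Union>Q \<subseteq> {b..<c' + k}" "\<Union>T \<subseteq> {b..<c' + k}"
      using PQ(6,7) UP UT0 by (auto simp: P'_def T_def c'_def subset_iff)
    then show ?thesis using Union_mul[of P' T] unfolding \<Theta>_def Union_Un_distrib by blast
  qed
  ultimately show ?thesis using e by blast
qed

end

section \<open>Absorbers\<close>

lemma Union_UN: "\<Union>(\<Union>x\<in>A. B x) = (\<Union>x\<in>A. \<Union>(B x))"
  by blast

context shape begin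

text \<open>The equivalents are chosen one after another on successive disjoint intervals of
  coordinates. As none of them contains \<open>{}\<close>, families on disjoint intervals are
  disjoint.\<close>

lemma fresh_sequence:
  obtains \<Theta> :: "nat \<Rightarrow> nat set set"
  where "\<And>i. exch {{}} (\<Theta> i)" "\<And>i. {} \<notin> \<Theta> i" "\<And>i. \<Union>(\<Theta> i) \<subseteq> {b..}"
    "\<And>i j. i \<noteq> j \<Longrightarrow> \<Theta> i \<inter> \<Theta> j = {}"
proof -
  let ?G = "\<lambda>(T, l, u). exch {{}} T \<and> {} \<notin> T \<and> \<Union>T \<subseteq> {l..<u::nat} \<and> b \<le> l \<and> l \<le> u"
  have step: "\<exists>q. ?G q \<and> u \<le> fst (snd q)" if "b \<le> u" for u
  proof -
    obtain T u' where "exch {{}} T" "{} \<notin> T" "\<Union>T \<subseteq> {u..<u'}" using fresh_equivalent by blast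
    moreover have "{u..<u'} \<subseteq> {u..<max u u'}" by auto
    ultimately have "?G (T, u, max u u')" using that by auto
    then show ?thesis by (intro exI[of _ "(T, u, max u u')"]) auto
  qed
  have "\<exists>f. \<forall>n. ?G (f n) \<and> snd (snd (f n)) \<le> fst (snd (f (Suc n)))"
  proof (rule dependent_nat_choice)
    show "\<exists>q. ?G q" using step[of b] by auto
    fix q n assume "?G q"
    then have "b \<le> snd (snd q)" by auto
    from step[OF this] show "\<exists>y. ?G y \<and> snd (snd q) \<le> fst (snd y)" .
  qed
  then obtain f where f: "\<forall>n. ?G (f n) \<and> snd (snd (f n)) \<le> fst (snd (f (Suc n)))" ..
  define T l u where "T n = fst (f n)" and "l n = fst (snd (f n))" and "u n = snd (snd (f n))" for n
  have G: "exch {{}} (T n)" "{} \<notin> T n" "\<Union>(T n) \<subseteq> {l n..<u n}" "b \<le> l n" "l n \<le> u n" "u n \<le> l (Suc n)" for n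
    using f[rule_format, of n] by (auto simp: T_def l_def u_def split: prod.splits)
  have mono: "u i \<le> l j" if "i < j" for i j
    using that
  proof (induction j)
    case (Suc j)
    then show ?case using G(5)[of j] G(6)[of j] by (cases "i = j") auto
  qed simp
  have dj: "T i \<inter> T j = {}" if "i < j" for i j
  proof (rule equals0I)
    fix t assume t: "t \<in> T i \<inter> T j"
    then obtain a where a: "a \<in> t" using G(2)[of i] by (metis IntD1 equals0I)
    then have "a \<in> {l i..<u i}" "a \<in> {l j..<u j}" using t G(3)[of i] G(3)[of j] by blast+
    then show False using mono[OF that] by auto
  qed
  have "T i \<inter> T j = {}" if "i \<noteq> j" for i j
    using that dj[of i j] dj[of j i] by (metis inf_commute nat_neq_iff)
  moreover have "\<Union>(T n) \<subseteq> {b..}" for n using G(3)[of n] G(4)[of n] by (auto simp: subset_iff)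
  ultimately show thesis using G(1,2) by (intro that[of T])
qed

text \<open>The nonempty factor from \<open>V\<close> contributes a coordinate at or above
  \<open>b\<close>, so such a product differs from everything supported below
  \<open>b\<close>.\<close>

lemma not_subset_mul:
  assumes "r \<in> U \<odot> V" "\<Union>U \<subseteq> {..<b}" "\<Union>V \<subseteq> {b..}" "{} \<notin> V"
  shows "\<not> r \<subseteq> {..<b::nat}"
proof -
  obtain a p where r: "r = a \<triangle> p" "a \<in> U" "p \<in> V" using assms(1) by (auto elim!: mulE)
  then obtain i where i: "i \<in> p" using assms(4) by (metis ex_in_conv)
  then have "i \<in> {b..}" using r(3) assms(3) by blast
  moreover from this have "i \<notin> a" using r(2) assms(2) by (auto simp: subset_iff)
  ultimately show ?thesis using i r(1) by auto
qed

text \<open>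
  The translates of \<open>S\<close> by all \<open>v \<in> Pow {..<k}\<close> cover each point of \<open>Pow {..<k}\<close> exactly
  \<open>card S\<close> times; giving each translate its own fresh coordinates makes the cover disjoint.
\<close>

lemma exch_card_S_cubes:
  fixes A :: "'i \<Rightarrow> nat set \<Rightarrow> nat set set"
  assumes D: "finite D" "card D = card S"
    and A: "\<And>i x. i \<in> D \<Longrightarrow> x \<subseteq> {..<k} \<Longrightarrow> A i x = {x} \<or> exch {x} (A i x) \<and> x \<notin> A i x"
    and dj: "disjoint_family_on (\<lambda>(i, x). A i x) (D \<times> Pow {..<k})"
  shows "exch (\<Union>(i, x)\<in>D \<times> Pow {..<k}. A i x) {}"
proof -
  let ?K = "Pow {..<k}"
  have finA: "finite (\<Union>(A i x))" if "i \<in> D" "x \<in> ?K" for i x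
  proof -
    have "finite x" using that(2) finite_subset by auto
    then show ?thesis using A[of i x] that exch_finite(2)[of "{x}" "A i x"] by auto
  qed
  have "finite (\<Union>(\<Union>(i, x)\<in>D \<times> ?K. A i x))"
    using D(1) finA by (auto simp: Union_UN)
  then obtain b0 where b0: "\<Union>(\<Union>(i, x)\<in>D \<times> ?K. A i x) \<subseteq> {..<b0}" using coordinate_bound by metis
  define b where "b = max b0 k"
  have bA: "\<Union>(A i x) \<subseteq> {..<b}" if "i \<in> D" "x \<in> ?K" for i x
  proof -
    have "\<Union>(A i x) \<subseteq> {..<b0}" using b0 that by blast
    then show ?thesis by (auto simp: b_def subset_iff)
  qed
  have bK: "x \<subseteq> {..<b}" if "x \<in> ?K" for x using that by (auto simp: b_def)
  obtain \<Theta> :: "nat \<Rightarrow> nat set set" where \<Theta>: "\<And>i. exch {{}} (\<Theta> i)" "\<And>i. {} \<notin> \<Theta> i" "\<And>i. \<Union>(\<Theta> i) \<subseteq> {b..}"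
    "\<And>i j. i \<noteq> j \<Longrightarrow> \<Theta> i \<inter> \<Theta> j = {}"
    by (rule fresh_sequence[of b]) blast
  obtain e :: "nat set \<Rightarrow> nat" where e: "inj_on e ?K"
    using finite_imp_inj_to_nat_seg[of ?K] by auto
  define \<Phi> where "\<Phi> v = \<Theta> (e v)" for v
  have \<Phi>: "exch {{}} (\<Phi> v)" "{} \<notin> \<Phi> v" "\<Union>(\<Phi> v) \<subseteq> {b..}" for v using \<Theta> by (auto simp: \<Phi>_def)
  have \<Phi>d: "\<Phi> v \<inter> \<Phi> w = {}" if "v \<in> ?K" "w \<in> ?K" "v \<noteq> w" for v w
    using \<Theta>(4)[of "e v" "e w"] that e by (auto simp: \<Phi>_def inj_on_eq_iff)
  have sep: "X \<inter> {..<b} = {}" if "X \<subseteq> {b..}" for X using that by force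
  define V where "V x = (\<lambda>s. x \<triangle> s) ` S" for x
  have V: "V x \<subseteq> ?K" if "x \<in> ?K" for x
    unfolding V_def using that S_sub xr_subset[of x "{..<k}"] by blast
  have cV: "card (V x) = card D" for x
    unfolding V_def D by (intro card_image) (auto simp: inj_on_def)
  have finV: "finite (V x)" for x by (simp add: V_def finite_S)
  \<comment> \<open>\<open>V x\<close> also consists of those \<open>v\<close> for which
    \<open>x\<close> lies in the translate of \<open>S\<close> by \<open>v\<close>. As it has
    \<open>card S\<close> members, the copies of \<open>x\<close> indexed by \<open>D\<close> can be
    assigned to distinct translates.\<close>
  have "\<forall>x. \<exists>\<pi>. bij_betw \<pi> D (V x)"
    using cV D(1) finV by (metis finite_same_card_bij)
  then obtain \<pi> where \<pi>: "\<And>x. bij_betw (\<pi> x) D (V x)" by metis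
  define B where "B i x = {x} \<odot> \<Phi> (\<pi> x i)" for i x
  have B1: "\<not> r \<subseteq> {..<b}" if "r \<in> B i x" "x \<in> ?K" for r i x
    using that bK \<Phi> unfolding B_def by (intro not_subset_mul[of r "{x}" "\<Phi> (\<pi> x i)" b]) auto
  have x\<Phi>: "exch {x} (B i x)" if "x \<in> ?K" for i x
    using exch_translate[OF \<Phi>(1), of x "\<pi> x i"] that finite_subset[of x "{..<k}"] unfolding B_def by simp
  have AB: "A i x \<inter> B j y = {}" if "i \<in> D" "x \<in> ?K" "y \<in> ?K" for i x j y
    using B1[of _ j y] that bA[OF that(1,2)] by blast
  have ab1: "exch (A i x) (B i x)" if "i \<in> D" "x \<in> ?K" for i x
  proof (cases "A i x = {x}")
    case True then show ?thesis using x\<Phi> that by auto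
  next
    case False
    then have "exch (A i x) {x}" "x \<notin> A i x" using A[of i x] that by (auto intro: exch_sym)
    moreover have "x \<notin> B i x" using B1 bK that by blast
    ultimately show ?thesis
      using exch_trans_disjoint[of "A i x" "{x}" "B i x"] x\<Phi> AB[of i x x i] that by auto
  qed
  have Bd: "B i x \<inter> B j y = {}" if "i \<in> D" "j \<in> D" "x \<in> ?K" "y \<in> ?K" "(i, x) \<noteq> (j, y)" for i j x y
    unfolding B_def
  proof (rule mul_disjoint[of _ "{..<b}"])
    show "\<Union>{x} \<subseteq> {..<b}" "\<Union>{y} \<subseteq> {..<b}" using bK that by auto
    show "\<Union>(\<Phi> (\<pi> x i)) \<inter> {..<b} = {}" "\<Union>(\<Phi> (\<pi> y j)) \<inter> {..<b} = {}" using \<Phi> sep by auto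
    show "{x} \<inter> {y} = {} \<or> \<Phi> (\<pi> x i) \<inter> \<Phi> (\<pi> y j) = {}"
    proof (cases "x = y")
      case True
      then have "\<pi> x i \<noteq> \<pi> y j" using \<pi>[of x] that by (auto simp: bij_betw_def inj_on_eq_iff)
      moreover have "\<pi> x i \<in> ?K" "\<pi> y j \<in> ?K"
        using \<pi> V that by (meson bij_betwE subsetD)+
      ultimately show ?thesis using \<Phi>d by auto
    qed auto
  qed
  have "exch (\<Union>p\<in>D \<times> ?K. (\<lambda>(i, x). A i x) p) (\<Union>p\<in>D \<times> ?K. (\<lambda>(i, x). B i x) p)"
  proof (rule exch_UN)
    show "disjoint_family_on (\<lambda>(i, x). B i x) (D \<times> ?K)"
      unfolding disjoint_family_on_def using Bd by (auto simp del: Pow_iff)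
  qed (use D(1) ab1 dj in auto)
  \<comment> \<open>Regrouping by translates instead of points: the copies assigned to
    \<open>v\<close> form a whole tile times the marker \<open>\<Phi> v\<close>.\<close>
  moreover have "(\<Union>p\<in>D \<times> ?K. (\<lambda>(i, x). B i x) p) = (\<Union>v\<in>?K. (({v} \<odot> S) \<odot> \<Phi> v))"
  proof -
    have "(\<Union>p\<in>D \<times> ?K. (\<lambda>(i, x). B i x) p) = (\<Union>x\<in>?K. \<Union>v\<in>\<pi> x ` D. {x} \<odot> \<Phi> v)"
      unfolding B_def by auto
    also have "\<dots> = (\<Union>x\<in>?K. \<Union>v\<in>V x. {x} \<odot> \<Phi> v)"
      using \<pi> by (simp add: bij_betw_def)
    also have "\<dots> = (\<Union>v\<in>?K. \<Union>x\<in>V v. {x} \<odot> \<Phi> v)"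
    proof -
      have "x = v \<triangle> s \<longleftrightarrow> v = x \<triangle> s" for x v s :: "nat set" by (auto simp: set_eq_iff)
      then have sw: "x \<in> V v \<longleftrightarrow> v \<in> V x" for x v unfolding V_def image_iff by metis
      show ?thesis
      proof (intro equalityI subsetI)
        fix r assume "r \<in> (\<Union>x\<in>?K. \<Union>v\<in>V x. {x} \<odot> \<Phi> v)"
        then obtain x v where "x \<in> ?K" "v \<in> V x" "r \<in> {x} \<odot> \<Phi> v" by blast
        moreover from this have "v \<in> ?K" "x \<in> V v" using V sw by blast+
        ultimately show "r \<in> (\<Union>v\<in>?K. \<Union>x\<in>V v. {x} \<odot> \<Phi> v)" by blast
      next
        fix r assume "r \<in> (\<Union>v\<in>?K. \<Union>x\<in>V v. {x} \<odot> \<Phi> v)"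
        then obtain x v where "v \<in> ?K" "x \<in> V v" "r \<in> {x} \<odot> \<Phi> v" by blast
        moreover from this have "x \<in> ?K" "v \<in> V x" using V sw by blast+
        ultimately show "r \<in> (\<Union>x\<in>?K. \<Union>v\<in>V x. {x} \<odot> \<Phi> v)" by blast
      qed
    qed
    also have "\<dots> = (\<Union>v\<in>?K. (({v} \<odot> S) \<odot> \<Phi> v))"
      unfolding V_def mul_singleton[of _ S] by (subst (2) mul_UN) simp
    finally show ?thesis .
  qed
  moreover have "tileable (\<Union>v\<in>?K. (({v} \<odot> S) \<odot> \<Phi> v))"
  proof (rule tileable_UN)
    have SK: "\<Union>({v} \<odot> S) \<subseteq> {..<b}" if "v \<in> ?K" for v
      using V[OF that] bK unfolding V_def mul_singleton by blast
    show "tileable (({v} \<odot> S) \<odot> \<Phi> v)" if "v \<in> ?K" for v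
    proof -
      have "tile ({v} \<odot> S)" using tileI[of "\<lambda>x. x" v] by (simp add: mul_singleton)
      moreover have "\<Union>({v} \<odot> S) \<inter> {b..} = {}" using SK[OF that] by force
      ultimately have "tileable (\<Union>y\<in>\<Phi> v. {y} \<odot> ({v} \<odot> S))"
        using \<Phi>(3) by (intro tileable_fibres[of _ _ "{b..}"]) (auto intro: tileable_tile)
      then show ?thesis by (simp add: mul_commute[of _ "\<Phi> v"] flip: mul_UN)
    qed
    show "disjoint_family_on (\<lambda>v. {v} \<odot> S \<odot> \<Phi> v) ?K"
      unfolding disjoint_family_on_def
    proof (intro ballI impI)
      fix v w assume "v \<in> ?K" "w \<in> ?K" "v \<noteq> w"
      then show "({v} \<odot> S \<odot> \<Phi> v) \<inter> ({w} \<odot> S \<odot> \<Phi> w) = {}"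
        using SK \<Phi>d \<Phi> sep by (intro mul_disjoint[of _ "{..<b}"]) auto
    qed
  qed
  ultimately have *: "exch (\<Union>p\<in>D \<times> ?K. (\<lambda>(i, x). A i x) p) (\<Union>p\<in>D \<times> ?K. (\<lambda>(i, x). B i x) p)"
      "tileable (\<Union>p\<in>D \<times> ?K. (\<lambda>(i, x). B i x) p)" by simp_all
  have "exch (\<Union>p\<in>D \<times> ?K. (\<lambda>(i, x). A i x) p) {}"
  proof (rule exch_trans_disjoint[OF *(1) exch_tileable[OF *(2) exch_finite(2)[OF *(1)]]])
    show "(\<Union>p\<in>D \<times> ?K. (\<lambda>(i, x). A i x) p) \<inter> (\<Union>p\<in>D \<times> ?K. (\<lambda>(i, x). B i x) p) = {}"
    proof (rule equals0I)
      fix r assume "r \<in> (\<Union>p\<in>D \<times> ?K. (\<lambda>(i, x). A i x) p) \<inter> (\<Union>p\<in>D \<times> ?K. (\<lambda>(i, x). B i x) p)"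
      then obtain i x j y where "i \<in> D" "x \<in> ?K" "r \<in> A i x" "y \<in> ?K" "r \<in> B j y" by auto
      then show False using AB[of i x y j] by blast
    qed
  qed auto
  then show ?thesis by simp
qed

text \<open>Gadgets are added one by one. Each is tileable alone as well as with its own
  \<open>D\<close>, so it does not disturb what was arranged for the other members.\<close>

lemma common_gadget:
  assumes "finite \<D>" "\<And>D. D \<in> \<D> \<Longrightarrow> exch D {}" "finite (\<Union>F)" "\<And>D. D \<in> \<D> \<Longrightarrow> D \<subseteq> F"
  shows "\<exists>E. finite (\<Union>E) \<and> E \<inter> F = {} \<and> tileable E \<and> (\<forall>D\<in>\<D>. tileable (E \<union> D))"
  using assms
proof (induction \<D> rule: finite_induct)
  case empty
  show ?case by (rule exI[of _ "{}"]) simp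
next
  case (insert D \<D>)
  then obtain E where E: "finite (\<Union>E)" "E \<inter> F = {}" "tileable E" "\<forall>D\<in>\<D>. tileable (E \<union> D)" by auto
  have "finite (\<Union>(F \<union> E))" using E(1) insert.prems by auto
  then obtain X where X: "finite (\<Union>X)" "X \<inter> (F \<union> E) = {}" "tileable (X \<union> D)" "tileable (X \<union> {})"
    using abE[of D "{}"] insert.prems(1)[of D] by (metis insertI1)
  have "tileable (E \<union> X)" using tileable_Un[of E X] E(3) X by auto
  moreover have "tileable (E \<union> X \<union> D)"
    using tileable_Un[OF E(3) X(3)] X(2) E(2) insert.prems(3)[of D] by (auto simp: Un_assoc)
  moreover have "tileable (E \<union> X \<union> D')" if "D' \<in> \<D>" for D'
  proof -
    have "(E \<union> D') \<inter> X = {}" using X(2) insert.prems(3)[of D'] that by auto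
    then have "tileable ((E \<union> D') \<union> X)" using tileable_Un[of "E \<union> D'" X] E(4) X(4) that by auto
    then show ?thesis by (simp add: Un_ac)
  qed
  ultimately show ?case using E X by (intro exI[of _ "E \<union> X"]) auto
qed

text \<open>\<open>Y 0\<close> is the cube itself, the other \<open>Y i\<close> are equivalents of
  it in fresh coordinates. One gadget serves all unions of a multiple of \<open>card S\<close> many
  \<open>Y i\<close>; as \<open>n\<close> is such a multiple, the indices outside \<open>J\<close>
  again form such a union.\<close>

lemma absorber:
  assumes "n = card S * m"
  obtains c Y Z where "k \<le> c" "Y 0 = Pow {..<k}" "Z \<subseteq> Pow {..<c}" "\<And>i. i < n \<Longrightarrow> Y i \<subseteq> Z"
    "disjoint_family_on Y {..<n}"
    "\<And>J. J \<subseteq> {..<n} \<Longrightarrow> card S dvd card J \<Longrightarrow> tileable (Z - (\<Union>i\<in>J. Y i))"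
proof -
  let ?K = "Pow {..<k}"
  obtain \<Theta> :: "nat \<Rightarrow> nat set set" where \<Theta>: "\<And>i. exch {{}} (\<Theta> i)" "\<And>i. {} \<notin> \<Theta> i" "\<And>i. \<Union>(\<Theta> i) \<subseteq> {k..}"
    "\<And>i j. i \<noteq> j \<Longrightarrow> \<Theta> i \<inter> \<Theta> j = {}"
    by (rule fresh_sequence[of k]) blast
  define \<Psi> where "\<Psi> i = (if i = 0 then {{}} else \<Theta> i)" for i :: nat
  define Y where "Y i = ?K \<odot> \<Psi> i" for i
  have \<Psi>d: "\<Psi> i \<inter> \<Psi> j = {}" if "i \<noteq> j" for i j using \<Theta>(2,4) that by (auto simp: \<Psi>_def)
  have \<Psi>U: "\<Union>(\<Psi> i) \<inter> {..<k} = {}" for i using \<Theta>(3)[of i] by (force simp: \<Psi>_def)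
  have \<Psi>fin: "finite (\<Union>(\<Psi> i))" for i using exch_finite(2)[OF \<Theta>(1)] by (auto simp: \<Psi>_def)
  have Y0: "Y 0 = ?K" by (simp add: Y_def \<Psi>_def)
  have Yfin: "finite (\<Union>(Y i))" for i unfolding Y_def using \<Psi>fin by (intro finite_Union_mul) auto
  have Yd: "Y i \<inter> Y j = {}" if "i \<noteq> j" for i j
    unfolding Y_def using \<Psi>d[OF that] \<Psi>U by (intro mul_disjoint[of _ "{..<k}"]) auto
  then have Yeq: "i = j" if "r \<in> Y i" "r \<in> Y j" for i j r using that by (metis IntI emptyE)
  have base: "exch (\<Union>i\<in>D. Y i) {}" if D: "finite D" "card D = card S" for D
  proof -
    have "exch (\<Union>(i, x)\<in>D \<times> ?K. {x} \<odot> \<Psi> i) {}"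
    proof (rule exch_card_S_cubes[OF D])
      fix i x assume "i \<in> D" "x \<subseteq> {..<k}"
      moreover from this have "finite x" using finite_subset by auto
      ultimately show "{x} \<odot> \<Psi> i = {x} \<or> exch {x} ({x} \<odot> \<Psi> i) \<and> x \<notin> {x} \<odot> \<Psi> i"
        using exch_translate[OF \<Theta>(1), of x i] not_subset_mul[of x "{x}" "\<Theta> i" k] \<Theta>(2,3)
        by (auto simp: \<Psi>_def)
    next
      show "disjoint_family_on (\<lambda>(i, x). {x} \<odot> \<Psi> i) (D \<times> ?K)"
        unfolding disjoint_family_on_def
      proof (intro ballI impI)
        fix p q assume pq: "p \<in> D \<times> ?K" "q \<in> D \<times> ?K" "p \<noteq> q"
        obtain i x j y where [simp]: "p = (i, x)" "q = (j, y)" by (cases p, cases q)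
        have "({x} \<odot> \<Psi> i) \<inter> ({y} \<odot> \<Psi> j) = {}"
          using pq \<Psi>U \<Psi>d[of i j] by (intro mul_disjoint[of _ "{..<k}"]) auto
        then show "(case p of (i, x) \<Rightarrow> {x} \<odot> \<Psi> i) \<inter> (case q of (i, x) \<Rightarrow> {x} \<odot> \<Psi> i) = {}" by simp
      qed
    qed
    moreover have "(\<Union>(i, x)\<in>D \<times> ?K. {x} \<odot> \<Psi> i) = (\<Union>i\<in>D. Y i)"
      unfolding Y_def by (subst (2) mul_UN) auto
    ultimately show ?thesis by simp
  qed
  have multi: "exch (\<Union>i\<in>D. Y i) {}" if "finite D" "card D = card S * q" for D q
    using that
  proof (induction q arbitrary: D)
    case 0
    then show ?case by simp
  next
    case (Suc q)
    then obtain D0 where D0: "D0 \<subseteq> D" "card D0 = card S"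
      by (metis le_add1 mult_Suc_right obtain_subset_with_card_n)
    then have fin: "finite D0" using Suc.prems(1) finite_subset by auto
    have "card (D - D0) = card S * q" using D0 Suc.prems fin by (simp add: card_Diff_subset)
    then have "exch (\<Union>i\<in>D - D0. Y i) {}" using Suc.prems by (intro Suc.IH) simp_all
    moreover have "(\<Union>i\<in>D0. Y i) \<inter> (\<Union>i\<in>D - D0. Y i) = {}" by (auto dest: Yeq)
    ultimately have "exch ((\<Union>i\<in>D0. Y i) \<union> (\<Union>i\<in>D - D0. Y i)) ({} \<union> {})"
      using base[OF fin D0(2)] by (intro exch_Un) auto
    moreover have "(\<Union>i\<in>D0. Y i) \<union> (\<Union>i\<in>D - D0. Y i) = (\<Union>i\<in>D. Y i)" using D0(1) by blast
    ultimately show ?case by simp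
  qed
  define F where "F = (\<Union>i<n. Y i)"
  define \<D> where "\<D> = (\<lambda>D. \<Union>i\<in>D. Y i) ` {D. D \<subseteq> {..<n} \<and> card S dvd card D}"
  have finF: "finite (\<Union>F)" using Yfin by (auto simp: F_def Union_UN)
  have "\<exists>E. finite (\<Union>E) \<and> E \<inter> F = {} \<and> tileable E \<and> (\<forall>D\<in>\<D>. tileable (E \<union> D))"
  proof (rule common_gadget[OF _ _ finF])
    show "finite \<D>" unfolding \<D>_def by (intro finite_imageI) simp
    show "exch D {}" if D: "D \<in> \<D>" for D
    proof -
      obtain I q where I: "I \<subseteq> {..<n}" "card I = card S * q" "D = (\<Union>i\<in>I. Y i)"
        using D unfolding \<D>_def by (auto simp: dvd_def)
      then show ?thesis using multi[of I q] finite_subset[OF I(1)] by simp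
    qed
    show "D \<subseteq> F" if "D \<in> \<D>" for D using that unfolding \<D>_def F_def by auto
  qed
  then obtain E where E: "finite (\<Union>E)" "E \<inter> F = {}" "\<forall>D\<in>\<D>. tileable (E \<union> D)" by blast
  define Z where "Z = E \<union> F"
  have "finite (\<Union>Z)" using E(1) finF by (simp add: Z_def)
  then obtain c where c: "\<Union>Z \<subseteq> {..<c}" using coordinate_bound by metis
  have "tileable (Z - (\<Union>i\<in>J. Y i))" if J: "J \<subseteq> {..<n}" "card S dvd card J" for J
  proof -
    have "card ({..<n} - J) = n - card J" using J by (simp add: card_Diff_subset finite_subset)
    then have "(\<Union>i\<in>{..<n} - J. Y i) \<in> \<D>"
      unfolding \<D>_def using J assms by (intro imageI) (auto intro: dvd_diff_nat)
    moreover have "Z - (\<Union>i\<in>J. Y i) = E \<union> (\<Union>i\<in>{..<n} - J. Y i)"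
      using J(1) E(2) unfolding Z_def F_def by (auto dest: Yeq)
    ultimately show ?thesis using E(3) by simp
  qed
  moreover have "Y i \<subseteq> Z" if "i < n" for i using that by (auto simp: Z_def F_def)
  moreover have "disjoint_family_on Y {..<n}" using Yd by (auto simp: disjoint_family_on_def)
  moreover have "Z \<subseteq> Pow {..<max k c}" using c by (auto simp: subset_iff)
  ultimately show thesis using Y0 by (intro that[of "max k c" Y Z]) auto
qed

end

section \<open>Sparse leftovers\<close>

context shape begin

text \<open>
  The first \<open>a\<close> coordinates select, in the block belonging to \<open>f\<close>, which translate of \<open>S\<close> is tiled
  there; a point is left over only if it is missed in every block.
\<close>

lemma block_leftover:
  assumes "finite \<F>" "\<And>f \<alpha>. f \<in> \<F> \<Longrightarrow> \<alpha> \<subseteq> {..<a} \<Longrightarrow> f \<alpha> \<subseteq> {..<k}"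
  shows "\<exists>d\<ge>a. \<exists>L \<subseteq> Pow {..<d}. tileable (Pow {..<d} - L) \<and>
    (\<forall>\<beta> \<subseteq> {a..<d}. \<forall>f\<in>\<F>. f ` {\<alpha>. \<alpha> \<subseteq> {..<a} \<and> \<alpha> \<union> \<beta> \<in> L} \<noteq> Pow {..<k})"
  using assms
proof (induction \<F> rule: finite_induct)
  case empty
  show ?case by (intro exI[of _ a] conjI exI[of _ "Pow {..<a}"]) auto
next
  case (insert f \<F>)
  then obtain d L where d: "d \<ge> a" "L \<subseteq> Pow {..<d}" "tileable (Pow {..<d} - L)"
    "\<forall>\<beta> \<subseteq> {a..<d}. \<forall>f\<in>\<F>. f ` {\<alpha>. \<alpha> \<subseteq> {..<a} \<and> \<alpha> \<union> \<beta> \<in> L} \<noteq> Pow {..<k}"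
    by auto
  define sh where "sh = (\<lambda>\<mu> :: nat set. (\<lambda>i. d + i) ` \<mu>)"
  have inj: "inj (\<lambda>i. d + i)" by auto
  have sh: "sh x \<subseteq> {d..}" "sh x \<subseteq> {d..<d + k} \<longleftrightarrow> x \<subseteq> {..<k}" "sh x = sh y \<longleftrightarrow> x = y" for x y
    by (auto simp: sh_def inj_image_eq_iff[OF inj])
  \<comment> \<open>Over a leftover point with selector part \<open>\<alpha>\<close> the new block
    receives the translate of \<open>S\<close> by \<open>f \<alpha>\<close>, moved to the
    coordinates from \<open>d\<close> on.\<close>
  define R where "R \<alpha> = (\<lambda>s. sh (f \<alpha> \<triangle> s)) ` S" for \<alpha>
  have tR: "tile (R \<alpha>)" for \<alpha>
  proof -
    have "R \<alpha> = (\<lambda>s. sh (f \<alpha>) \<triangle> (\<lambda>i. d + i) ` s) ` S"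
      by (simp add: R_def sh_def image_xr)
    then show ?thesis using tileI[of "\<lambda>i. d + i"] by simp
  qed
  have RU: "R \<alpha> \<subseteq> Pow {d..<d + k}" if "\<alpha> \<subseteq> {..<a}" for \<alpha>
  proof -
    have "f \<alpha> \<triangle> s \<subseteq> {..<k}" if "s \<in> S" for s
      using insert.prems[of f \<alpha>] \<open>\<alpha> \<subseteq> {..<a}\<close> S_sub that by (intro xr_subset) auto
    then show ?thesis using sh(2) unfolding R_def by blast
  qed
  let ?B = "Pow {d..<d + k}"
  define L' where "L' = {l \<union> \<mu> |l \<mu>. l \<in> L \<and> \<mu> \<in> ?B - R (l \<inter> {..<a})}"
  have dec: "(l \<union> \<mu>) \<inter> {..<d} = l" "(l \<union> \<mu>) \<inter> {d..<d + k} = \<mu>" if "l \<subseteq> {..<d}" "\<mu> \<in> ?B" for l \<mu>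
    using that by auto
  have un: "l \<triangle> \<mu> = l \<union> \<mu>" if "l \<subseteq> {..<d}" "\<mu> \<in> ?B" for l \<mu>
    by (rule xr_disjoint) (use that in force)
  have L'_iff: "l \<union> \<mu> \<in> L' \<longleftrightarrow> l \<in> L \<and> \<mu> \<notin> R (l \<inter> {..<a})" if "l \<subseteq> {..<d}" "\<mu> \<in> ?B" for l \<mu>
  proof
    assume "l \<union> \<mu> \<in> L'"
    then obtain l' \<mu>' where *: "l \<union> \<mu> = l' \<union> \<mu>'" "l' \<in> L" "\<mu>' \<in> ?B" "\<mu>' \<notin> R (l' \<inter> {..<a})"
      by (auto simp: L'_def)
    then have "l' \<subseteq> {..<d}" using d(2) by auto
    then have "l = l'" "\<mu> = \<mu>'" using dec[OF that] dec[of l' \<mu>', OF _ *(3)] *(1) by simp_all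
    then show "l \<in> L \<and> \<mu> \<notin> R (l \<inter> {..<a})" using * by simp
  qed (use that in \<open>auto simp: L'_def\<close>)
  have split: "\<exists>l \<mu>. x = l \<union> \<mu> \<and> l \<subseteq> {..<d} \<and> \<mu> \<in> ?B" if "x \<subseteq> {..<d + k}" for x
    using that by (intro exI[of _ "x \<inter> {..<d}"] exI[of _ "x \<inter> {d..<d + k}"]) auto
  have "Pow {..<d + k} - L' = (\<Union>\<mu>\<in>?B. {\<mu>} \<odot> (Pow {..<d} - L)) \<union> (\<Union>l\<in>L. {l} \<odot> R (l \<inter> {..<a}))"
  proof (intro equalityI subsetI)
    fix x assume x: "x \<in> Pow {..<d + k} - L'"
    then obtain l \<mu> where lm: "x = l \<union> \<mu>" "l \<subseteq> {..<d}" "\<mu> \<in> ?B" using split[of x] by auto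
    show "x \<in> (\<Union>\<mu>\<in>?B. {\<mu>} \<odot> (Pow {..<d} - L)) \<union> (\<Union>l\<in>L. {l} \<odot> R (l \<inter> {..<a}))"
    proof (cases "l \<in> L")
      case True
      then have "l \<triangle> \<mu> \<in> {l} \<odot> R (l \<inter> {..<a})" using x lm L'_iff[of l \<mu>] by (intro mulI) auto
      then show ?thesis using True lm un[of l \<mu>] by auto
    next
      case False
      then have "\<mu> \<triangle> l \<in> {\<mu>} \<odot> (Pow {..<d} - L)" using lm by (intro mulI) auto
      then show ?thesis using lm un[of l \<mu>] by (auto simp: xr_commute)
    qed
  next
    fix x assume "x \<in> (\<Union>\<mu>\<in>?B. {\<mu>} \<odot> (Pow {..<d} - L)) \<union> (\<Union>l\<in>L. {l} \<odot> R (l \<inter> {..<a}))"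
    then obtain l \<mu> where lm: "x = l \<triangle> \<mu>" "l \<subseteq> {..<d}" "\<mu> \<in> ?B" "l \<notin> L \<or> \<mu> \<in> R (l \<inter> {..<a})"
    proof (elim UnE UN_E)
      fix \<mu> assume *: "\<mu> \<in> ?B" "x \<in> {\<mu>} \<odot> (Pow {..<d} - L)"
      then obtain l where "l \<in> Pow {..<d} - L" "x = \<mu> \<triangle> l" by (auto elim!: mulE)
      then show ?thesis using that[of l \<mu>] *(1) by (simp add: xr_commute)
    next
      fix l assume *: "l \<in> L" "x \<in> {l} \<odot> R (l \<inter> {..<a})"
      then obtain \<mu> where "\<mu> \<in> R (l \<inter> {..<a})" "x = l \<triangle> \<mu>" by (auto elim!: mulE)
      then show ?thesis using that[of l \<mu>] * d(2) RU[of "l \<inter> {..<a}"] by auto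
    qed
    moreover from this have "x \<subseteq> {..<d + k}" using un[of l \<mu>] by force
    ultimately show "x \<in> Pow {..<d + k} - L'" using un[of l \<mu>] L'_iff[of l \<mu>] by simp
  qed
  moreover have "tileable ((\<Union>\<mu>\<in>?B. {\<mu>} \<odot> (Pow {..<d} - L)) \<union> (\<Union>l\<in>L. {l} \<odot> R (l \<inter> {..<a})))"
  proof (rule tileable_Un)
    show "tileable (\<Union>\<mu>\<in>?B. {\<mu>} \<odot> (Pow {..<d} - L))"
      using d(3) by (rule tileable_fibres[of _ _ "{d..}"]) auto
    show "tileable (\<Union>l\<in>L. {l} \<odot> R (l \<inter> {..<a}))"
    proof (rule tileable_fibres[of _ _ "{..<d}"])
      fix l assume "l \<in> L"
      show "\<Union>(R (l \<inter> {..<a})) \<inter> {..<d} = {}" using RU[of "l \<inter> {..<a}"] by force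
    qed (use d(2) tR tileable_tile in auto)
    show "(\<Union>\<mu>\<in>?B. {\<mu>} \<odot> (Pow {..<d} - L)) \<inter> (\<Union>l\<in>L. {l} \<odot> R (l \<inter> {..<a})) = {}"
    proof (rule equals0I)
      fix x assume "x \<in> (\<Union>\<mu>\<in>?B. {\<mu>} \<odot> (Pow {..<d} - L)) \<inter> (\<Union>l\<in>L. {l} \<odot> R (l \<inter> {..<a}))"
      then obtain l \<mu> l' \<mu>' where x: "\<mu> \<in> ?B" "l \<in> Pow {..<d} - L" "x = \<mu> \<triangle> l" "l' \<in> L"
          "\<mu>' \<in> R (l' \<inter> {..<a})" "x = l' \<triangle> \<mu>'"
        by (auto elim!: mulE)
      moreover have "\<mu>' \<in> ?B" using RU[of "l' \<inter> {..<a}"] x(5) by auto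
      ultimately have "l = l'"
        using xr_separated(1)[of l \<mu> l' \<mu>' "{..<d}"] d(2) by (force simp: xr_commute)
      then show False using x by simp
    qed
  qed
  ultimately have "tileable (Pow {..<d + k} - L')" by simp
  moreover have "L' \<subseteq> Pow {..<d + k}" using d(2) by (force simp: L'_def)
  moreover have "g ` {\<alpha>. \<alpha> \<subseteq> {..<a} \<and> \<alpha> \<union> \<beta> \<in> L'} \<noteq> Pow {..<k}"
    if \<beta>: "\<beta> \<subseteq> {a..<d + k}" and g: "g \<in> insert f \<F>" for \<beta> g
  proof
    assume onto: "g ` {\<alpha>. \<alpha> \<subseteq> {..<a} \<and> \<alpha> \<union> \<beta> \<in> L'} = Pow {..<k}"
    define \<nu> \<mu> where "\<nu> = \<beta> \<inter> {a..<d}" and "\<mu> = \<beta> \<inter> {d..<d + k}"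
    have \<beta>': "\<beta> = \<nu> \<union> \<mu>" using \<beta> by (auto simp: \<nu>_def \<mu>_def)
    have iff: "\<alpha> \<union> \<beta> \<in> L' \<longleftrightarrow> \<alpha> \<union> \<nu> \<in> L \<and> \<mu> \<notin> R \<alpha>" if "\<alpha> \<subseteq> {..<a}" for \<alpha>
    proof -
      have "\<alpha> \<union> \<nu> \<subseteq> {..<d}" using that d(1) by (force simp: \<nu>_def)
      moreover have "(\<alpha> \<union> \<nu>) \<inter> {..<a} = \<alpha>" using that by (force simp: \<nu>_def)
      ultimately show ?thesis
        using L'_iff[of "\<alpha> \<union> \<nu>" \<mu>] unfolding \<beta>' by (simp add: Un_assoc \<mu>_def)
    qed
    show False
    proof (cases "g = f")
      case True
      \<comment> \<open>If \<open>f\<close> were onto, the block part of \<open>\<beta>\<close>,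
        moved back, would be \<open>f \<alpha>\<close> for a remaining \<open>\<alpha>\<close>. As
        \<open>{} \<in> S\<close>, that block part lies in the tile used over
        \<open>\<alpha>\<close>, so the point was covered.\<close>
      define s where "s = {i. d + i \<in> \<mu>}"
      have \<mu>s: "\<mu> = sh s" by (force simp: s_def sh_def \<mu>_def image_iff le_iff_add)
      have "s \<in> Pow {..<k}" by (auto simp: s_def \<mu>_def)
      then obtain \<alpha> where \<alpha>: "\<alpha> \<subseteq> {..<a}" "\<alpha> \<union> \<beta> \<in> L'" "f \<alpha> = s" using onto True by (auto simp: set_eq_iff image_iff) metis
      have "\<mu> \<in> R \<alpha>" unfolding R_def using empty_S \<alpha>(3) \<mu>s by (intro image_eqI[of _ _ "{}"]) auto
      then show False using iff \<alpha> by auto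
    next
      case False
      then have "g \<in> \<F>" using g by auto
      moreover have "\<nu> \<subseteq> {a..<d}" by (auto simp: \<nu>_def)
      ultimately have "g ` {\<alpha>. \<alpha> \<subseteq> {..<a} \<and> \<alpha> \<union> \<nu> \<in> L} \<noteq> Pow {..<k}" using d(4) by blast
      moreover have "g ` {\<alpha>. \<alpha> \<subseteq> {..<a} \<and> \<alpha> \<union> \<beta> \<in> L'} \<subseteq> g ` {\<alpha>. \<alpha> \<subseteq> {..<a} \<and> \<alpha> \<union> \<nu> \<in> L}"
        using iff by auto
      moreover have "g ` {\<alpha>. \<alpha> \<subseteq> {..<a} \<and> \<alpha> \<union> \<nu> \<in> L} \<subseteq> Pow {..<k}"
        using insert.prems[of g] g by blast
      ultimately show False using onto by auto
    qed
  qed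
  ultimately show ?case using d(1) by (intro exI[of _ "d + k"] conjI exI[of _ L']) auto
qed

text \<open>Giving a block to every map from the selector cube to \<open>Pow {..<k}\<close> forces
  the fibres of \<open>L\<close> over the other coordinates to have fewer than \<open>2 ^ k\<close>
  points. After discarding one separating coordinate for each pair in a fibre, \<open>c\<close>
  directions remain, and the subcubes they span at the leftover points are disjoint.\<close>

lemma sparse_leftover:
  obtains d L C where "L \<subseteq> Pow {..<d}" "tileable (Pow {..<d} - L)"
    "\<And>l. l \<in> L \<Longrightarrow> C l \<subseteq> {..<d} \<and> card (C l) = c"
    "\<And>l l' u u'. l \<in> L \<Longrightarrow> l' \<in> L \<Longrightarrow> u \<subseteq> C l \<Longrightarrow> u' \<subseteq> C l' \<Longrightarrow> l \<triangle> u = l' \<triangle> u' \<Longrightarrow> l = l'"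
proof -
  \<comment> \<open>The second summand pays for one discarded coordinate per ordered pair of points
    in a fibre.\<close>
  define a where "a = c + 2 ^ k * 2 ^ k"
  define \<F> where "\<F> = Pow {..<a} \<rightarrow>\<^sub>E Pow {..<k}"
  have "finite \<F>" unfolding \<F>_def by (intro finite_PiE) auto
  moreover have "f \<alpha> \<subseteq> {..<k}" if "f \<in> \<F>" "\<alpha> \<subseteq> {..<a}" for f \<alpha> using that by (auto simp: \<F>_def PiE_def Pi_def)
  ultimately have "\<exists>d\<ge>a. \<exists>L \<subseteq> Pow {..<d}. tileable (Pow {..<d} - L) \<and>
      (\<forall>\<beta> \<subseteq> {a..<d}. \<forall>f\<in>\<F>. f ` {\<alpha>. \<alpha> \<subseteq> {..<a} \<and> \<alpha> \<union> \<beta> \<in> L} \<noteq> Pow {..<k})"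
    by (rule block_leftover)
  then obtain d L where d: "d \<ge> a" "L \<subseteq> Pow {..<d}" "tileable (Pow {..<d} - L)"
    "\<forall>\<beta> \<subseteq> {a..<d}. \<forall>f\<in>\<F>. f ` {\<alpha>. \<alpha> \<subseteq> {..<a} \<and> \<alpha> \<union> \<beta> \<in> L} \<noteq> Pow {..<k}"
    by (elim exE conjE) (rule that)
  define N where "N \<beta> = {\<alpha>. \<alpha> \<subseteq> {..<a} \<and> \<alpha> \<union> \<beta> \<in> L}" for \<beta>
  have finN: "finite (N \<beta>)" for \<beta> by (rule finite_subset[of _ "Pow {..<a}"]) (auto simp: N_def)
  have cN: "card (N \<beta>) < 2 ^ k" if "\<beta> \<subseteq> {a..<d}" for \<beta>
  proof (rule ccontr)
    assume "\<not> card (N \<beta>) < 2 ^ k"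
    then obtain M where M: "M \<subseteq> N \<beta>" "card M = card (Pow {..<k})"
      by (metis card_Pow card_lessThan finite_lessThan not_less obtain_subset_with_card_n)
    then have "finite M" using finN finite_subset by blast
    then obtain g where g: "bij_betw g M (Pow {..<k})" using M(2) finite_same_card_bij[of M "Pow {..<k}"] by auto
    \<comment> \<open>The default \<open>{}\<close> outside \<open>M\<close> keeps the values inside
      \<open>Pow {..<k}\<close>, while the map is already onto on \<open>M\<close>.\<close>
    define f where "f = (\<lambda>\<alpha>\<in>Pow {..<a}. if \<alpha> \<in> M then g \<alpha> else {})"
    have "g \<alpha> \<subseteq> {..<k}" if "\<alpha> \<in> M" for \<alpha> using g that by (auto simp: bij_betw_def)
    then have "f \<in> \<F>" by (auto simp: f_def \<F>_def)
    moreover have "f ` N \<beta> = Pow {..<k}"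
    proof
      show "f ` N \<beta> \<subseteq> Pow {..<k}" using \<open>f \<in> \<F>\<close> by (auto simp: \<F>_def N_def PiE_def Pi_def)
      have "f ` M = g ` M" using M(1) by (intro image_cong) (auto simp: f_def N_def)
      then have "f ` M = Pow {..<k}" using g by (simp add: bij_betw_def)
      then show "Pow {..<k} \<subseteq> f ` N \<beta>" using image_mono[OF M(1), of f] by simp
    qed
    ultimately show False using d(4) that unfolding N_def by blast
  qed
  have "\<exists>C \<subseteq> {..<a}. card C = c \<and> (\<forall>\<alpha>\<in>N \<beta>. \<forall>\<gamma>\<in>N \<beta>. \<alpha> \<noteq> \<gamma> \<longrightarrow> \<not> \<alpha> \<triangle> \<gamma> \<subseteq> C)"
    if "\<beta> \<subseteq> {a..<d}" for \<beta>
  proof -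
    have "\<exists>i. i \<in> \<alpha> \<triangle> \<gamma>" if "\<alpha> \<noteq> \<gamma>" for \<alpha> \<gamma> :: "nat set" using that by auto
    then obtain w where w: "\<And>\<alpha> \<gamma> :: nat set. \<alpha> \<noteq> \<gamma> \<Longrightarrow> w (\<alpha>, \<gamma>) \<in> \<alpha> \<triangle> \<gamma>"
      by (metis case_prod_conv)
    \<comment> \<open>Pairs with equal entries contribute an arbitrary coordinate, which the crude
      count covers as well.\<close>
    define Pr where "Pr = w ` (N \<beta> \<times> N \<beta>)"
    have "card Pr \<le> card (N \<beta>) * card (N \<beta>)"
      unfolding Pr_def by (metis card_cartesian_product card_image_le finN finite_cartesian_product)
    also have "\<dots> \<le> 2 ^ k * 2 ^ k" using cN[OF that] by (intro mult_le_mono) auto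
    finally have "card ({..<a} - Pr) \<ge> c"
      using diff_card_le_card_Diff[of Pr "{..<a}"] finN by (auto simp: a_def Pr_def)
    then obtain C where C: "C \<subseteq> {..<a} - Pr" "card C = c" by (metis obtain_subset_with_card_n)
    moreover have "\<not> \<alpha> \<triangle> \<gamma> \<subseteq> C" if "\<alpha> \<in> N \<beta>" "\<gamma> \<in> N \<beta>" "\<alpha> \<noteq> \<gamma>" for \<alpha> \<gamma>
      using w[OF that(3)] C(1) that(1,2) unfolding Pr_def by blast
    ultimately show ?thesis by blast
  qed
  then obtain C0 where C0: "\<And>\<beta>. \<beta> \<subseteq> {a..<d} \<Longrightarrow> C0 \<beta> \<subseteq> {..<a} \<and> card (C0 \<beta>) = c \<and>
      (\<forall>\<alpha>\<in>N \<beta>. \<forall>\<gamma>\<in>N \<beta>. \<alpha> \<noteq> \<gamma> \<longrightarrow> \<not> \<alpha> \<triangle> \<gamma> \<subseteq> C0 \<beta>)" by metis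
  define C where "C l = C0 (l \<inter> {a..<d})" for l
  have C: "C l \<subseteq> {..<a}" "card (C l) = c" for l
    using C0[of "l \<inter> {a..<d}"] unfolding C_def by auto
  show thesis
  proof (rule that[of L d C])
    fix l l' u u' assume l: "l \<in> L" "l' \<in> L" "u \<subseteq> C l" "u' \<subseteq> C l'" "l \<triangle> u = l' \<triangle> u'"
    define \<beta> where "\<beta> = l \<inter> {a..<d}"
    \<comment> \<open>All chosen directions lie below \<open>a\<close>, so both points agree from
      \<open>a\<close> on and therefore have the same direction set.\<close>
    have "i \<in> l \<longleftrightarrow> i \<in> l'" if "i \<ge> a" for i
    proof -
      have "i \<notin> u" "i \<notin> u'" using that l(3,4) C(1)[of l] C(1)[of l'] by (auto simp: subset_iff)
      then show ?thesis using l(5) by (metis mem_xr)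
    qed
    then have \<beta>': "\<beta> = l' \<inter> {a..<d}" by (auto simp: \<beta>_def)
    have g: "y = y \<inter> {..<a} \<union> y \<inter> {a..<d}" if "y \<in> L" for y
      using that d(2) by (auto simp: subset_iff)
    have un: "l = l \<inter> {..<a} \<union> \<beta>" "l' = l' \<inter> {..<a} \<union> \<beta>"
      using g[OF l(1)] g[OF l(2), folded \<beta>'] by (simp_all only: \<beta>_def)
    then have N: "l \<inter> {..<a} \<in> N \<beta>" "l' \<inter> {..<a} \<in> N \<beta>" using l(1,2) by (auto simp: N_def)
    have "(l \<inter> {..<a}) \<triangle> (l' \<inter> {..<a}) \<subseteq> C0 \<beta>"
    proof
      fix i assume "i \<in> (l \<inter> {..<a}) \<triangle> (l' \<inter> {..<a})"
      then have "i \<in> u \<union> u'" using l(5) by (auto simp: set_eq_iff)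
      then show "i \<in> C0 \<beta>" using l(3,4) by (auto simp: C_def \<beta>_def \<beta>'[unfolded \<beta>_def])
    qed
    moreover have "\<beta> \<subseteq> {a..<d}" by (auto simp: \<beta>_def)
    ultimately have "l \<inter> {..<a} = l' \<inter> {..<a}" 
      using C0[THEN conjunct2, THEN conjunct2, rule_format, OF _ N] by blast
    then show "l = l'" using un by simp
  next
    fix l assume "l \<in> L"
    show "C l \<subseteq> {..<d} \<and> card (C l) = c" using C[of l] d(1) by auto
  qed (use d in auto)
qed

end

section \<open>Modular covers\<close>

text \<open>Call \<open>i\<close> a change if the bits at \<open>i\<close> and \<open>i + 1\<close>
  differ. Then \<open>ups\<close> are the rises of the change indicator (patterns \<open>001\<close>
  and \<open>110\<close>), and \<open>downs\<close> are its falls (\<open>011\<close> and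
  \<open>100\<close>).\<close>

definition ups :: "nat \<Rightarrow> nat set \<Rightarrow> nat set" where
  "ups n x = {i. i + 2 < n \<and> (i \<in> x \<longleftrightarrow> i + 1 \<in> x) \<and> (i + 1 \<in> x \<longleftrightarrow> i + 2 \<notin> x)}"

definition downs :: "nat \<Rightarrow> nat set \<Rightarrow> nat set" where
  "downs n x = {i. i + 2 < n \<and> (i \<in> x \<longleftrightarrow> i + 1 \<notin> x) \<and> (i + 1 \<in> x \<longleftrightarrow> i + 2 \<in> x)}"

text \<open>These places tell whether bit \<open>i + 2\<close> equals bit \<open>i\<close>, so
  together with its first two bits they determine a string.\<close>

definition turns :: "nat \<Rightarrow> nat set \<Rightarrow> nat set" where
  "turns n x = {i. i + 2 < n \<and> (i \<in> x \<longleftrightarrow> i + 2 \<notin> x)}"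

definition changes :: "nat \<Rightarrow> nat set \<Rightarrow> nat set" where
  "changes n x = {i. i + 1 < n \<and> (i \<in> x \<longleftrightarrow> i + 1 \<notin> x)}"

text \<open>Toggling the middle of a pattern in \<open>ups\<close> moves one change from
  \<open>i + 1\<close> to \<open>i\<close>, so this sum of positions drops by exactly one.\<close>

definition potential :: "nat \<Rightarrow> nat set \<Rightarrow> nat" where
  "potential n x = \<Sum>(changes n x)"

lemma turns_eq: "turns n x = ups n x \<union> downs n x"
  by (auto simp: turns_def ups_def downs_def)

lemma finite_ups [simp]: "finite (ups n x)" and finite_downs [simp]: "finite (downs n x)"
  and finite_turns [simp]: "finite (turns n x)" and finite_changes [simp]: "finite (changes n x)"
  by (rule finite_subset[of _ "{..<n}"]; auto simp: ups_def downs_def turns_def changes_def)+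

text \<open>Falls and rises of a Boolean sequence alternate, so their numbers differ only through
  the first and the last value.\<close>

lemma falls_rises:
  "card {i. i < t \<and> b i \<and> \<not> b (Suc i)} + of_bool (b t) =
   card {i. i < t \<and> \<not> b i \<and> b (Suc i)} + of_bool (b (0::nat))"
proof (induction t)
  case 0 then show ?case by simp
next
  case (Suc t)
  have "{i. i < Suc t \<and> P i} = (if P t then insert t {i. i < t \<and> P i} else {i. i < t \<and> P i})" for P
    by (auto simp: less_Suc_eq)
  note e = this[of "\<lambda>i. b i \<and> \<not> b (Suc i)"] this[of "\<lambda>i. \<not> b i \<and> b (Suc i)"]
  show ?case unfolding e using Suc by (cases "b t"; cases "b (Suc t)") simp_all
qed

text \<open>Falls and rises of the change indicator are compared on an initial segment, which later
  permits local bounds up to a given place.\<close>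

lemma card_downs_le: "card (downs n x \<inter> {..<t}) \<le> card (ups n x \<inter> {..<t}) + 1"
proof -
  \<comment> \<open>The cut-off \<open>n - 2\<close> encodes \<open>i + 2 < n\<close>, also for
    \<open>n < 2\<close>, where it is \<open>0\<close>.\<close>
  let ?b = "\<lambda>i. i \<in> x \<longleftrightarrow> i + 1 \<notin> x" and ?t = "min t (n - 2)"
  have "downs n x \<inter> {..<t} = {i. i < ?t \<and> ?b i \<and> \<not> ?b (Suc i)}"
    by (auto simp: downs_def)
  moreover have "ups n x \<inter> {..<t} = {i. i < ?t \<and> \<not> ?b i \<and> ?b (Suc i)}"
    by (auto simp: ups_def)
  ultimately show ?thesis using falls_rises[of ?t ?b] by (simp add: of_bool_def split: if_splits)
qed

lemma card_turns_le: "card (turns n x \<inter> {..<t}) \<le> 2 * card (ups n x \<inter> {..<t}) + 1"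
proof -
  have "card (turns n x \<inter> {..<t}) \<le> card (ups n x \<inter> {..<t}) + card (downs n x \<inter> {..<t})"
    unfolding turns_eq Int_Un_distrib2 by (rule card_Un_le)
  then show ?thesis using card_downs_le[of n x t] by simp
qed

lemma ups_spaced: "i \<in> ups n x \<Longrightarrow> Suc i \<notin> ups n x"
  by (auto simp: ups_def)

text \<open>Two such patterns never start at neighbouring places, so the middle of one is no bit of
  another, and several toggles can be made independently.\<close>

lemma ups_toggle: "i \<in> ups n x \<Longrightarrow> j \<in> ups n x \<Longrightarrow> j \<noteq> i \<Longrightarrow> j \<in> ups n (x \<triangle> {Suc i})"
  using ups_spaced[of i n x] ups_spaced[of j n x] by (auto simp: ups_def)

lemma potential_toggle:
  assumes "i \<in> ups n x"
  shows "potential n (x \<triangle> {Suc i}) + 1 = potential n x"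
proof -
  have i: "i \<notin> changes n x" "Suc i \<in> changes n x"
    using assms by (auto simp: ups_def changes_def)
  have "changes n (x \<triangle> {Suc i}) = insert i (changes n x - {Suc i})"
    using assms by (auto simp: ups_def changes_def)
  then have "potential n (x \<triangle> {Suc i}) = i + \<Sum>(changes n x - {Suc i})"
    using i by (simp add: potential_def)
  moreover have "\<Sum>(changes n x) = Suc i + \<Sum>(changes n x - {Suc i})"
    using i by (subst sum.remove[of _ "Suc i"]) auto
  ultimately show ?thesis by (simp add: potential_def)
qed

lemma potential_toggles:
  assumes "finite A" "A \<subseteq> ups n x"
  shows "potential n (x \<triangle> Suc ` A) + card A = potential n x"
  using assms
proof (induction A arbitrary: x rule: finite_induct)
  case (insert a A)
  have "x \<triangle> Suc ` insert a A = (x \<triangle> {Suc a}) \<triangle> Suc ` A"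
    using insert.hyps by (auto simp: set_eq_iff)
  moreover have "A \<subseteq> ups n (x \<triangle> {Suc a})"
    using insert.prems insert.hyps ups_toggle[of a n x] by auto
  ultimately show ?case
    using insert.IH[of "x \<triangle> {Suc a}"] potential_toggle[of a n x] insert.prems insert.hyps by simp
qed simp

text \<open>Whether \<open>j\<close> is a turn depends on bits \<open>j\<close> and
  \<open>j + 2\<close> only. Members of \<open>A\<close> are never adjacent, so toggling leaves both
  bits of a turn in \<open>A\<close> alone, and elsewhere it matters only right next to
  \<open>A\<close>.\<close>

lemma toggled_turns:
  assumes "A \<subseteq> ups n x"
  shows "A \<subseteq> turns n (x \<triangle> Suc ` A)"
    and "turns n (x \<triangle> Suc ` A) \<subseteq> turns n x \<union> Suc ` A \<union> (\<lambda>a. a - 1) ` A"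
proof
  fix i assume i: "i \<in> A"
  have "i \<notin> Suc ` A" using i assms ups_spaced by blast
  moreover have "i + 2 \<notin> Suc ` A" using i assms ups_spaced[of i n x] by auto
  ultimately show "i \<in> turns n (x \<triangle> Suc ` A)" using i assms by (auto simp: ups_def turns_def)
next
  show "turns n (x \<triangle> Suc ` A) \<subseteq> turns n x \<union> Suc ` A \<union> (\<lambda>a. a - 1) ` A"
  proof
    fix j assume j: "j \<in> turns n (x \<triangle> Suc ` A)"
    show "j \<in> turns n x \<union> Suc ` A \<union> (\<lambda>a. a - 1) ` A"
    proof (cases "j \<in> Suc ` A \<or> j + 2 \<in> Suc ` A")
      case True
      then show ?thesis
      proof
        assume "j + 2 \<in> Suc ` A"
        then have "Suc j \<in> A" by auto
        then show ?thesis by force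
      qed auto
    next
      case False
      then show ?thesis using j by (auto simp: turns_def)
    qed
  qed
qed

section \<open>Initial segments and counts of sets\<close>

lemma initial_subset:
  assumes "finite (U :: nat set)" "m \<le> card U"
  shows "\<exists>K \<subseteq> U. card K = m \<and> (\<forall>i\<in>U - K. \<forall>j\<in>K. j < i)"
  using assms(2)
proof (induction m)
  case 0 then show ?case by (intro exI[of _ "{}"]) auto
next
  case (Suc m)
  then obtain K where K: "K \<subseteq> U" "card K = m" "\<forall>i\<in>U - K. \<forall>j\<in>K. j < i" by auto
  have finK: "finite K" using K(1) assms(1) finite_subset by auto
  have "card (U - K) > 0" using K Suc.prems finK by (simp add: card_Diff_subset)
  then have ne: "U - K \<noteq> {}" by force
  define a where "a = Min (U - K)"
  have "a \<in> U - K" unfolding a_def using ne assms(1) by (intro Min_in) auto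
  moreover have "a \<le> i" if "i \<in> U - K" for i unfolding a_def using that assms(1) by (intro Min_le) auto
  ultimately have a: "a \<in> U - K" "\<And>i. i \<in> U - K \<Longrightarrow> a \<le> i" by auto
  have "card (insert a K) = Suc m" using a(1) K(2) finK by simp
  moreover have "\<forall>i\<in>U - insert a K. \<forall>j\<in>insert a K. j < i" using a K(3) by (force simp: le_neq_implies_less)
  ultimately show ?case using a(1) K(1) by (intro exI[of _ "insert a K"]) auto
qed

text \<open>All the elements counted lie at or below the largest of them, which satisfies the bound
  itself.\<close>

lemma card_initial_le:
  assumes "finite (D :: nat set)"
  shows "card {i \<in> D. card (D \<inter> {..i}) \<le> c} \<le> c"
proof (cases "{i \<in> D. card (D \<inter> {..i}) \<le> c} = {}")
  case True then show ?thesis by (metis card.empty le0)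
next
  case False
  let ?E = "{i \<in> D. card (D \<inter> {..i}) \<le> c}"
  have fin: "finite ?E" using assms by simp
  then have "Max ?E \<in> ?E" using False Max_in by blast
  moreover have "?E \<subseteq> D \<inter> {..Max ?E}" using fin by auto
  then have "card ?E \<le> card (D \<inter> {..Max ?E})" using assms by (intro card_mono) auto
  ultimately show ?thesis by auto
qed

lemma card_bounded_subsets: "card {D. D \<subseteq> {..<n} \<and> card D \<le> m} \<le> (n + 1) ^ m"
proof (induction m)
  case 0
  have "{D. D \<subseteq> {..<n} \<and> card D \<le> 0} = {{}}" by (auto dest: finite_subset[OF _ finite_lessThan])
  then show ?case by simp
next
  case (Suc m)
  let ?X = "{D. D \<subseteq> {..<n} \<and> card D \<le> m}"
  \<comment> \<open>The index \<open>n\<close> stands for inserting nothing.\<close>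
  let ?f = "\<lambda>(D, i). if i < n then insert i D else D"
  have fin: "finite ?X" by (rule finite_subset[of _ "Pow {..<n}"]) auto
  have "{D. D \<subseteq> {..<n} \<and> card D \<le> Suc m} \<subseteq> ?f ` (?X \<times> {..n})"
  proof
    fix D assume D: "D \<in> {D. D \<subseteq> {..<n} \<and> card D \<le> Suc m}"
    show "D \<in> ?f ` (?X \<times> {..n})"
    proof (cases "D = {}")
      case True
      then show ?thesis by (intro image_eqI[of _ _ "({}, n)"]) auto
    next
      case False
      then obtain i where i: "i \<in> D" by auto
      have "card (D - {i}) \<le> m" using D i finite_subset[of D "{..<n}"] by auto
      then show ?thesis using D i by (intro image_eqI[of _ _ "(D - {i}, i)"]) auto
    qed
  qed
  then have "card {D. D \<subseteq> {..<n} \<and> card D \<le> Suc m} \<le> card (?X \<times> {..n})"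
    using fin by (meson card_image_le card_mono finite_SigmaI finite_atMost finite_imageI le_trans)
  also have "\<dots> \<le> (n + 1) ^ m * (n + 1)" using mult_right_mono[OF Suc, of "n + 1"] by (simp add: card_cartesian_product)
  finally show ?case by (simp add: mult.commute)
qed

text \<open>A string is recovered from its first two bits and its set of turns. Fewer than
  \<open>k\<close> rises leave at most \<open>2 * k\<close> turns, and the first two bits account
  for the factor \<open>4\<close>.\<close>

lemma card_few_ups: "card {x. x \<subseteq> {..<n} \<and> card (ups n x) < k} \<le> 4 * (n + 1) ^ (2 * k)"
proof -
  let ?B = "{x. x \<subseteq> {..<n} \<and> card (ups n x) < k}"
  let ?X = "Pow {0, 1 :: nat} \<times> {D. D \<subseteq> {..<n} \<and> card D \<le> 2 * k}"
  let ?f = "\<lambda>x. (x \<inter> {0, 1}, turns n x)"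
  have "inj_on ?f ?B"
  proof (rule inj_onI)
    fix x y assume xy: "x \<in> ?B" "y \<in> ?B" "?f x = ?f y"
    have "i \<in> x \<longleftrightarrow> i \<in> y" if "i < n" for i
      using that
    proof (induction i rule: less_induct)
      case (less i)
      show ?case
      proof (cases "i < 2")
        case True
        then have "i = 0 \<or> i = 1" by auto
        then show ?thesis using xy(3) by (auto simp: set_eq_iff)
      next
        case False
        define j where "j = i - 2"
        have j: "i = j + 2" using False by (simp add: j_def)
        have "j \<in> x \<longleftrightarrow> j \<in> y" using less j by auto
        moreover have "j \<in> turns n x \<longleftrightarrow> j \<in> turns n y" using xy(3) by simp
        ultimately show ?thesis using less.prems by (auto simp: turns_def j)
      qed
    qed
    then show "x = y" using xy(1,2) by blast
  qed
  moreover have "?f ` ?B \<subseteq> ?X"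
  proof
    fix p assume "p \<in> ?f ` ?B"
    then obtain x where x: "x \<subseteq> {..<n}" "card (ups n x) < k" "p = ?f x" by auto
    have "turns n x \<inter> {..<n} = turns n x" "ups n x \<inter> {..<n} = ups n x"
      by (auto simp: turns_def ups_def)
    then have "card (turns n x) \<le> 2 * k" using card_turns_le[of n x n] x(2) by simp
    moreover have "turns n x \<subseteq> {..<n}" by (auto simp: turns_def)
    ultimately show "p \<in> ?X" using x(3) by auto
  qed
  moreover have "finite ?X" by (intro finite_cartesian_product) (auto intro: finite_subset[of _ "Pow {..<n}"])
  ultimately have "card ?B \<le> card ?X" by (rule card_inj_on_le)
  also have "\<dots> \<le> 4 * (n + 1) ^ (2 * k)"
    using card_bounded_subsets[of n "2 * k"] by (simp add: card_cartesian_product card_Pow)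
  finally show ?thesis .
qed

section \<open>Triangular congruences and greedy colourings\<close>

lemma residue_complement: "h > 0 \<Longrightarrow> \<exists>v<h. h dvd R + v + (1::nat)"
proof (cases "(R + 1) mod h = 0")
  case True
  then show "h > 0 \<Longrightarrow> ?thesis" by (intro exI[of _ 0]) auto
next
  case False
  assume h: "h > 0"
  have "R + (h - (R + 1) mod h) + 1 = h * ((R + 1) div h) + h"
    using h mod_less_divisor[OF h, of "R + 1"] mult_div_mod_eq[of h "R + 1"] by linarith
  then show ?thesis using False h
    by (intro exI[of _ "h - (R + 1) mod h"]) auto
qed

text \<open>The incidence matrix of the sets \<open>T x\<close> is unitriangular with respect to
  \<open>pot\<close>, so the congruences are solved from the highest potential downwards.\<close>

lemma triangular_residues:
  fixes pot :: "'a \<Rightarrow> nat"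
  assumes "finite G" "h > 0" "\<And>x. x \<in> G \<Longrightarrow> x \<in> T x"
    and "\<And>x z. x \<in> G \<Longrightarrow> z \<in> T x \<Longrightarrow> z \<noteq> x \<Longrightarrow> pot z < pot x"
  shows "\<exists>a :: 'a \<Rightarrow> nat. (\<forall>x. a x < h) \<and> (\<forall>z\<in>G. h dvd (\<Sum>x | x \<in> G \<and> z \<in> T x. a x) + 1)"
proof -
  obtain M where M: "\<And>z. z \<in> G \<Longrightarrow> pot z < M"
    using finite_nat_bounded[of "pot ` G"] assms(1) by auto
  \<comment> \<open>Stage \<open>n\<close> settles all \<open>z\<close> with
    \<open>pot z + n \<ge> M\<close>. Changes at lower levels do not affect them, since any other
    \<open>x\<close> with \<open>z \<in> T x\<close> has larger potential than
    \<open>z\<close>.\<close>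
  have "\<exists>a :: 'a \<Rightarrow> nat. (\<forall>x. a x < h) \<and>
      (\<forall>z\<in>G. pot z + n \<ge> M \<longrightarrow> h dvd (\<Sum>x | x \<in> G \<and> z \<in> T x. a x) + 1)" for n
  proof (induction n)
    case 0
    have "\<not> pot z + 0 \<ge> M" if "z \<in> G" for z using M[OF that] by simp
    then show ?case using assms(2) by (intro exI[of _ "\<lambda>_. 0"]) auto
  next
    case (Suc n)
    then obtain a :: "'a \<Rightarrow> nat" where a: "\<And>x. a x < h"
      "\<And>z. z \<in> G \<Longrightarrow> pot z + n \<ge> M \<Longrightarrow> h dvd (\<Sum>x | x \<in> G \<and> z \<in> T x. a x) + 1" by auto
    have "\<forall>z. \<exists>v<h. h dvd (\<Sum>x | x \<in> G \<and> z \<in> T x \<and> x \<noteq> z. a x) + v + 1"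
      using residue_complement[OF assms(2)] by blast
    then obtain v where v: "\<And>z. v z < h" "\<And>z. h dvd (\<Sum>x | x \<in> G \<and> z \<in> T x \<and> x \<noteq> z. a x) + v z + 1"
      by metis
    define b where "b x = (if pot x + Suc n = M then v x else a x)" for x
    have "h dvd (\<Sum>x | x \<in> G \<and> z \<in> T x. b x) + 1" if z: "z \<in> G" "pot z + Suc n \<ge> M" for z
    proof -
      have above: "b x = a x" if "x \<in> G" "z \<in> T x" "x \<noteq> z" for x
        using assms(4)[OF that(1,2)] that(3) z(2) by (auto simp: b_def)
      have eq: "{x. x \<in> G \<and> z \<in> T x} = insert z {x. x \<in> G \<and> z \<in> T x \<and> x \<noteq> z}"
        using z(1) assms(3) by auto
      have s: "(\<Sum>x | x \<in> G \<and> z \<in> T x. f x) = f z + (\<Sum>x | x \<in> G \<and> z \<in> T x \<and> x \<noteq> z. f x)" for f :: "'a \<Rightarrow> nat"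
        unfolding eq using assms(1) by (subst sum.insert) auto
      have b: "(\<Sum>x | x \<in> G \<and> z \<in> T x \<and> x \<noteq> z. b x) = (\<Sum>x | x \<in> G \<and> z \<in> T x \<and> x \<noteq> z. a x)"
        by (intro sum.cong) (use above in auto)
      show ?thesis
      proof (cases "pot z + Suc n = M")
        case True
        then have "b z = v z" by (simp add: b_def)
        then show ?thesis unfolding s b using v(2)[of z] by (simp add: add.commute)
      next
        case False
        then have "b z = a z" "pot z + n \<ge> M" using z(2) by (auto simp: b_def)
        then show ?thesis unfolding s b using a(2)[OF z(1)] unfolding s by simp
      qed
    qed
    moreover have "\<And>x. b x < h" using a(1) v(1) by (simp add: b_def)
    ultimately show ?case by blast
  qed
  from this[of M] show ?thesis by auto
qed

text \<open>A new set meets at most \<open>h * \<Delta>\<close> earlier ones, at most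
  \<open>\<Delta>\<close> through each of its points, so one of \<open>h * \<Delta> + 1\<close>
  colours is free.\<close>

lemma greedy_colouring:
  assumes "finite V" "\<And>x. x \<in> V \<Longrightarrow> finite (T x) \<and> card (T x) \<le> h"
    and "\<And>z. card {x \<in> V. z \<in> T x} \<le> \<Delta>"
  shows "\<exists>col :: 'a \<Rightarrow> nat. \<forall>x\<in>V. col x \<le> h * \<Delta> \<and>
    (\<forall>y\<in>V. x \<noteq> y \<longrightarrow> T x \<inter> T y \<noteq> {} \<longrightarrow> col x \<noteq> col y)"
  using assms
proof (induction V rule: finite_induct)
  case empty then show ?case by simp
next
  case (insert x V)
  have le: "card {y \<in> V. z \<in> T y} \<le> \<Delta>" for z
    using insert.prems(2)[of z] insert.hyps(1)
      card_mono[of "{y \<in> insert x V. z \<in> T y}" "{y \<in> V. z \<in> T y}"] by fastforce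
  have "\<exists>col :: 'a \<Rightarrow> nat. \<forall>x\<in>V. col x \<le> h * \<Delta> \<and>
      (\<forall>y\<in>V. x \<noteq> y \<longrightarrow> T x \<inter> T y \<noteq> {} \<longrightarrow> col x \<noteq> col y)"
    using insert.prems(1) le by (intro insert.IH) auto
  then obtain col :: "'a \<Rightarrow> nat" where col: "\<forall>x\<in>V. col x \<le> h * \<Delta> \<and>
      (\<forall>y\<in>V. x \<noteq> y \<longrightarrow> T x \<inter> T y \<noteq> {} \<longrightarrow> col x \<noteq> col y)" ..
  define Nb where "Nb = {y \<in> V. T x \<inter> T y \<noteq> {}}"
  have "Nb = (\<Union>z\<in>T x. {y \<in> V. z \<in> T y})" by (auto simp: Nb_def)
  then have "card Nb \<le> (\<Sum>z\<in>T x. card {y \<in> V. z \<in> T y})"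
    using insert.prems(1)[of x] by (simp add: card_UN_le)
  also have "\<dots> \<le> (\<Sum>z\<in>T x. \<Delta>)" by (intro sum_mono le)
  also have "\<dots> \<le> h * \<Delta>" using insert.prems(1)[of x] by simp
  finally have "card (col ` Nb) \<le> h * \<Delta>"
    using insert.hyps(1) card_image_le[of Nb col] by (force simp: Nb_def)
  then have "\<not> {..h * \<Delta>} \<subseteq> col ` Nb"
    using card_mono[of "col ` Nb" "{..h * \<Delta>}"] insert.hyps(1) by (auto simp: Nb_def)
  then obtain c where c: "c \<le> h * \<Delta>" "c \<notin> col ` Nb" by auto
  show ?case
    using col c insert.hyps(2)
    by (intro exI[of _ "col(x := c)"]) (auto simp: Nb_def Int_commute)
qed

section \<open>Descending tiles and the modular cover\<close>

context shape begin

definition rich :: "nat \<Rightarrow> nat set set" where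
  "rich n = {x. x \<subseteq> {..<n} \<and> k \<le> card (ups n x)}"

text \<open>The tile at \<open>x\<close> toggles the middles of the first \<open>k\<close> patterns
  only, so \<open>x\<close> is its strict top. Taking the first ones confines the toggled places to
  an initial part of the turns of any point of the tile; this bounds the number of tiles through a
  point independently of \<open>n\<close>.\<close>

lemma descending_tiles:
  obtains T where "\<And>x. x \<in> rich n \<Longrightarrow> tile (T x) \<and> x \<in> T x \<and> T x \<subseteq> Pow {..<n}"
    "\<And>x z. x \<in> rich n \<Longrightarrow> z \<in> T x \<Longrightarrow> z \<noteq> x \<Longrightarrow> potential n z < potential n x"
    "\<And>x. x \<in> rich n \<Longrightarrow> finite (T x) \<and> card (T x) \<le> card S"
    "\<And>z. card {x \<in> rich n. z \<in> T x} \<le> 2 ^ (4 * k + 1)"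
proof -
  have "\<forall>x. \<exists>K. x \<in> rich n \<longrightarrow> K \<subseteq> ups n x \<and> card K = k \<and> (\<forall>i\<in>ups n x - K. \<forall>j\<in>K. j < i)"
    using initial_subset[OF finite_ups] by (auto simp: rich_def)
  then obtain K where K: "\<And>x. x \<in> rich n \<Longrightarrow> K x \<subseteq> ups n x" "\<And>x. x \<in> rich n \<Longrightarrow> card (K x) = k"
    "\<And>x i j. x \<in> rich n \<Longrightarrow> i \<in> ups n x \<Longrightarrow> i \<notin> K x \<Longrightarrow> j \<in> K x \<Longrightarrow> j < i" by (metis DiffI)
  have finK: "finite (K x)" if "x \<in> rich n" for x using finite_subset[OF K(1)[OF that]] by simp
  have "\<exists>f. x \<in> rich n \<longrightarrow> bij_betw f {..<k} (K x)" for x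
  proof (cases "x \<in> rich n")
    case True
    then show ?thesis
      using finite_same_card_bij[of "{..<k}" "K x"] K(2)[OF True] finK[OF True] by simp
  qed simp
  then obtain f where f: "\<And>x. x \<in> rich n \<Longrightarrow> bij_betw (f x) {..<k} (K x)" by metis
  define T where "T x = (\<lambda>s. x \<triangle> (Suc \<circ> f x) ` s) ` S" for x
  have T: "\<exists>A. A \<subseteq> K x \<and> z = x \<triangle> Suc ` A" if xz: "x \<in> rich n" "z \<in> T x" for x z
  proof -
    obtain s where s: "s \<in> S" "z = x \<triangle> Suc ` (f x ` s)" using xz(2) by (auto simp: T_def image_comp)
    have "f x ` s \<subseteq> K x" using f[OF xz(1)] s(1) S_sub by (auto simp: bij_betw_def)
    then show ?thesis using s(2) by blast
  qed
  show thesis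
  proof (rule that[of T])
    fix x assume x: "x \<in> rich n"
    have "inj_on (Suc \<circ> f x) {..<k}" using f[OF x] by (auto simp: bij_betw_def inj_on_def)
    then have "tile (T x)" unfolding T_def by (rule tileI)
    moreover have "x \<in> T x" unfolding T_def by (rule image_eqI[OF _ empty_S]) simp
    moreover have "T x \<subseteq> Pow {..<n}"
    proof
      fix z assume "z \<in> T x"
      then obtain A where "A \<subseteq> K x" "z = x \<triangle> Suc ` A" using T[OF x] by blast
      moreover have "K x \<subseteq> {i. Suc i < n}" using K(1)[OF x] by (auto simp: ups_def)
      moreover have "x \<subseteq> {..<n}" using x by (simp add: rich_def)
      ultimately show "z \<in> Pow {..<n}" by (auto simp: subset_iff)
    qed
    ultimately show "tile (T x) \<and> x \<in> T x \<and> T x \<subseteq> Pow {..<n}" by blast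
    show "finite (T x) \<and> card (T x) \<le> card S" unfolding T_def using finite_S card_image_le by auto
  next
    fix x z assume xz: "x \<in> rich n" "z \<in> T x" "z \<noteq> x"
    then obtain A where A: "A \<subseteq> K x" "z = x \<triangle> Suc ` A" using T by blast
    then have "A \<noteq> {}" "finite A" using xz(3) finK[OF xz(1)] finite_subset by auto
    then have "card A > 0" by (simp add: card_gt_0_iff)
    moreover have "potential n z + card A = potential n x"
      unfolding A(2) using A(1) K(1)[OF xz(1)] \<open>finite A\<close> by (intro potential_toggles) auto
    ultimately show "potential n z < potential n x" by linarith
  next
    fix z
    \<comment> \<open>Up to a toggled place there are at most \<open>2 * k + 1\<close> turns of
      \<open>x\<close>, and toggling creates at most \<open>2 * k\<close> more.\<close>
    define c where "c = 4 * k + 1"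
    define E where "E = {i \<in> turns n z. card (turns n z \<inter> {..i}) \<le> c}"
    have cE: "card E \<le> c" unfolding E_def by (rule card_initial_le) simp
    have finE: "finite E" by (simp add: E_def)
    have "{x \<in> rich n. z \<in> T x} \<subseteq> (\<lambda>A. z \<triangle> Suc ` A) ` Pow E"
    proof
      fix x assume "x \<in> {x \<in> rich n. z \<in> T x}"
      then have x: "x \<in> rich n" "z \<in> T x" by auto
      then obtain A where A: "A \<subseteq> K x" "z = x \<triangle> Suc ` A" using T by blast
      have Au: "A \<subseteq> ups n x" using A(1) K(1)[OF x(1)] by auto
      have finA: "finite A" using A(1) finK[OF x(1)] finite_subset by auto
      have cA: "card A \<le> k" using A(1) K(2)[OF x(1)] card_mono[OF finK[OF x(1)]] by metis
      have "i \<in> E" if i: "i \<in> A" for i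
      proof -
        have "ups n x \<inter> {..<Suc i} \<subseteq> K x" using K(3)[OF x(1), of _ i] A(1) i by force
        then have "card (ups n x \<inter> {..<Suc i}) \<le> k" using K(2)[OF x(1)] card_mono[OF finK[OF x(1)]] by metis
        then have 1: "card (turns n x \<inter> {..<Suc i}) \<le> 2 * k + 1" using card_turns_le[of n x "Suc i"] by simp
        have "turns n z \<inter> {..i} \<subseteq> (turns n x \<inter> {..<Suc i}) \<union> (Suc ` A \<union> (\<lambda>a. a - 1) ` A)"
          using toggled_turns(2)[OF Au] unfolding A(2) by (auto simp: less_Suc_eq_le)
        then have "card (turns n z \<inter> {..i}) \<le> card ((turns n x \<inter> {..<Suc i}) \<union> (Suc ` A \<union> (\<lambda>a. a - 1) ` A))"
          using finA by (intro card_mono) auto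
        also have "\<dots> \<le> card (turns n x \<inter> {..<Suc i}) + (card (Suc ` A) + card ((\<lambda>a. a - 1) ` A))"
          by (meson add_left_mono card_Un_le le_trans)
        also have "\<dots> \<le> (2 * k + 1) + (k + k)"
          using 1 cA card_image_le[OF finA, of Suc] card_image_le[OF finA, of "\<lambda>a. a - 1"] by linarith
        finally have "card (turns n z \<inter> {..i}) \<le> c" by (simp add: c_def)
        then show ?thesis using toggled_turns(1)[OF Au] i A(2) by (auto simp: E_def)
      qed
      moreover have "x = z \<triangle> Suc ` A" unfolding A(2) by (auto simp: set_eq_iff)
      ultimately show "x \<in> (\<lambda>A. z \<triangle> Suc ` A) ` Pow E" by blast
    qed
    then have "card {x \<in> rich n. z \<in> T x} \<le> card (Pow E)"
      using finE by (meson card_image_le card_mono finite_Pow_iff finite_imageI le_trans)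
    also have "\<dots> \<le> 2 ^ c" using cE finE by (simp add: card_Pow)
    finally show "card {x \<in> rich n. z \<in> T x} \<le> 2 ^ (4 * k + 1)" by (simp add: c_def)
  qed
qed

text \<open>A pair \<open>(x, j)\<close> is the \<open>j\<close>-th repetition of the tile at
  \<open>x\<close>, with repetition numbers taken from the triangular system. Equally coloured tiles
  are disjoint, and colour \<open>0\<close> is reserved for the set \<open>Y 0\<close> of the
  absorber.\<close>

lemma modular_cover:
  defines "h \<equiv> card S"
  defines "m \<equiv> h * 2 ^ (4 * k + 1) + 2"
  obtains I :: "(nat set \<times> nat) set" and N col where "finite I"
    "\<And>e. e \<in> I \<Longrightarrow> tile (N e) \<and> N e \<subseteq> Pow {..<n} \<and> 0 < col e \<and> col e < h * m"
    "\<And>e e'. e \<in> I \<Longrightarrow> e' \<in> I \<Longrightarrow> e \<noteq> e' \<Longrightarrow> col e = col e' \<Longrightarrow> N e \<inter> N e' = {}"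
    "\<And>z. z \<in> rich n \<Longrightarrow> h dvd card {e \<in> I. z \<in> N e} + 1"
proof -
  let ?G = "rich n"
  have h: "h > 0" using empty_S finite_S by (auto simp: h_def card_gt_0_iff)
  have finG: "finite ?G" by (rule finite_subset[of _ "Pow {..<n}"]) (auto simp: rich_def)
  obtain T where T: "\<And>x. x \<in> ?G \<Longrightarrow> tile (T x) \<and> x \<in> T x \<and> T x \<subseteq> Pow {..<n}"
    "\<And>x z. x \<in> ?G \<Longrightarrow> z \<in> T x \<Longrightarrow> z \<noteq> x \<Longrightarrow> potential n z < potential n x"
    "\<And>x. x \<in> ?G \<Longrightarrow> finite (T x) \<and> card (T x) \<le> h"
    "\<And>z. card {x \<in> ?G. z \<in> T x} \<le> 2 ^ (4 * k + 1)"
    by (rule descending_tiles[of n, folded h_def]) (rule that)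
  have "\<exists>a :: nat set \<Rightarrow> nat. (\<forall>x. a x < h) \<and> (\<forall>z\<in>?G. h dvd (\<Sum>x | x \<in> ?G \<and> z \<in> T x. a x) + 1)"
    using T(1,2) by (intro triangular_residues[OF finG h, of T "potential n"]) auto
  then obtain a where a: "\<And>x. a x < h" "\<And>z. z \<in> ?G \<Longrightarrow> h dvd (\<Sum>x | x \<in> ?G \<and> z \<in> T x. a x) + 1"
    by auto
  have "\<exists>c :: nat set \<Rightarrow> nat. \<forall>x\<in>?G. c x \<le> h * 2 ^ (4 * k + 1) \<and>
      (\<forall>y\<in>?G. x \<noteq> y \<longrightarrow> T x \<inter> T y \<noteq> {} \<longrightarrow> c x \<noteq> c y)"
    by (rule greedy_colouring[OF finG T(3,4)])
  then obtain c :: "nat set \<Rightarrow> nat" where c0: "\<forall>x\<in>?G. c x \<le> h * 2 ^ (4 * k + 1) \<and>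
      (\<forall>y\<in>?G. x \<noteq> y \<longrightarrow> T x \<inter> T y \<noteq> {} \<longrightarrow> c x \<noteq> c y)" ..
  have c: "c x \<le> h * 2 ^ (4 * k + 1)" "y \<in> ?G \<Longrightarrow> x \<noteq> y \<Longrightarrow> T x \<inter> T y \<noteq> {} \<Longrightarrow> c x \<noteq> c y"
    if "x \<in> ?G" for x y
    using bspec[OF c0 that] by simp_all
  define I where "I = (SIGMA x:?G. {..<a x})"
  define N where "N = (\<lambda>e :: nat set \<times> nat. T (fst e))"
  \<comment> \<open>Greedy colour and repetition number are combined as quotient and remainder
    modulo \<open>h\<close>; the shift by one keeps colours positive.\<close>
  define col where "col e = c (fst e) * h + snd e + 1" for e
  show thesis
  proof (rule that[of I N col])
    show "finite I" unfolding I_def using finG by auto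
  next
    fix e assume e: "e \<in> I"
    then have x: "fst e \<in> ?G" "snd e < h" using a(1)[of "fst e"] by (auto simp: I_def)
    have "col e \<le> c (fst e) * h + h" using x(2) by (simp add: col_def)
    also have "\<dots> \<le> h * 2 ^ (4 * k + 1) * h + h" using c(1)[OF x(1)] by (intro add_mono mult_right_mono) auto
    \<comment> \<open>The greedy colours take up to \<open>h * 2 ^ (4 * k + 1) + 1\<close> values,
      and the further \<open>1\<close> in \<open>m\<close> makes room for the shift.\<close>
    also have "\<dots> < h * m" unfolding m_def using h by (simp add: distrib_left mult_ac)
    finally have "col e < h * m" .
    then show "tile (N e) \<and> N e \<subseteq> Pow {..<n} \<and> 0 < col e \<and> col e < h * m"
      using T(1)[OF x(1)] by (auto simp: N_def col_def)
  next
    fix e e' assume e: "e \<in> I" "e' \<in> I" "e \<noteq> e'" "col e = col e'"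
    then have x: "fst e \<in> ?G" "snd e < h" "fst e' \<in> ?G" "snd e' < h"
      using a(1)[of "fst e"] a(1)[of "fst e'"] by (auto simp: I_def)
    have eq: "c (fst e) * h + snd e = c (fst e') * h + snd e'" using e(4) by (simp add: col_def)
    have "snd e = snd e'" using arg_cong[OF eq, of "\<lambda>u. u mod h"] x by simp
    then have "c (fst e) = c (fst e')" "fst e \<noteq> fst e'" using eq e(3) h by (auto simp: prod_eq_iff)
    then show "N e \<inter> N e' = {}" using c(2)[of "fst e" "fst e'"] x unfolding N_def by blast
  next
    fix z assume z: "z \<in> ?G"
    have "{e \<in> I. z \<in> N e} = (SIGMA x:{x. x \<in> ?G \<and> z \<in> T x}. {..<a x})"
      by (auto simp: I_def N_def)
    then have "card {e \<in> I. z \<in> N e} = (\<Sum>x | x \<in> ?G \<and> z \<in> T x. a x)"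
      using finG by simp
    then show "h dvd card {e \<in> I. z \<in> N e} + 1" using a(2)[of z] z by simp
  qed
qed

end

section \<open>Assembling the packing\<close>

lemma xr_Int: "B \<inter> D = {} \<Longrightarrow> l \<subseteq> D \<Longrightarrow> (l \<triangle> B) \<inter> D = l"
  by auto

context shape begin

text \<open>Each leftover point is the base of a \<open>k\<close>-dimensional subcube disjoint from
  the others. Placing a tile there, with its image of \<open>{}\<close> at the base, covers the
  leftover by disjoint tiles.\<close>

lemma leftover_tiles:
  obtains q W T where "W \<subseteq> Pow {..<q}" "tileable (Pow {..<q} - W)"
    "\<And>w. w \<in> W \<Longrightarrow> tile (T w) \<and> T w \<subseteq> Pow {..<q} \<and> T w \<inter> W = {w}"
    "disjoint_family_on T W"
proof -
  obtain q W C where W: "W \<subseteq> Pow {..<q}" "tileable (Pow {..<q} - W)"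
    "\<And>l. l \<in> W \<Longrightarrow> C l \<subseteq> {..<q} \<and> card (C l) = k"
    "\<And>l l' u u'. l \<in> W \<Longrightarrow> l' \<in> W \<Longrightarrow> u \<subseteq> C l \<Longrightarrow> u' \<subseteq> C l' \<Longrightarrow> l \<triangle> u = l' \<triangle> u' \<Longrightarrow> l = l'"
    by (rule sparse_leftover[of k]) (rule that)
  have "\<exists>f. w \<in> W \<longrightarrow> bij_betw f {..<k} (C w)" for w
  proof (cases "w \<in> W")
    case True
    then have "finite (C w)" using W(3) finite_subset by blast
    then show ?thesis using finite_same_card_bij[of "{..<k}" "C w"] W(3)[OF True] by simp
  qed simp
  then obtain f where f: "\<And>w. w \<in> W \<Longrightarrow> bij_betw (f w) {..<k} (C w)" by metis
  define T where "T w = (\<lambda>s. w \<triangle> f w ` s) ` S" for w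
  have T: "\<exists>u. u \<subseteq> C w \<and> r = w \<triangle> u" if r: "w \<in> W" "r \<in> T w" for w r
  proof -
    obtain s where "s \<in> S" "r = w \<triangle> f w ` s" using r(2) by (auto simp: T_def)
    moreover from this have "f w ` s \<subseteq> C w" using f[OF r(1)] S_sub by (auto simp: bij_betw_def)
    ultimately show ?thesis by blast
  qed
  have in_T: "w \<in> T w" for w unfolding T_def by (rule image_eqI[OF _ empty_S]) simp
  show thesis
  proof (rule that[OF W(1,2), of T])
    fix w assume w: "w \<in> W"
    have "tile (T w)" unfolding T_def using f[OF w] by (intro tileI) (simp add: bij_betw_def)
    moreover have "T w \<subseteq> Pow {..<q}"
    proof
      fix r assume "r \<in> T w"
      then obtain u where "u \<subseteq> C w" "r = w \<triangle> u" using T[OF w] by blast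
      then show "r \<in> Pow {..<q}" using w W(1,3) xr_subset[of w "{..<q}" u] by blast
    qed
    moreover have "r = w" if r: "r \<in> T w" "r \<in> W" for r
    proof -
      obtain u where u: "u \<subseteq> C w" "r = w \<triangle> u" using T[OF w r(1)] by blast
      \<comment> \<open>The leftover point \<open>r\<close> is the base of its own subcube, so
        sparseness with offset \<open>{}\<close> on its side gives \<open>r = w\<close>.\<close>
      then show ?thesis using W(4)[OF r(2) w, of "{}" u] by simp
    qed
    ultimately show "tile (T w) \<and> T w \<subseteq> Pow {..<q} \<and> T w \<inter> W = {w}" using w in_T by blast
  next
    show "disjoint_family_on T W"
      unfolding disjoint_family_on_def
    proof (intro ballI impI equals0I)
      fix v w r assume vw: "v \<in> W" "w \<in> W" "v \<noteq> w" "r \<in> T v \<inter> T w"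
      obtain u where u: "u \<subseteq> C v" "r = v \<triangle> u" using T[OF vw(1), of r] vw(4) by blast
      obtain u' where u': "u' \<subseteq> C w" "r = w \<triangle> u'" using T[OF vw(2), of r] vw(4) by blast
      show False using W(4)[OF vw(1,2) u(1) u'(1)] u(2) u'(2) vw(3) by simp
    qed
  qed
qed

text \<open>A copy of the absorber is planted at every leftover point \<open>l\<close>: its first
  \<open>k\<close> coordinates become a new block from \<open>d\<close> on, the others go into the
  directions \<open>C l\<close>, which makes the copies disjoint. The copies of \<open>Y 0\<close>
  then fill exactly the leftover times the block.\<close>

lemma leftover_absorber:
  assumes "n = card S * m" "n > 0"
  obtains p Y Z where "Z \<subseteq> Pow {..<p}" "tileable (Pow {..<p} - Y 0)" "\<And>i. i < n \<Longrightarrow> Y i \<subseteq> Z"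
    "disjoint_family_on Y {..<n}"
    "\<And>J. J \<subseteq> {..<n} \<Longrightarrow> card S dvd card J \<Longrightarrow> tileable (Z - (\<Union>i\<in>J. Y i))"
proof -
  obtain c Y0 Z0 where A: "k \<le> c" "Y0 0 = Pow {..<k}" "Z0 \<subseteq> Pow {..<c}" "\<And>i. i < n \<Longrightarrow> Y0 i \<subseteq> Z0"
    "disjoint_family_on Y0 {..<n}"
    "\<And>J. J \<subseteq> {..<n} \<Longrightarrow> card S dvd card J \<Longrightarrow> tileable (Z0 - (\<Union>i\<in>J. Y0 i))"
    by (rule absorber[OF assms(1)]) (rule that)
  obtain d L C where L: "L \<subseteq> Pow {..<d}" "tileable (Pow {..<d} - L)"
    "\<And>l. l \<in> L \<Longrightarrow> C l \<subseteq> {..<d} \<and> card (C l) = c - k"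
    "\<And>l l' u u'. l \<in> L \<Longrightarrow> l' \<in> L \<Longrightarrow> u \<subseteq> C l \<Longrightarrow> u' \<subseteq> C l' \<Longrightarrow> l \<triangle> u = l' \<triangle> u' \<Longrightarrow> l = l'"
    by (rule sparse_leftover[of "c - k"]) (rule that)
  have "\<exists>g. l \<in> L \<longrightarrow> bij_betw g {k..<c} (C l)" for l
  proof (cases "l \<in> L")
    case True
    then have "finite (C l)" using L(3) finite_subset by blast
    then show ?thesis using finite_same_card_bij[of "{k..<c}" "C l"] L(3)[OF True] by simp
  qed simp
  then obtain g where g: "\<And>l. l \<in> L \<Longrightarrow> bij_betw (g l) {k..<c} (C l)" by metis
  \<comment> \<open>The last case extends the placement to an injection of all of
    \<open>nat\<close>, the form in which tilings are transferred.\<close>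
  define \<phi> where "\<phi> l i = (if i < k then d + i else if i < c then g l i else d + k + i)" for l i
  have gd: "g l i < d" if "l \<in> L" "k \<le> i" "i < c" for l i
    using g[OF that(1)] L(3)[OF that(1)] that(2,3) by (force simp: bij_betw_def)
  have inj: "inj (\<phi> l)" if l: "l \<in> L" for l
  proof (rule injI)
    fix i j assume e: "\<phi> l i = \<phi> l j"
    have "i = j" if "k \<le> i" "i < c" "k \<le> j" "j < c" "g l i = g l j"
      using g[OF l] that by (auto simp: bij_betw_def inj_on_def)
    then show "i = j" using e gd[OF l, of i] gd[OF l, of j] unfolding \<phi>_def by (auto split: if_splits)
  qed
  define \<iota> where "\<iota> l y = l \<triangle> \<phi> l ` y" for l y
  \<comment> \<open>Below \<open>d\<close> a point of the copy at \<open>l\<close> differs from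
    \<open>l\<close> only in directions from \<open>C l\<close>, so sparseness identifies
    \<open>l\<close>.\<close>
  have low: "\<exists>u \<subseteq> C l. \<iota> l y \<inter> {..<d} = l \<triangle> u" if l: "l \<in> L" "y \<subseteq> {..<c}" for l y
  proof (intro exI conjI)
    let ?u = "\<phi> l ` y \<inter> {..<d}"
    show "?u \<subseteq> C l" using l(2) g[OF l(1)] by (auto simp: \<phi>_def bij_betw_def split: if_splits)
    have "l \<subseteq> {..<d}" using L(1) l(1) by blast
    then show "\<iota> l y \<inter> {..<d} = l \<triangle> ?u" by (auto simp: \<iota>_def)
  qed
  have uniq: "l = l' \<and> y = y'"
    if l: "l \<in> L" "l' \<in> L" "y \<subseteq> {..<c}" "y' \<subseteq> {..<c}" "\<iota> l y = \<iota> l' y'" for l l' y y'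
  proof -
    obtain u where u: "u \<subseteq> C l" "\<iota> l y \<inter> {..<d} = l \<triangle> u" using low[OF l(1,3)] by blast
    obtain u' where u': "u' \<subseteq> C l'" "\<iota> l' y' \<inter> {..<d} = l' \<triangle> u'" using low[OF l(2,4)] by blast
    have ll: "l = l'" using L(4)[OF l(1,2) u(1) u'(1)] u(2) u'(2) l(5) by simp
    then have "\<phi> l ` y = \<phi> l ` y'" using l(5) by (simp add: \<iota>_def)
    then show ?thesis using ll inj_image_eq_iff[OF inj[OF l(1)]] by simp
  qed
  define E where "E A = (\<Union>l\<in>L. \<iota> l ` A)" for A
  have E_diff: "E (A - B) = E A - E B" if A: "A \<subseteq> Pow {..<c}" "B \<subseteq> Pow {..<c}" for A B
  proof (intro equalityI subsetI)
    fix x assume "x \<in> E (A - B)"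
    then obtain l y where x: "l \<in> L" "y \<in> A" "y \<notin> B" "x = \<iota> l y" by (auto simp: E_def)
    have "x \<notin> E B"
    proof
      assume "x \<in> E B"
      then obtain l' y' where x': "l' \<in> L" "y' \<in> B" "x = \<iota> l' y'" by (auto simp: E_def)
      have "y = y'" using uniq[OF x(1) x'(1), of y y'] x x' A by auto
      then show False using x x' by simp
    qed
    then show "x \<in> E A - E B" using x by (auto simp: E_def)
  qed (auto simp: E_def)
  have E_tileable: "tileable (E A)" if A: "tileable A" "A \<subseteq> Pow {..<c}" for A
    unfolding E_def
  proof (rule tileable_UN)
    show "tileable (\<iota> l ` A)" if "l \<in> L" for l
      using tileable_map[OF inj[OF that] A(1), of l] by (simp add: \<iota>_def)
    show "disjoint_family_on (\<lambda>l. \<iota> l ` A) L"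
      unfolding disjoint_family_on_def
    proof (intro ballI impI equals0I)
      fix l l' r assume l: "l \<in> L" "l' \<in> L" "l \<noteq> l'" "r \<in> \<iota> l ` A \<inter> \<iota> l' ` A"
      then obtain y y' where "y \<in> A" "y' \<in> A" "\<iota> l y = \<iota> l' y'" by auto
      then show False using uniq[OF l(1,2), of y y'] A(2) l(3) by auto
    qed
  qed
  have Ysub: "Y0 i \<subseteq> Pow {..<c}" if "i < n" for i using A(3,4) that by blast
  have E0: "x \<in> E (Y0 0) \<longleftrightarrow> x \<inter> {..<d} \<in> L" if x: "x \<subseteq> {..<d + k}" for x
  proof
    assume "x \<in> E (Y0 0)"
    then obtain l y where l: "l \<in> L" "y \<subseteq> {..<k}" "x = \<iota> l y" by (auto simp: E_def A(2))
    have "\<phi> l ` y \<inter> {..<d} = {}" using l(2) by (auto simp: \<phi>_def)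
    moreover have "l \<subseteq> {..<d}" using l(1) L(1) by blast
    ultimately have "x \<inter> {..<d} = l" unfolding l(3) \<iota>_def by (intro xr_Int)
    then show "x \<inter> {..<d} \<in> L" using l(1) by simp
  next
    assume l: "x \<inter> {..<d} \<in> L"
    let ?l = "x \<inter> {..<d}" and ?y = "{i. i < k \<and> d + i \<in> x}"
    have "\<phi> ?l ` ?y = x \<inter> {d..}"
    proof (intro equalityI subsetI)
      fix i assume i: "i \<in> x \<inter> {d..}"
      then have "i - d \<in> ?y" "i = \<phi> ?l (i - d)" using x by (auto simp: \<phi>_def)
      then show "i \<in> \<phi> ?l ` ?y" by blast
    qed (auto simp: \<phi>_def)
    then have "x = \<iota> ?l ?y" unfolding \<iota>_def by auto
    then show "x \<in> E (Y0 0)" unfolding E_def A(2) using l by blast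
  qed
  show thesis
  proof (rule that[of "E Z0" "d + k" "\<lambda>i. E (Y0 i)"])
    show "E Z0 \<subseteq> Pow {..<d + k}"
    proof
      fix x assume "x \<in> E Z0"
      then obtain l y where l: "l \<in> L" "y \<in> Z0" "x = \<iota> l y" by (auto simp: E_def)
      have "\<phi> l i < d + k" if "i \<in> y" for i
      proof -
        have "i < c" using that l(2) A(3) by auto
        then show ?thesis using gd[OF l(1), of i] by (auto simp: \<phi>_def)
      qed
      moreover have "l \<subseteq> {..<d + k}" using l(1) L(1) by (auto dest!: subsetD)
      ultimately show "x \<in> Pow {..<d + k}" unfolding l(3) \<iota>_def Pow_iff by (intro xr_subset) auto
    qed
    \<comment> \<open>The complement is the tiled part of \<open>Pow {..<d}\<close>, repeated over
      every point of the new block.\<close>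
    have "Pow {..<d + k} - E (Y0 0) = (\<Union>\<mu>\<in>Pow {d..<d + k}. {\<mu>} \<odot> (Pow {..<d} - L))"
    proof (intro equalityI subsetI)
      fix x assume x: "x \<in> Pow {..<d + k} - E (Y0 0)"
      define \<mu> l where "\<mu> = x \<inter> {d..<d + k}" and "l = x \<inter> {..<d}"
      have "l \<in> Pow {..<d} - L" using E0[of x] x by (auto simp: l_def)
      moreover have "x = \<mu> \<triangle> l" using x by (auto simp: \<mu>_def l_def)
      ultimately have "x \<in> {\<mu>} \<odot> (Pow {..<d} - L)" using mulI[of \<mu> "{\<mu>}" l] by simp
      moreover have "\<mu> \<in> Pow {d..<d + k}" by (simp add: \<mu>_def)
      ultimately show "x \<in> (\<Union>\<mu>\<in>Pow {d..<d + k}. {\<mu>} \<odot> (Pow {..<d} - L))" by blast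
    next
      fix x assume "x \<in> (\<Union>\<mu>\<in>Pow {d..<d + k}. {\<mu>} \<odot> (Pow {..<d} - L))"
      then obtain \<mu> l where m: "\<mu> \<subseteq> {d..<d + k}" "l \<subseteq> {..<d}" "l \<notin> L" "x = \<mu> \<triangle> l"
        by (auto elim!: mulE)
      have "{d..<d + k} \<inter> {..<d} = {}" by auto
      then have m': "\<mu> \<inter> {..<d} = {}" using m(1) by blast
      have m'': "\<mu> \<subseteq> {..<d + k}" "l \<subseteq> {..<d + k}"
        by (rule order_trans[OF m(1)] order_trans[OF m(2)]; auto)+
      have "x \<inter> {..<d} = l" unfolding m(4) xr_commute[of \<mu>] using m' m(2) by (rule xr_Int)
      moreover have "x \<subseteq> {..<d + k}" unfolding m(4) using m'' by (rule xr_subset)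
      ultimately show "x \<in> Pow {..<d + k} - E (Y0 0)" using E0[of x] m(3) by simp
    qed
    moreover have "tileable \<dots>" using L(2) by (intro tileable_fibres[of _ _ "{d..}"]) auto
    ultimately show "tileable (Pow {..<d + k} - E (Y0 0))" by simp
    show "E (Y0 i) \<subseteq> E Z0" if "i < n" for i using A(4)[OF that] by (auto simp: E_def)
    show "disjoint_family_on (\<lambda>i. E (Y0 i)) {..<n}"
      unfolding disjoint_family_on_def
    proof (intro ballI impI equals0I)
      fix i j r assume i: "i \<in> {..<n}" "j \<in> {..<n}" "i \<noteq> j" "r \<in> E (Y0 i) \<inter> E (Y0 j)"
      then obtain l y l' y' where l: "l \<in> L" "y \<in> Y0 i" "l' \<in> L" "y' \<in> Y0 j" "\<iota> l y = \<iota> l' y'"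
        by (auto simp: E_def)
      then have "y = y'" using uniq[OF l(1,3), of y y'] Ysub i(1,2) by auto
      then show False using A(5) i l(2,4) by (auto simp: disjoint_family_on_def)
    qed
    fix J assume J: "J \<subseteq> {..<n}" "card S dvd card J"
    have "(\<Union>i\<in>J. Y0 i) \<subseteq> Pow {..<c}" using Ysub J(1) by blast
    then have "E Z0 - E (\<Union>i\<in>J. Y0 i) = E (Z0 - (\<Union>i\<in>J. Y0 i))" using E_diff A(3) by simp
    moreover have "tileable (E (Z0 - (\<Union>i\<in>J. Y0 i)))" using A(3) by (intro E_tileable A(6) J) auto
    moreover have "E (\<Union>i\<in>J. Y0 i) = (\<Union>i\<in>J. E (Y0 i))" by (auto simp: E_def)
    ultimately show "tileable (E Z0 - (\<Union>i\<in>J. E (Y0 i)))" by simp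
  qed
qed

text \<open>Coordinates for a product of three cubes on consecutive blocks. With symmetric
  difference in place of union, the map in each single argument is a renaming followed by a
  translation, so tilings carry over.\<close>

definition point :: "nat \<Rightarrow> nat \<Rightarrow> nat set \<Rightarrow> nat set \<Rightarrow> nat set \<Rightarrow> nat set" where
  "point q p u z y = u \<triangle> ((\<lambda>i. q + i) ` z \<triangle> (\<lambda>i. q + p + i) ` y)"

lemma point_inj:
  assumes "point q p u z y = point q p u' z' y'" "u \<subseteq> {..<q}" "u' \<subseteq> {..<q}" "z \<subseteq> {..<p}" "z' \<subseteq> {..<p}"
  shows "u = u' \<and> z = z' \<and> y = y'"
proof -
  have nu: "q + i \<notin> u" "q + p + i \<notin> u" if "u \<subseteq> {..<q}" for u i using that by auto
  have 1: "u = point q p u z y \<inter> {..<q}" if "u \<subseteq> {..<q}" for u z y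
    using that nu[OF that] by (auto simp: point_def)
  have 2: "z = {i. i < p \<and> q + i \<in> point q p u z y}" if "u \<subseteq> {..<q}" "z \<subseteq> {..<p}" for u z y
    using that(2) nu[OF that(1)] by (auto simp: point_def image_iff)
  have 3: "y = {i. q + p + i \<in> point q p u z y}" if "u \<subseteq> {..<q}" "z \<subseteq> {..<p}" for u z y
    using that(2) nu[OF that(1)] by (auto simp: point_def image_iff subset_iff)
  show ?thesis using 1[OF assms(2), of z y] 1[OF assms(3), of z' y'] 2[OF assms(2,4), of y] 2[OF assms(3,5), of y']
    3[OF assms(2,4), of y] 3[OF assms(3,5), of y'] assms(1) by metis
qed

lemma tileable_point:
  assumes "tileable A"
  shows "tileable ((\<lambda>u. point q p u z y) ` A)" "tileable ((\<lambda>z. point q p u z y) ` A)" "tileable ((\<lambda>y. point q p u z y) ` A)"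
proof -
  have *: "tileable (F ` A)" if "\<And>x. F x = g \<triangle> (\<lambda>i. c + i) ` x" for F g and c :: nat
  proof -
    have "F ` A = (\<lambda>x. g \<triangle> (\<lambda>i. c + i) ` x) ` A" by (rule image_cong) (simp_all add: that)
    then show ?thesis using tileable_map[OF _ assms, of "\<lambda>i. c + i" g] by simp
  qed
  show "tileable ((\<lambda>u. point q p u z y) ` A)"
    by (rule *[of _ "(\<lambda>i. q + i) ` z \<triangle> (\<lambda>i. q + p + i) ` y" 0]) (simp add: point_def xr_ac)
  show "tileable ((\<lambda>z. point q p u z y) ` A)"
    by (rule *[of _ "u \<triangle> (\<lambda>i. q + p + i) ` y" q]) (simp add: point_def xr_ac)
  show "tileable ((\<lambda>y. point q p u z y) ` A)"
    by (rule *[of _ "u \<triangle> (\<lambda>i. q + i) ` z" "q + p"]) (simp add: point_def xr_ac)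
qed

text \<open>Each family prescribes the part to be tiled on the fibres in its direction. By the last
  three hypotheses no point is claimed by two directions, so the tilings of all fibres fit
  together.\<close>

lemma tileable_three_directions:
  fixes F1 F2 F3 :: "nat set \<Rightarrow> nat set \<Rightarrow> nat set set"
  assumes "\<And>u y. tileable (F1 u y)" "\<And>z y. tileable (F2 z y)" "\<And>u z. tileable (F3 u z)"
    and "\<And>u y. F1 u y \<subseteq> Pow {..<p}" "\<And>z y. F2 z y \<subseteq> Pow {..<q}" "\<And>u z. F3 u z \<subseteq> Pow {..<n}"
    and "\<And>u z y. \<not> (z \<in> F1 u y \<and> u \<in> F2 z y)" "\<And>u z y. \<not> (z \<in> F1 u y \<and> y \<in> F3 u z)"
      "\<And>u z y. \<not> (u \<in> F2 z y \<and> y \<in> F3 u z)"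
  shows "tileable {point q p u z y |u z y. u \<subseteq> {..<q} \<and> z \<subseteq> {..<p} \<and> y \<subseteq> {..<n} \<and>
     (z \<in> F1 u y \<or> u \<in> F2 z y \<or> y \<in> F3 u z)}"
proof -
  let ?U = "Pow {..<q}" and ?Z = "Pow {..<p}" and ?Y = "Pow {..<n}"
  let ?pt = "point q p"
  let ?R1 = "\<Union>(u, y)\<in>?U \<times> ?Y. (\<lambda>z. ?pt u z y) ` F1 u y"
  let ?R2 = "\<Union>(z, y)\<in>?Z \<times> ?Y. (\<lambda>u. ?pt u z y) ` F2 z y"
  let ?R3 = "\<Union>(u, z)\<in>?U \<times> ?Z. (\<lambda>y. ?pt u z y) ` F3 u z"
  have pt: "u = u' \<and> z = z' \<and> y = y'"
    if "?pt u z y = ?pt u' z' y'" "u \<in> ?U" "u' \<in> ?U" "z \<in> ?Z" "z' \<in> ?Z" for u z y u' z' y'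
    using point_inj[OF that(1)] that by auto
  have "tileable ?R1"
  proof (rule tileable_UN)
    show "disjoint_family_on (\<lambda>(u, y). (\<lambda>z. ?pt u z y) ` F1 u y) (?U \<times> ?Y)"
      unfolding disjoint_family_on_def
    proof (intro ballI impI equals0I)
      fix a b r assume *: "a \<in> ?U \<times> ?Y" "b \<in> ?U \<times> ?Y" "a \<noteq> b"
        "r \<in> (case a of (u, y) \<Rightarrow> (\<lambda>z. ?pt u z y) ` F1 u y) \<inter> (case b of (u, y) \<Rightarrow> (\<lambda>z. ?pt u z y) ` F1 u y)"
      obtain u y u' y' where exch: "a = (u, y)" "b = (u', y')" by (cases a, cases b)
      then obtain z z' where "z \<in> F1 u y" "z' \<in> F1 u' y'" "?pt u z y = ?pt u' z' y'" using *(4) by auto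
      moreover from this have "z \<in> ?Z" "z' \<in> ?Z" using assms(4) by blast+
      ultimately show False using pt[of u z y u' z' y'] * exch by auto
    qed
  qed (auto intro: tileable_point assms)
  moreover have "tileable ?R2"
  proof (rule tileable_UN)
    show "disjoint_family_on (\<lambda>(z, y). (\<lambda>u. ?pt u z y) ` F2 z y) (?Z \<times> ?Y)"
      unfolding disjoint_family_on_def
    proof (intro ballI impI equals0I)
      fix a b r assume *: "a \<in> ?Z \<times> ?Y" "b \<in> ?Z \<times> ?Y" "a \<noteq> b"
        "r \<in> (case a of (z, y) \<Rightarrow> (\<lambda>u. ?pt u z y) ` F2 z y) \<inter> (case b of (z, y) \<Rightarrow> (\<lambda>u. ?pt u z y) ` F2 z y)"
      obtain z y z' y' where exch: "a = (z, y)" "b = (z', y')" by (cases a, cases b)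
      then obtain u u' where "u \<in> F2 z y" "u' \<in> F2 z' y'" "?pt u z y = ?pt u' z' y'" using *(4) by auto
      moreover from this have "u \<in> ?U" "u' \<in> ?U" using assms(5) by blast+
      ultimately show False using pt[of u z y u' z' y'] * exch by auto
    qed
  qed (auto intro: tileable_point assms)
  moreover have "tileable ?R3"
  proof (rule tileable_UN)
    show "disjoint_family_on (\<lambda>(u, z). (\<lambda>y. ?pt u z y) ` F3 u z) (?U \<times> ?Z)"
      unfolding disjoint_family_on_def
    proof (intro ballI impI equals0I)
      fix a b r assume *: "a \<in> ?U \<times> ?Z" "b \<in> ?U \<times> ?Z" "a \<noteq> b"
        "r \<in> (case a of (u, z) \<Rightarrow> (\<lambda>y. ?pt u z y) ` F3 u z) \<inter> (case b of (u, z) \<Rightarrow> (\<lambda>y. ?pt u z y) ` F3 u z)"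
      obtain u z u' z' where exch: "a = (u, z)" "b = (u', z')" by (cases a, cases b)
      then obtain y y' where "?pt u z y = ?pt u' z' y'" using *(4) by auto
      then show False using pt[of u z y u' z' y'] * exch by auto
    qed
  qed (auto intro: tileable_point assms)
  moreover have "?R1 \<inter> ?R2 = {}"
  proof (rule equals0I)
    fix r assume "r \<in> ?R1 \<inter> ?R2"
    then obtain u z y u' z' y' where *: "u \<in> ?U" "z \<in> F1 u y" "r = ?pt u z y"
      "z' \<in> ?Z" "u' \<in> F2 z' y'" "r = ?pt u' z' y'" by auto
    then have "z \<in> ?Z" "u' \<in> ?U" using assms(4,5) by blast+
    then show False using pt[of u z y u' z' y'] * assms(7)[of z u y] by auto
  qed
  moreover have "(?R1 \<union> ?R2) \<inter> ?R3 = {}"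
  proof (rule equals0I)
    fix r assume r: "r \<in> (?R1 \<union> ?R2) \<inter> ?R3"
    then obtain u' z' y' where 3: "u' \<in> ?U" "z' \<in> ?Z" "y' \<in> F3 u' z'" "r = ?pt u' z' y'" by auto
    from r have "r \<in> ?R1 \<or> r \<in> ?R2" by blast
    then show False
    proof
      assume "r \<in> ?R1"
      then obtain u z y where *: "u \<in> ?U" "z \<in> F1 u y" "r = ?pt u z y" by auto
      then have "z \<in> ?Z" using assms(4) by blast
      then show False using pt[of u z y u' z' y'] * 3 assms(8)[of z u y] by auto
    next
      assume "r \<in> ?R2"
      then obtain u z y where *: "z \<in> ?Z" "u \<in> F2 z y" "r = ?pt u z y" by auto
      then have "u \<in> ?U" using assms(5) by blast
      then show False using pt[of u z y u' z' y'] * 3 assms(9)[of u z y] by auto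
    qed
  qed
  ultimately have "tileable (?R1 \<union> ?R2 \<union> ?R3)" by (intro tileable_Un)
  moreover have "?R1 \<union> ?R2 \<union> ?R3 = {?pt u z y |u z y. u \<subseteq> {..<q} \<and> z \<subseteq> {..<p} \<and> y \<subseteq> {..<n} \<and>
     (z \<in> F1 u y \<or> u \<in> F2 z y \<or> y \<in> F3 u z)}" (is "_ = ?Q")
  proof (intro equalityI subsetI)
    fix r assume "r \<in> ?R1 \<union> ?R2 \<union> ?R3"
    then consider "r \<in> ?R1" | "r \<in> ?R2" | "r \<in> ?R3" by blast
    then show "r \<in> ?Q"
    proof cases
      case 1
      then obtain u z y where *: "u \<in> ?U" "y \<in> ?Y" "z \<in> F1 u y" "r = ?pt u z y" by auto
      moreover from this have "z \<in> ?Z" using assms(4) by blast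
      ultimately show ?thesis by blast
    next
      case 2
      then obtain u z y where *: "z \<in> ?Z" "y \<in> ?Y" "u \<in> F2 z y" "r = ?pt u z y" by auto
      moreover from this have "u \<in> ?U" using assms(5) by blast
      ultimately show ?thesis by blast
    next
      case 3
      then obtain u z y where *: "u \<in> ?U" "z \<in> ?Z" "y \<in> F3 u z" "r = ?pt u z y" by auto
      moreover from this have "y \<in> ?Y" using assms(6) by blast
      ultimately show ?thesis by blast
    qed
  next
    fix r assume "r \<in> ?Q"
    then obtain u z y where r: "r = ?pt u z y" "u \<in> ?U" "z \<in> ?Z" "y \<in> ?Y"
      "z \<in> F1 u y \<or> u \<in> F2 z y \<or> y \<in> F3 u z" by auto
    from r(5) show "r \<in> ?R1 \<union> ?R2 \<union> ?R3"
    proof (elim disjE)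
      assume "z \<in> F1 u y" then have "r \<in> ?R1" using r by blast
      then show ?thesis by blast
    next
      assume "u \<in> F2 z y" then have "r \<in> ?R2" using r by blast
      then show ?thesis by blast
    next
      assume "y \<in> F3 u z" then have "r \<in> ?R3" using r by blast
      then show ?thesis by blast
    qed
  qed
  ultimately show ?thesis by simp
qed

end

context shape begin

lemma point_surj:
  assumes "x \<subseteq> {..<q + p + n}"
  obtains u z y where "x = point q p u z y" "u \<subseteq> {..<q}" "z \<subseteq> {..<p}" "y \<subseteq> {..<n}"
proof -
  define u z y where "u = x \<inter> {..<q}" and "z = {i. i < p \<and> q + i \<in> x}" and "y = {i. q + p + i \<in> x}"
  have "i \<in> x \<longleftrightarrow> i \<in> point q p u z y" for i
  proof -
    consider "i < q" | j where "i = q + j" "j < p" | j where "i = q + p + j"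
      by (metis add.assoc le_add_diff_inverse nat_add_left_cancel_less not_less)
    then show ?thesis
      by cases (auto simp: point_def u_def z_def y_def image_iff)
  qed
  then have "x = point q p u z y" by blast
  moreover have "u \<subseteq> {..<q}" "z \<subseteq> {..<p}" "y \<subseteq> {..<n}" using assms by (auto simp: u_def z_def y_def)
  ultimately show thesis by (rule that)
qed

lemma point_subset:
  assumes "u \<subseteq> {..<q}" "z \<subseteq> {..<p}" "y \<subseteq> {..<n}"
  shows "point q p u z y \<subseteq> {..<q + p + n}"
  unfolding point_def using assms by (intro xr_subset) (auto simp: subset_iff)

text \<open>
  Over \<open>w \<in> W\<close> the fibre \<open>Pow {..<p}\<close> is tiled up to \<open>Y 0\<close>, which is covered by the tiles \<open>T w\<close>.
  The holes these leave over \<open>u \<in> \<Union>(T ` W) - W\<close> are completed, by the tiles of the modular cover, to a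
  multiple of \<open>card S\<close> many sets \<open>Y i\<close>, which the absorber \<open>Z\<close> can do without.
\<close>

lemma nearly_tile_cube:
  "\<exists>c0. \<forall>n. \<exists>A \<subseteq> Pow {..<n}. tileable A \<and> card (Pow {..<n} - A) \<le> c0 * (n + 1) ^ (2 * k)"
proof -
  define m where "m = card S * 2 ^ (4 * k + 1) + 2"
  define M where "M = card S * m"
  have h: "card S > 0" using empty_S finite_S by (auto simp: card_gt_0_iff)
  have M: "M > 0" using h by (simp add: M_def m_def)
  obtain q W T where W: "W \<subseteq> Pow {..<q}" "tileable (Pow {..<q} - W)"
    "\<And>w. w \<in> W \<Longrightarrow> tile (T w) \<and> T w \<subseteq> Pow {..<q} \<and> T w \<inter> W = {w}"
    "disjoint_family_on T W"
    by (rule leftover_tiles) (rule that)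
  obtain p Y Z where Z: "Z \<subseteq> Pow {..<p}" "tileable (Pow {..<p} - Y 0)" "\<And>i. i < M \<Longrightarrow> Y i \<subseteq> Z"
    "disjoint_family_on Y {..<M}"
    "\<And>J. J \<subseteq> {..<M} \<Longrightarrow> card S dvd card J \<Longrightarrow> tileable (Z - (\<Union>i\<in>J. Y i))"
    by (rule leftover_absorber[OF M_def M]) (rule that)
  have Yeq: "i = j" if "z \<in> Y i" "z \<in> Y j" "i < M" "j < M" for z i j
    using Z(4) that by (auto simp: disjoint_family_on_def)
  define V where "V = (\<Union>w\<in>W. T w)"
  have WV: "W \<subseteq> V" using W(3) unfolding V_def by blast
  have tV: "tileable V" unfolding V_def using W(3,4) by (intro tileable_UN) (auto intro: tileable_tile)
  have VU: "V \<subseteq> Pow {..<q}" using W(3) unfolding V_def by blast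
  have main: "\<exists>A \<subseteq> Pow {..<q + p + n}. tileable A \<and>
      card (Pow {..<q + p + n} - A) \<le> 2 ^ q * 2 ^ p * (4 * (n + 1) ^ (2 * k))" for n
  proof -
    obtain I :: "(nat set \<times> nat) set" and N col where I: "finite I"
      "\<And>e. e \<in> I \<Longrightarrow> tile (N e) \<and> N e \<subseteq> Pow {..<n} \<and> 0 < col e \<and> col e < M"
      "\<And>e e'. e \<in> I \<Longrightarrow> e' \<in> I \<Longrightarrow> e \<noteq> e' \<Longrightarrow> col e = col e' \<Longrightarrow> N e \<inter> N e' = {}"
      "\<And>z. z \<in> rich n \<Longrightarrow> card S dvd card {e \<in> I. z \<in> N e} + 1"
      by (rule modular_cover[of n, folded m_def, folded M_def]) (rule that)
    \<comment> \<open>Index \<open>0\<close> stands for the set \<open>Y 0\<close> covered from the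
      first direction, the others are the colours of the cover tiles through \<open>y\<close>. For
      rich \<open>y\<close> their total number is a multiple of \<open>card S\<close>.\<close>
    define J where "J y = insert 0 (col ` {e \<in> I. y \<in> N e})" for y
    have J: "J y \<subseteq> {..<M}" for y using I(2) M by (auto simp: J_def)
    have cJ: "card S dvd card (J y)" if "y \<in> rich n" for y
    proof -
      have "inj_on col {e \<in> I. y \<in> N e}"
      proof (rule inj_onI, rule ccontr)
        fix e e' assume "e \<in> {e \<in> I. y \<in> N e}" "e' \<in> {e \<in> I. y \<in> N e}" "col e = col e'" "e \<noteq> e'"
        then show False using I(3)[of e e'] by blast
      qed
      moreover have "0 \<notin> col ` {e \<in> I. y \<in> N e}" using I(2) by fastforce
      ultimately have "card (J y) = card {e \<in> I. y \<in> N e} + 1"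
        unfolding J_def using I(1) by (simp add: card_image)
      then show ?thesis using I(4)[OF that] by simp
    qed
    \<comment> \<open>Over rich \<open>y\<close>, the second direction takes everything but
      \<open>Y 0\<close> when \<open>u \<in> W\<close>, the absorber without its holes when
      \<open>u \<in> V - W\<close>, and the full absorber otherwise. The first direction then
      supplies \<open>Y 0\<close> over \<open>V\<close> and all of the fibre outside
      \<open>Z\<close> up to \<open>W\<close>.\<close>
    define F1 where "F1 u y = (if y \<notin> rich n then {} else if u \<in> W then Pow {..<p} - Y 0
      else if u \<in> V then Z - (\<Union>i\<in>J y. Y i) else Z)" for u y
    define F2 where "F2 z y = (if y \<notin> rich n then {} else if z \<in> Y 0 then V
      else if z \<in> Z then {} else Pow {..<q} - W)" for z y
    \<comment> \<open>A cover tile of colour \<open>i\<close> is used over every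
      \<open>z \<in> Y i\<close>; at each \<open>y\<close> it contains, this fills the hole
      \<open>Y i\<close> of the absorber.\<close>
    define F3 where "F3 u z = (if u \<in> V - W then \<Union>e\<in>{e \<in> I. z \<in> Y (col e)}. N e else {})" for u z
    have Y0: "Y 0 \<subseteq> Z" using Z(3) M by blast
    have t1: "tileable (F1 u y)" for u y
      using Z(2) Z(5)[OF J cJ, of y] Z(5)[of "{}"] by (simp add: F1_def)
    have t2: "tileable (F2 z y)" for z y
      using tV W(2) by (simp add: F2_def)
    have t3: "tileable (F3 u z)" for u z
    proof -
      have "disjoint_family_on N {e \<in> I. z \<in> Y (col e)}"
        unfolding disjoint_family_on_def using I(2,3) Yeq by (metis (mono_tags, lifting) mem_Collect_eq)
      then have "tileable (\<Union>e\<in>{e \<in> I. z \<in> Y (col e)}. N e)" using I(2) by (intro tileable_UN) (auto intro: tileable_tile)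
      then show ?thesis by (simp add: F3_def)
    qed
    have inJ: "z \<in> (\<Union>i\<in>J y. Y i)" if "y \<in> F3 u z" for u y z
      using that by (auto simp: F3_def J_def split: if_splits)
    have F3Z: "z \<in> Z \<and> z \<notin> Y 0" if "y \<in> F3 u z" for u y z
    proof -
      obtain e where e: "e \<in> I" "z \<in> Y (col e)" using \<open>y \<in> F3 u z\<close> by (auto simp: F3_def split: if_splits)
      then show ?thesis using I(2)[OF e(1)] Z(3)[of "col e"] Yeq[of z "col e" 0] M by auto
    qed
    define A where "A = {point q p u z y |u z y. u \<subseteq> {..<q} \<and> z \<subseteq> {..<p} \<and> y \<subseteq> {..<n} \<and>
       (z \<in> F1 u y \<or> u \<in> F2 z y \<or> y \<in> F3 u z)}"
    have "tileable A"
      unfolding A_def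
    proof (rule tileable_three_directions[OF t1 t2 t3])
      show "F1 u y \<subseteq> Pow {..<p}" for u y using Z(1) by (auto simp: F1_def)
      show "F2 z y \<subseteq> Pow {..<q}" for z y using VU by (auto simp: F2_def)
      show "F3 u z \<subseteq> Pow {..<n}" for u z using I(2) unfolding F3_def by (simp add: UN_subset_iff)
      show "\<not> (z \<in> F1 u y \<and> u \<in> F2 z y)" for u z y
        using WV Y0 by (auto simp: F1_def F2_def J_def split: if_splits)
      show "\<not> (z \<in> F1 u y \<and> y \<in> F3 u z)" for u z y
      proof
        assume "z \<in> F1 u y \<and> y \<in> F3 u z"
        then have 13: "z \<in> F1 u y" "y \<in> F3 u z" by auto
        then have "u \<in> V" "u \<notin> W" by (simp_all add: F3_def split: if_splits)
        then have "z \<notin> (\<Union>i\<in>J y. Y i)" using 13(1) by (simp add: F1_def split: if_splits)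
        then show False using inJ[OF 13(2)] by blast
      qed
      show "\<not> (u \<in> F2 z y \<and> y \<in> F3 u z)" for u z y
        using F3Z[of y u z] by (auto simp: F2_def split: if_splits)
    qed
    moreover have "A \<subseteq> Pow {..<q + p + n}" unfolding A_def using point_subset by blast
    moreover have "card (Pow {..<q + p + n} - A) \<le> 2 ^ q * 2 ^ p * (4 * (n + 1) ^ (2 * k))"
    proof -
      let ?B = "{y. y \<subseteq> {..<n} \<and> card (ups n y) < k}"
      let ?X = "Pow {..<q} \<times> (Pow {..<p} \<times> ?B)"
      have finB: "finite ?B" by (rule finite_subset[of _ "Pow {..<n}"]) auto
      have "Pow {..<q + p + n} - A \<subseteq> (\<lambda>(u, z, y). point q p u z y) ` ?X"
      proof
        fix x assume x: "x \<in> Pow {..<q + p + n} - A"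
        then obtain u z y where pt: "x = point q p u z y" "u \<subseteq> {..<q}" "z \<subseteq> {..<p}" "y \<subseteq> {..<n}"
          by (auto elim: point_surj)
        \<comment> \<open>Over rich \<open>y\<close> some direction claims every point, so uncovered
          points occur only over strings with few patterns.\<close>
        have "y \<notin> rich n"
        proof
          assume y: "y \<in> rich n"
          have "z \<in> F1 u y \<or> u \<in> F2 z y \<or> y \<in> F3 u z"
          proof (rule ccontr)
            assume neg: "\<not> (z \<in> F1 u y \<or> u \<in> F2 z y \<or> y \<in> F3 u z)"
            then have n0: "u \<notin> W" using y pt(3) WV by (auto simp: F1_def F2_def)
            have nZ: "z \<in> Z" using neg y n0 pt(2) Y0 by (auto simp: F2_def split: if_splits)
            then have uV: "u \<in> V" using neg y n0 by (auto simp: F1_def split: if_splits)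
            then obtain i where i: "i \<in> J y" "z \<in> Y i" using neg y n0 nZ by (auto simp: F1_def split: if_splits)
            then have "i \<noteq> 0" using neg y uV by (cases "i = 0") (auto simp: F2_def)
            then obtain e where e: "e \<in> I" "y \<in> N e" "i = col e" using i(1) by (auto simp: J_def)
            have "y \<in> (\<Union>e\<in>{e \<in> I. z \<in> Y (col e)}. N e)" using e i(2) by blast
            then show False using neg uV n0 by (simp add: F3_def)
          qed
          then have "x \<in> A" unfolding A_def using pt by blast
          then show False using x by blast
        qed
        then have "y \<in> ?B" using pt(4) by (auto simp: rich_def)
        then show "x \<in> (\<lambda>(u, z, y). point q p u z y) ` ?X"
          using pt by (intro image_eqI[of _ _ "(u, z, y)"]) auto
      qed
      then have "card (Pow {..<q + p + n} - A) \<le> card ?X"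
        by (rule surj_card_le[rotated]) (use finB in auto)
      also have "\<dots> = 2 ^ q * (2 ^ p * card ?B)"
        by (simp only: card_cartesian_product card_Pow[OF finite_lessThan] card_lessThan)
      also have "\<dots> \<le> 2 ^ q * (2 ^ p * (4 * (n + 1) ^ (2 * k)))"
        by (intro mult_left_mono card_few_ups) auto
      finally show ?thesis by (simp only: mult.assoc)
    qed
    ultimately show ?thesis by blast
  qed
  define c0 :: nat where "c0 = 2 ^ q * 2 ^ p * 4"
  show ?thesis
  proof (intro exI[of _ c0] allI)
    fix n
    show "\<exists>A \<subseteq> Pow {..<n}. tileable A \<and> card (Pow {..<n} - A) \<le> c0 * (n + 1) ^ (2 * k)"
    proof (cases "q + p \<le> n")
      case True
      define n' where "n' = n - (q + p)"
      have n: "n = q + p + n'" using True by (simp add: n'_def)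
      obtain A where A: "A \<subseteq> Pow {..<n}" "tileable A" "card (Pow {..<n} - A) \<le> 2 ^ q * 2 ^ p * (4 * (n' + 1) ^ (2 * k))"
        using main[of n'] unfolding n by blast
      have "(n' + 1) ^ (2 * k) \<le> (n + 1) ^ (2 * k)" using n by (intro power_mono) auto
      then have "2 ^ q * 2 ^ p * (4 * (n' + 1) ^ (2 * k)) \<le> c0 * (n + 1) ^ (2 * k)"
        by (simp add: c0_def)
      then show ?thesis using A by (meson le_trans)
    next
      case False
      \<comment> \<open>Below dimension \<open>q + p\<close> the empty family suffices, since
        \<open>c0\<close> already exceeds the number of points.\<close>
      have "card (Pow {..<n}) = 2 ^ n" by (simp add: card_Pow)
      also have "\<dots> \<le> 2 ^ (q + p)" using False by (intro power_increasing) auto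
      also have "\<dots> \<le> c0 * (n + 1) ^ (2 * k)" by (simp add: c0_def power_add)
      finally show ?thesis by (intro exI[of _ "{}"]) simp
    qed
  qed
qed

end

section \<open>Packings of the hypercube\<close>

definition cube_subgraph :: "nat \<Rightarrow> bool list set \<Rightarrow> (bool list, bool list \<times> bool list) pre_digraph" where
  "cube_subgraph n U = \<lparr> verts = U, arcs = {a \<in> parcs (hypercube n). fst a \<in> U \<and> snd a \<in> U},
     tail = fst, head = snd \<rparr>"

lemma wf_hypercube: "wf_digraph (with_proj (hypercube n))"
proof -
  interpret pair_graph "hypercube n" by (rule pair_graph_hypercube)
  show ?thesis ..
qed

lemma wf_cube_subgraph: "wf_digraph (cube_subgraph n U)"
  by unfold_locales (auto simp: cube_subgraph_def)

lemma induced_cube_subgraph: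
  assumes "U \<subseteq> pverts (hypercube n)"
  shows "induced_subgraph (cube_subgraph n U) (with_proj (hypercube n))"
  unfolding induced_subgraph_def subgraph_def
  using assms wf_hypercube wf_cube_subgraph by (auto simp: cube_subgraph_def compatible_def)

text \<open>Inducedness fixes the arcs, and compatibility with the cube fixes \<open>tail\<close>
  and \<open>head\<close>, so copies can be handled as vertex sets.\<close>

lemma induced_subgraph_hypercubeD:
  assumes "induced_subgraph C (with_proj (hypercube n))"
  shows "verts C \<subseteq> pverts (hypercube n)" "C = cube_subgraph n (verts C)"
proof -
  have *: "verts C \<subseteq> pverts (hypercube n)" "arcs C = {e \<in> parcs (hypercube n). fst e \<in> verts C \<and> snd e \<in> verts C}"
    "tail C = fst" "head C = snd"
    using assms by (auto simp: induced_subgraph_def subgraph_def compatible_def)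
  show "verts C \<subseteq> pverts (hypercube n)" by (fact *)
  show "C = cube_subgraph n (verts C)"
    by (rule pre_digraph.equality) (use * in \<open>auto simp: cube_subgraph_def\<close>)
qed

text \<open>Arcs are pairs of vertices, so the vertex map acts on them as
  \<open>map_prod \<psi> \<psi>\<close>; the equivalence of adjacencies makes this a bijection onto
  the arcs of the image.\<close>

lemma digraph_iso_cube_subgraph:
  assumes "inj_on \<psi> U"
    and "\<And>x y. x \<in> U \<Longrightarrow> y \<in> U \<Longrightarrow> (\<psi> x, \<psi> y) \<in> parcs (hypercube n) \<longleftrightarrow> (x, y) \<in> parcs (hypercube k)"
  shows "digraph_iso (cube_subgraph k U) (cube_subgraph n (\<psi> ` U))"
proof -
  let ?f = "\<lparr> iso_verts = \<psi>, iso_arcs = map_prod \<psi> \<psi>, iso_head = snd, iso_tail = fst \<rparr>"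
  have "inj_on (map_prod \<psi> \<psi>) (U \<times> U)" using assms(1) by (simp add: map_prod_inj_on)
  then have inj: "inj_on (map_prod \<psi> \<psi>) {a \<in> parcs (hypercube k). fst a \<in> U \<and> snd a \<in> U}"
    by (rule inj_on_subset) auto
  have "pre_digraph.digraph_isomorphism (cube_subgraph k U) ?f"
    unfolding pre_digraph.digraph_isomorphism_def
    using assms(1) inj wf_cube_subgraph[of k U] by (simp add: cube_subgraph_def)
  moreover have "cube_subgraph n (\<psi> ` U) = app_iso ?f (cube_subgraph k U)"
  proof (rule pre_digraph.equality)
    have "{a \<in> parcs (hypercube n). fst a \<in> \<psi> ` U \<and> snd a \<in> \<psi> ` U} =
        map_prod \<psi> \<psi> ` {a \<in> parcs (hypercube k). fst a \<in> U \<and> snd a \<in> U}"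
    proof (intro equalityI subsetI)
      fix a assume "a \<in> {a \<in> parcs (hypercube n). fst a \<in> \<psi> ` U \<and> snd a \<in> \<psi> ` U}"
      then obtain x y where "x \<in> U" "y \<in> U" "a = (\<psi> x, \<psi> y)" "(\<psi> x, \<psi> y) \<in> parcs (hypercube n)"
        by (cases a) auto
      then show "a \<in> map_prod \<psi> \<psi> ` {a \<in> parcs (hypercube k). fst a \<in> U \<and> snd a \<in> U}"
        using assms(2) by (intro image_eqI[of _ _ "(x, y)"]) auto
    qed (use assms(2) in auto)
    then show "arcs (cube_subgraph n (\<psi> ` U)) = arcs (app_iso ?f (cube_subgraph k U))"
      by (simp add: cube_subgraph_def)
  qed (simp_all add: cube_subgraph_def app_iso_def)
  ultimately show ?thesis unfolding digraph_iso_def by blast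
qed

section \<open>Boolean lists as characteristic vectors of sets\<close>

definition bits :: "nat \<Rightarrow> nat set \<Rightarrow> bool list" where
  "bits n x = map (\<lambda>i. i \<in> x) [0..<n]"

lemma bits_simps [simp]: "length (bits n x) = n" "i < n \<Longrightarrow> bits n x ! i \<longleftrightarrow> i \<in> x"
  by (simp_all add: bits_def)

lemma inj_on_bits: "inj_on (bits n) (Pow {..<n})"
proof (rule inj_onI)
  fix x y assume xy: "x \<in> Pow {..<n}" "y \<in> Pow {..<n}" "bits n x = bits n y"
  then have "i \<in> x \<longleftrightarrow> i \<in> y" if "i < n" for i using that by (metis bits_simps(2))
  then show "x = y" using xy(1,2) by blast
qed

lemma bits_image: "bits n ` Pow {..<n} = pverts (hypercube n)"
proof
  show "pverts (hypercube n) \<subseteq> bits n ` Pow {..<n}"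
  proof
    fix l assume "l \<in> pverts (hypercube n)"
    then have "l = bits n {i. i < n \<and> l ! i}" by (auto simp: hypercube_def intro: nth_equalityI)
    then show "l \<in> bits n ` Pow {..<n}" by blast
  qed
qed (auto simp: hypercube_def)

lemma arc_bits:
  assumes "x \<subseteq> {..<n}" "y \<subseteq> {..<n}"
  shows "(bits n x, bits n y) \<in> parcs (hypercube n) \<longleftrightarrow> card (x \<triangle> y) = 1"
proof -
  have "{i. i < n \<and> bits n x ! i \<noteq> bits n y ! i} = {i. i < n \<and> (i \<in> x) \<noteq> (i \<in> y)}"
    by (rule Collect_cong) auto
  also have "\<dots> = x \<triangle> y" using assms by auto
  finally show ?thesis by (simp add: hypercube_def)
qed

text \<open>The coordinate map of a tile is injective only on \<open>{..<k}\<close>, so a relative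
  version is called for.\<close>

lemma image_xr_on:
  assumes "inj_on f D" "x \<subseteq> D" "y \<subseteq> D"
  shows "f ` (x \<triangle> y) = f ` x \<triangle> f ` y"
proof -
  have xr: "a \<triangle> b = (a - b) \<union> (b - a)" for a b :: "'c set" by auto
  have "f ` (x - y) = f ` x - f ` y" "f ` (y - x) = f ` y - f ` x"
    using assms by (auto intro!: inj_on_image_set_diff[OF assms(1)])
  moreover have "x \<triangle> y = (x - y) \<union> (y - x)" by auto
  ultimately show ?thesis by (simp add: image_Un xr)
qed

definition diff_set :: "nat \<Rightarrow> bool list \<Rightarrow> bool list \<Rightarrow> nat set" where
  "diff_set k x y = {i. i < k \<and> x ! i \<noteq> y ! i}"

lemma diff_set_xr: "diff_set k x z \<triangle> diff_set k y z = diff_set k x y"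
  by (auto simp: diff_set_def)

theorem theorem1:
  fixes H :: "'a pair_pre_digraph"
  assumes "pair_graph H"
    and "pverts H \<noteq> {}"
    and "\<exists>k C. induced_copy (with_proj H) (with_proj (hypercube k)) C"
  shows "\<exists>c::real. \<exists>P. (\<forall>n. induced_packing (with_proj H) (with_proj (hypercube n)) (P n)) \<and>
           (\<lambda>n. real (card (uncovered (with_proj (hypercube n)) (P n)))) \<in> O(\<lambda>n. real n powr c)"
proof -
  obtain k C where C: "induced_subgraph C (with_proj (hypercube k))" "digraph_iso (with_proj H) C"
    using assms(3) unfolding induced_copy_def by blast
  define U where "U = verts C"
  have U: "U \<subseteq> pverts (hypercube k)" "C = cube_subgraph k U"
    using induced_subgraph_hypercubeD[OF C(1)] by (simp_all add: U_def)
  \<comment> \<open>A vertex of \<open>H\<close> yields a base point \<open>v0\<close>; translating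
    the copy by it puts \<open>{}\<close> into \<open>S\<close>.\<close>
  have "U \<noteq> {}" using C(2) assms(2) unfolding U_def digraph_iso_def by auto
  then obtain v0 where v0: "v0 \<in> U" by auto
  have len: "length x = k" if "x \<in> U" for x using U(1) that by (auto simp: hypercube_def)
  define S where "S = (\<lambda>x. diff_set k x v0) ` U"
  interpret shape k S
  proof
    show "S \<subseteq> Pow {..<k}" by (auto simp: S_def diff_set_def)
    have "diff_set k v0 v0 = {}" by (simp add: diff_set_def)
    then show "{} \<in> S" using v0 unfolding S_def by (metis imageI)
  qed
  have copy: "induced_copy (with_proj H) (with_proj (hypercube n)) (cube_subgraph n (bits n ` N))"
    if N: "tile N" "N \<subseteq> Pow {..<n}" for n N
  proof -
    obtain g f where gf: "inj_on f {..<k}" "N = (\<lambda>s. g \<triangle> f ` s) ` S" using N(1) by (auto simp: tile_def)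
    \<comment> \<open>Two image points differ exactly in the \<open>f\<close>-image of the places
      where the vertices differ. As \<open>f\<close> is injective there, distances and hence
      adjacency are preserved.\<close>
    define \<chi> where "\<chi> x = g \<triangle> f ` diff_set k x v0" for x
    have \<chi>N: "\<chi> ` U = N" unfolding gf(2) S_def \<chi>_def by auto
    have \<chi>n: "\<chi> x \<subseteq> {..<n}" if "x \<in> U" for x using \<chi>N N(2) that by blast
    have D: "diff_set k x y \<subseteq> {..<k}" for x y by (auto simp: diff_set_def)
    have \<chi>x: "\<chi> x \<triangle> \<chi> y = f ` diff_set k x y" for x y
    proof -
      have "\<chi> x \<triangle> \<chi> y = f ` diff_set k x v0 \<triangle> f ` diff_set k y v0" by (auto simp: \<chi>_def set_eq_iff)
      then show ?thesis using image_xr_on[OF gf(1) D D, of x v0 y v0] diff_set_xr by simp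
    qed
    have card_\<chi>: "card (\<chi> x \<triangle> \<chi> y) = card (diff_set k x y)" for x y
      unfolding \<chi>x by (rule card_image[OF inj_on_subset[OF gf(1) D]])
    have "digraph_iso (cube_subgraph k U) (cube_subgraph n ((bits n \<circ> \<chi>) ` U))"
    proof (rule digraph_iso_cube_subgraph)
      have "inj_on \<chi> U"
      proof (rule inj_onI)
        fix x y assume xy: "x \<in> U" "y \<in> U" "\<chi> x = \<chi> y"
        then have "diff_set k x y = {}" using \<chi>x[of x y] by simp
        then show "x = y" using len[OF xy(1)] len[OF xy(2)] by (auto simp: diff_set_def intro: nth_equalityI)
      qed
      moreover have "inj_on (bits n) (\<chi> ` U)" using \<chi>N N(2) by (metis inj_on_bits inj_on_subset)
      ultimately show "inj_on (bits n \<circ> \<chi>) U" by (rule comp_inj_on)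
      fix x y assume xy: "x \<in> U" "y \<in> U"
      have "(x, y) \<in> parcs (hypercube k) \<longleftrightarrow> card (diff_set k x y) = 1"
        using len[OF xy(1)] len[OF xy(2)] by (simp add: hypercube_def diff_set_def)
      then show "((bits n \<circ> \<chi>) x, (bits n \<circ> \<chi>) y) \<in> parcs (hypercube n) \<longleftrightarrow> (x, y) \<in> parcs (hypercube k)"
        using arc_bits[OF \<chi>n[OF xy(1)] \<chi>n[OF xy(2)]] card_\<chi>[of x y] by simp
    qed
    moreover have "(bits n \<circ> \<chi>) ` U = bits n ` N" by (simp only: image_comp[symmetric] \<chi>N)
    ultimately have "digraph_iso C (cube_subgraph n (bits n ` N))"
      using U(2) by simp
    then have "digraph_iso (with_proj H) (cube_subgraph n (bits n ` N))"
      using C(2) digraph_iso_trans by blast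
    moreover have "bits n ` N \<subseteq> pverts (hypercube n)" using N(2) bits_image by blast
    ultimately show ?thesis unfolding induced_copy_def using induced_cube_subgraph by blast
  qed
  obtain c0 where "\<forall>n. \<exists>A \<subseteq> Pow {..<n}. tileable A \<and> card (Pow {..<n} - A) \<le> c0 * (n + 1) ^ (2 * k)"
    using nearly_tile_cube by blast
  then obtain A where A: "\<And>n. A n \<subseteq> Pow {..<n}" "\<And>n. tileable (A n)"
    "\<And>n. card (Pow {..<n} - A n) \<le> c0 * (n + 1) ^ (2 * k)" by metis
  obtain \<P> where \<P>: "\<And>n N. N \<in> \<P> n \<Longrightarrow> tile N" "\<And>n. pairwise disjnt (\<P> n)" "\<And>n. \<Union>(\<P> n) = A n"
    using A(2) unfolding tileable_def by metis
  define P where "P n = (\<lambda>N. cube_subgraph n (bits n ` N)) ` \<P> n" for n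
  have sub: "N \<subseteq> Pow {..<n}" if "N \<in> \<P> n" for n N using \<P>(3) A(1) that by blast
  have "induced_packing (with_proj H) (with_proj (hypercube n)) (P n)" for n
    unfolding induced_packing_def
  proof
    show "\<forall>C\<in>P n. induced_copy (with_proj H) (with_proj (hypercube n)) C"
      unfolding P_def using copy \<P>(1) sub by blast
    show "pairwise (\<lambda>C D. disjnt (verts C) (verts D)) (P n)"
    proof (rule pairwiseI)
      fix C D assume CD: "C \<in> P n" "D \<in> P n" "C \<noteq> D"
      then obtain N M where NM: "N \<in> \<P> n" "M \<in> \<P> n" "C = cube_subgraph n (bits n ` N)"
        "D = cube_subgraph n (bits n ` M)" by (auto simp: P_def)
      then have "N \<noteq> M" using CD(3) by auto
      then have "N \<inter> M = {}"
        using \<P>(2)[of n] NM(1,2) unfolding pairwise_def disjnt_def by blast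
      then have "bits n ` N \<inter> bits n ` M = {}"
        using inj_on_image_Int[OF inj_on_bits sub[OF NM(1)] sub[OF NM(2)]] by simp
      then show "disjnt (verts C) (verts D)" using NM(3,4) by (simp add: cube_subgraph_def disjnt_def)
    qed
  qed
  moreover have "card (uncovered (with_proj (hypercube n)) (P n)) \<le> c0 * (n + 1) ^ (2 * k)" for n
  proof -
    have "(\<Union>C\<in>P n. verts C) = bits n ` A n" unfolding P_def cube_subgraph_def using \<P>(3)[of n] by auto
    then have "uncovered (with_proj (hypercube n)) (P n) = bits n ` Pow {..<n} - bits n ` A n"
      by (simp add: uncovered_def bits_image)
    also have "\<dots> = bits n ` (Pow {..<n} - A n)"
      using A(1)[of n] by (intro inj_on_image_set_diff[OF inj_on_bits, symmetric]) auto
    finally show ?thesis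
      by (simp only:) (rule le_trans[OF card_image_le A(3)], simp)
  qed
  note bound = this
  have "(\<lambda>n. real (card (uncovered (with_proj (hypercube n)) (P n)))) \<in> O(\<lambda>n. real n powr real (2 * k))"
  \<comment> \<open>The exponent is twice the dimension of a cube containing a copy of
    \<open>H\<close>; from \<open>n + 1 \<le> 2 * n\<close> for \<open>n \<ge> 1\<close> comes the
    factor \<open>2 ^ (2 * k)\<close>.\<close>
  proof (rule bigoI[of _ "real c0 * 2 ^ (2 * k)"], rule eventually_sequentiallyI[of 1])
    fix n :: nat assume n: "1 \<le> n"
    have "(n + 1) ^ (2 * k) \<le> (2 * n) ^ (2 * k)" using n by (intro power_mono) auto
    then have "c0 * (n + 1) ^ (2 * k) \<le> c0 * (2 * n) ^ (2 * k)" by (rule mult_left_mono) simp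
    then have "card (uncovered (with_proj (hypercube n)) (P n)) \<le> c0 * (2 * n) ^ (2 * k)"
      using bound[of n] by (rule le_trans[rotated])
    then have "real (card (uncovered (with_proj (hypercube n)) (P n))) \<le> real (c0 * (2 * n) ^ (2 * k))"
      by (simp only: of_nat_le_iff)
    also have "\<dots> = real c0 * 2 ^ (2 * k) * real n ^ (2 * k)" by (simp add: power_mult_distrib)
    also have "real n ^ (2 * k) = real n powr real (2 * k)" using n by (subst powr_realpow) auto
    finally show "norm (real (card (uncovered (with_proj (hypercube n)) (P n))))
        \<le> real c0 * 2 ^ (2 * k) * norm (real n powr real (2 * k))" by simp
  qed
  ultimately show ?thesis by blast
qed

end
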